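(* Let $(X,X^*,R,R^\vee)$ be a root system such that $R$ spans $X^*$ and $-1_X\in W=W(R)$. Fix a Weyl chamber $C_0$ in $X$ with corresponding Weyl chamber $C_0^\vee$ in $X^*$, and let $x_0\in C_0$, $\lambda_0\in C_0^\vee$. Define $d:W\to\mathbb{Z}$ by $d(w)=\bar c_R(x_0,w\lambda_0)$ and define $d^\vee:W\to\mathbb{Z}$ by $d^\vee(w)=\bar c_{R^\vee}(\lambda_0,wx_0)$ (the function obtained by applying the same construction to the root system $R^\vee$ and the chamber $C_0^\vee$, using $W(R^\vee)=W(R)$); these do not depend on the choice of $x_0,\lambda_0$. Then for all $w\in W$: (1) $d^\vee(w)=d(w)$; (2) $d(w^{-1})=(-1)^{q(R)}\epsilon(w)d(w)$, where $\epsilon(w)$ denotes the sign of $w$.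
   Context: Root systems are reduced. $X$ is a finite-dimensional real vector space, $X^*$ its dual, $R\subset X^*$ a root system, $R^\vee\subset X$ its coroots. $X_{\mathrm{reg}}$, $X^*_{\mathrm{reg}}$ are the unions of the (open) Weyl chambers in $X$ and $X^*$. $C_0^\vee=\{\lambda\in X^*:\lambda(\alpha^\vee)>0$ for all roots $\alpha$ positive on $C_0\}$. $q(R)=(|R^+|+\dim X)/2$, where $R^+$ is a set of positive roots; this is an integer because $-1_X\in W$. The stable discrete series constants $\bar c_R: X_{\mathrm{reg}}\times X^*_{\mathrm{reg}}\to\mathbb{Z}$ (one function for each root system with $R$ spanning $X^*$ and $-1_X\in W(R)$) occur in the character formulas for stable discrete series characters of real reductive groups. It is known that they satisfy: (i) $\bar c_R(0,0)=1$ if $R$ is empty; (ii) $\bar c_R(x,\lambda)$ depends only on the chambers of $x$ and $\lambda$; (iii) $\bar c_R(x,\lambda)=0$ unless $\lambda(x)\le0$; (iv) if $x,x'$ lie in adjacent chambers of $X$ separated only by the root hyperplane $Y$, then $\bar c_R(x,\lambda)+\bar c_R(x',\lambda)=2\bar c_{R_Y}(y,\lambda_Y)$, where $R_Y\subset Y^*$ is the root system whose set of coroots is $R^\vee\cap Y$, $\lambda_Y=\lambda|_Y$, and $y$ is the unique point of $Y$ on the segment joining $x$ and $x'$; (v) $\bar c_R(wx,w\lambda)=\bar c_R(x,\lambda)$ for $w\in W(R)$. The family is characterized uniquely by (i), (iii), (iv), which may be taken as its definition. *)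

theory Defs
  imports "HOL-Analysis.Analysis" "HOL-Library.Function_Algebras"
begin

text \<open>
  Passing to \<open>R\<^sub>Y\<close> changes the ambient space, so a finite-dimensional real vector space is a
  subspace \<open>X\<close> of a type of class \<^class>\<open>real_vector\<close>. Passing to \<open>R\<^sup>\<or>\<close> replaces \<open>X\<close> by its dual,
  so functions into a real vector space must form a real vector space too.
\<close>

instantiation "fun" :: (type, real_vector) real_vector
begin

definition scaleR_fun :: "real \<Rightarrow> ('a \<Rightarrow> 'b) \<Rightarrow> 'a \<Rightarrow> 'b"
  where "scaleR_fun a f = (\<lambda>x. a *\<^sub>R f x)"

instance
  by standard (auto simp: scaleR_fun_def fun_eq_iff scaleR_add_right scaleR_add_left)

end

lemma scaleR_fun_apply [simp]: "(a *\<^sub>R f) x = a *\<^sub>R f x"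
  by (simp add: scaleR_fun_def)

definition finite_dim_subspace :: "'v::real_vector set \<Rightarrow> bool"
  where "finite_dim_subspace X \<longleftrightarrow> (\<exists>B. finite B \<and> span B = X)"

text \<open>
  A linear functional on \<open>X\<close> is represented by the function on the whole type that vanishes
  outside \<open>X\<close>; this makes the representation unique.
\<close>

definition dual_space :: "'v::real_vector set \<Rightarrow> ('v \<Rightarrow> real) set" where
  "dual_space X = {f. (\<forall>x\<in>X. \<forall>y\<in>X. f (x + y) = f x + f y) \<and>
                      (\<forall>a. \<forall>x\<in>X. f (a *\<^sub>R x) = a * f x) \<and>
                      (\<forall>x. x \<notin> X \<longrightarrow> f x = 0)}"

definition restrict_functional :: "'v set \<Rightarrow> ('v \<Rightarrow> real) \<Rightarrow> 'v \<Rightarrow> real"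
  where "restrict_functional Y f = (\<lambda>y. if y \<in> Y then f y else 0)"

text \<open>The canonical map \<open>X \<rightarrow> X\<^sup>*\<^sup>*\<close>.\<close>

definition bidual :: "'v::real_vector set \<Rightarrow> 'v \<Rightarrow> ('v \<Rightarrow> real) \<Rightarrow> real"
  where "bidual X x = restrict_functional (dual_space X) (\<lambda>f. f x)"


section \<open>Root systems\<close>

definition is_coroot ::
    "'v::real_vector set \<Rightarrow> ('v \<Rightarrow> real) set \<Rightarrow> ('v \<Rightarrow> real) \<Rightarrow> 'v \<Rightarrow> bool" where
  "is_coroot X R \<alpha> h \<longleftrightarrow> h \<in> X \<and> \<alpha> h = 2 \<and> (\<lambda>\<beta>. \<beta> - \<beta> h *\<^sub>R \<alpha>) ` R = R"

text \<open>
  Reduced root systems \<open>R\<close> spanning \<open>X\<^sup>*\<close>. Because \<open>R\<close> is finite and spans \<open>X\<^sup>*\<close>, the coroot of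
  each root is unique, so \<open>R\<^sup>\<or>\<close> is determined by \<open>R\<close>.
\<close>

definition root_system :: "'v::real_vector set \<Rightarrow> ('v \<Rightarrow> real) set \<Rightarrow> bool" where
  "root_system X R \<longleftrightarrow>
     finite_dim_subspace X \<and> finite R \<and> R \<subseteq> dual_space X \<and> 0 \<notin> R \<and> span R = dual_space X \<and>
     (\<forall>\<alpha>\<in>R. \<exists>h. is_coroot X R \<alpha> h \<and> (\<forall>\<beta>\<in>R. \<beta> h \<in> \<int>)) \<and>
     (\<forall>\<alpha>\<in>R. \<forall>t::real. t *\<^sub>R \<alpha> \<in> R \<longrightarrow> t = 1 \<or> t = -1)"

definition coroot :: "'v::real_vector set \<Rightarrow> ('v \<Rightarrow> real) set \<Rightarrow> ('v \<Rightarrow> real) \<Rightarrow> 'v"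
  where "coroot X R \<alpha> = (THE h. is_coroot X R \<alpha> h)"

definition coroots :: "'v::real_vector set \<Rightarrow> ('v \<Rightarrow> real) set \<Rightarrow> 'v set"
  where "coroots X R = coroot X R ` R"

text \<open>The set \<open>R\<^sup>\<or>\<close> as a set of functionals on \<open>X\<^sup>*\<close>, that is, as a root system in \<open>(X\<^sup>*)\<^sup>* = X\<close>.\<close>

definition dual_roots :: "'v::real_vector set \<Rightarrow> ('v \<Rightarrow> real) set \<Rightarrow> (('v \<Rightarrow> real) \<Rightarrow> real) set"
  where "dual_roots X R = bidual X ` coroots X R"


section \<open>The Weyl group\<close>

text \<open>
  Roots vanish outside \<open>X\<close>, so reflections, and hence all elements of the Weyl group, are
  bijections of the whole type that are the identity outside \<open>X\<close>. In particular the group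
  operations are \<^term>\<open>(\<circ>)\<close> and \<^term>\<open>inv\<close>.
\<close>

definition reflection :: "'v::real_vector set \<Rightarrow> ('v \<Rightarrow> real) set \<Rightarrow> ('v \<Rightarrow> real) \<Rightarrow> 'v \<Rightarrow> 'v"
  where "reflection X R \<alpha> = (\<lambda>x. x - \<alpha> x *\<^sub>R coroot X R \<alpha>)"

inductive_set weyl_group :: "'v::real_vector set \<Rightarrow> ('v \<Rightarrow> real) set \<Rightarrow> ('v \<Rightarrow> 'v) set"
  for X :: "'v set" and R :: "('v \<Rightarrow> real) set" where
  id: "id \<in> weyl_group X R"
| reflection: "\<alpha> \<in> R \<Longrightarrow> w \<in> weyl_group X R \<Longrightarrow> reflection X R \<alpha> \<circ> w \<in> weyl_group X R"

text \<open>The contragredient action on \<open>X\<^sup>*\<close>.\<close>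

definition dual_action :: "('v \<Rightarrow> 'v) \<Rightarrow> ('v \<Rightarrow> real) \<Rightarrow> 'v \<Rightarrow> real"
  where "dual_action w lam = lam \<circ> inv w"

definition minus_one_in_weyl :: "'v::real_vector set \<Rightarrow> ('v \<Rightarrow> real) set \<Rightarrow> bool"
  where "minus_one_in_weyl X R \<longleftrightarrow> (\<exists>w\<in>weyl_group X R. \<forall>x\<in>X. w x = - x)"

text \<open>
  Each reflection has sign \<open>-1\<close>, so \<open>w\<close> has sign \<open>(-1)\<^sup>n\<close> for any expression of \<open>w\<close> as a product of
  \<open>n\<close> reflections; a shortest one is used to fix a value.
\<close>

definition weyl_sign :: "'v::real_vector set \<Rightarrow> ('v \<Rightarrow> real) set \<Rightarrow> ('v \<Rightarrow> 'v) \<Rightarrow> int" where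
  "weyl_sign X R w =
     (-1) ^ (LEAST n. \<exists>\<alpha>s. length \<alpha>s = n \<and> set \<alpha>s \<subseteq> R \<and>
                          w = foldr (\<circ>) (map (reflection X R) \<alpha>s) id)"


section \<open>Weyl chambers\<close>

definition regular :: "'v::real_vector set \<Rightarrow> ('v \<Rightarrow> real) set \<Rightarrow> 'v set"
  where "regular X R = {x\<in>X. \<forall>\<alpha>\<in>R. \<alpha> x \<noteq> 0}"

definition dual_regular :: "'v::real_vector set \<Rightarrow> ('v \<Rightarrow> real) set \<Rightarrow> ('v \<Rightarrow> real) set"
  where "dual_regular X R = {lam\<in>dual_space X. \<forall>h\<in>coroots X R. lam h \<noteq> 0}"

text \<open>
  The chamber of a regular point consists of the points on the same side of every root
  hyperplane.
\<close>

definition weyl_chambers :: "'v::real_vector set \<Rightarrow> ('v \<Rightarrow> real) set \<Rightarrow> 'v set set"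
  where "weyl_chambers X R = (\<lambda>x. {y\<in>X. \<forall>\<alpha>\<in>R. \<alpha> x * \<alpha> y > 0}) ` regular X R"

definition positive_roots :: "('v \<Rightarrow> real) set \<Rightarrow> 'v set \<Rightarrow> ('v \<Rightarrow> real) set"
  where "positive_roots R C = {\<alpha>\<in>R. \<forall>x\<in>C. \<alpha> x > 0}"

definition dual_chamber ::
    "'v::real_vector set \<Rightarrow> ('v \<Rightarrow> real) set \<Rightarrow> 'v set \<Rightarrow> ('v \<Rightarrow> real) set" where
  "dual_chamber X R C = {lam\<in>dual_space X. \<forall>\<alpha>\<in>positive_roots R C. lam (coroot X R \<alpha>) > 0}"

text \<open>The division is exact when \<open>-1\<close> lies in the Weyl group and \<open>C\<close> is a chamber.\<close>

definition q_of :: "'v::real_vector set \<Rightarrow> ('v \<Rightarrow> real) set \<Rightarrow> 'v set \<Rightarrow> nat"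
  where "q_of X R C = (card (positive_roots R C) + dim X) div 2"

definition separated_only_by ::
    "'v::real_vector set \<Rightarrow> ('v \<Rightarrow> real) set \<Rightarrow> ('v \<Rightarrow> real) \<Rightarrow> 'v \<Rightarrow> 'v \<Rightarrow> bool" where
  "separated_only_by X R \<alpha> x x' \<longleftrightarrow>
     \<alpha> x * \<alpha> x' < 0 \<and>
     (\<forall>\<beta>\<in>R. {z\<in>X. \<beta> z = 0} \<noteq> {z\<in>X. \<alpha> z = 0} \<longrightarrow> \<beta> x * \<beta> x' > 0)"


section \<open>Stable discrete series constants\<close>

text \<open>
  The properties that characterize the family \<open>c\<^sub>R(x, lam)\<close>. Only arguments \<open>X\<close>, \<open>R\<close> with \<open>R\<close> a
  root system spanning \<open>X\<^sup>*\<close> and \<open>-1\<close> in its Weyl group, and regular \<open>x\<close> and \<open>lam\<close>, matter.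
  In the last clause \<open>S\<close> is \<open>R\<^sub>Y\<close>, the root system in \<open>Y\<^sup>*\<close> whose set of coroots is \<open>R\<^sup>\<or> \<inter> Y\<close>; it
  exists, is unique and again has \<open>-1\<close> in its Weyl group.
\<close>

definition stable_ds_constants ::
    "('v::real_vector set \<Rightarrow> ('v \<Rightarrow> real) set \<Rightarrow> 'v \<Rightarrow> ('v \<Rightarrow> real) \<Rightarrow> int) \<Rightarrow> bool" where
  "stable_ds_constants c \<longleftrightarrow>
     c {0} {} 0 0 = 1 \<and>
     (\<forall>X R. root_system X R \<and> minus_one_in_weyl X R \<longrightarrow>
        (\<forall>x\<in>regular X R. \<forall>lam\<in>dual_regular X R. \<not> lam x \<le> 0 \<longrightarrow> c X R x lam = 0) \<and>
        (\<forall>x\<in>regular X R. \<forall>x'\<in>regular X R. \<forall>lam\<in>dual_regular X R. \<forall>\<alpha>\<in>R. \<forall>Y S y.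
           separated_only_by X R \<alpha> x x' \<longrightarrow>
           Y = {z\<in>X. \<alpha> z = 0} \<longrightarrow>
           root_system Y S \<longrightarrow>
           coroots Y S = coroots X R \<inter> Y \<longrightarrow>
           y \<in> Y \<inter> closed_segment x x' \<longrightarrow>
           c X R x lam + c X R x' lam = 2 * c Y S y (restrict_functional Y lam)))"

definition d_fun ::
    "('v::real_vector set \<Rightarrow> ('v \<Rightarrow> real) set \<Rightarrow> 'v \<Rightarrow> ('v \<Rightarrow> real) \<Rightarrow> int) \<Rightarrow>
     'v set \<Rightarrow> ('v \<Rightarrow> real) set \<Rightarrow> 'v \<Rightarrow> ('v \<Rightarrow> real) \<Rightarrow> ('v \<Rightarrow> 'v) \<Rightarrow> int" where
  "d_fun c X R x0 lam0 w = c X R x0 (dual_action w lam0)"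

text \<open>
  The same construction for \<open>R\<^sup>\<or>\<close>: here \<open>w\<close> acts on \<open>(X\<^sup>*)\<^sup>* = X\<close> through \<open>W(R\<^sup>\<or>) = W(R)\<close>.
\<close>

definition d_dual ::
    "(('v::real_vector \<Rightarrow> real) set \<Rightarrow> (('v \<Rightarrow> real) \<Rightarrow> real) set \<Rightarrow>
        ('v \<Rightarrow> real) \<Rightarrow> (('v \<Rightarrow> real) \<Rightarrow> real) \<Rightarrow> int) \<Rightarrow>
     'v set \<Rightarrow> ('v \<Rightarrow> real) set \<Rightarrow> 'v \<Rightarrow> ('v \<Rightarrow> real) \<Rightarrow> ('v \<Rightarrow> 'v) \<Rightarrow> int" where
  "d_dual c X R x0 lam0 w = c (dual_space X) (dual_roots X R) lam0 (bidual X (w x0))"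

end

theory Submission
  imports Defs
begin

text \<open>
  The form \<open>\<Sum>\<gamma>\<in>R. \<gamma>(x) \<gamma>(y)\<close> on \<open>X\<close> is positive definite and invariant under the Weyl group, so it
  identifies \<open>X\<close> with \<open>X\<^sup>*\<close>. Under this identification roots and coroots are positively proportional,
  hence \<open>R\<close> and \<open>R\<^sup>\<or>\<close> have the same hyperplanes, and \<open>C\<^sub>0\<^sup>\<or>\<close> becomes \<open>C\<^sub>0\<close>. The recursion that
  defines the constants only involves signs of inner products with coroots and the sign of the pairing
  \<open>\<lambda>(x)\<close>. It therefore makes sense for a finite reflection system \<open>H\<close> of vectors with an inner product,
  and it is studied there (locale \<open>minus_one_system\<close>).
  
  Iterating the passage from \<open>R\<close> to \<open>R\<^sub>Y\<close> leads to the systems \<open>perp A\<close> of all vectors of \<open>H\<close>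
  orthogonal to a set \<open>A\<close> of mutually orthogonal vectors of \<open>H\<close>. The whole family of constants becomes one
  function \<open>F A x y\<close>, where \<open>x\<close> and \<open>y\<close> range over the full space, only their projections orthogonal
  to \<open>A\<close> being relevant. The recursion is \<open>ds_recursion\<close>: the sum of the values of \<open>F A\<close> at two
  points on either side of a wall \<open>\<beta>\<close> is twice \<open>F (insert \<beta> A)\<close>, and \<open>F A x y = 0\<close> when the
  projections of \<open>x\<close> and \<open>y\<close> have positive inner product. It determines \<open>F\<close>
  (\<open>ds_recursion_unique\<close>), because a function that changes sign at every wall and vanishes at one regular
  point vanishes at all of them.
  
  Part (1) follows at once: the constants of \<open>R\<close> and those of \<open>R\<^sup>\<or>\<close> satisfy the same recursion, so they
  are the same function, with values depending only on the chambers of \<open>x\<close> and \<open>y\<close>. The two sides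
  of (1) are its values at \<open>(x\<^sub>0, w \<lambda>\<^sub>0)\<close> and \<open>(\<lambda>\<^sub>0, w x\<^sub>0)\<close>, where \<open>x\<^sub>0\<close> and
  \<open>\<lambda>\<^sub>0\<close> now lie in the same chamber.
  
  Part (2) is the symmetry \<open>F A x y = \<plusminus> F A y x\<close> (\<open>ds_recursion_swap\<close>), the sign being
  \<open>(-1)\<^sup>q\<close> times the sign of the group element that carries the chamber of \<open>x\<close> to that of \<open>y\<close>. By
  uniqueness it suffices that the right-hand side satisfies the recursion. The sign changes at a wall, so
  this amounts to a formula for the jump of \<open>F A x y\<close> when \<open>y\<close> crosses a wall \<open>\<alpha>\<close>: it is, up to an
  explicit sign, \<open>2 F (insert \<alpha> A) x y\<close> (\<open>ds_recursion_wall_formula\<close>). This is again proved by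
  uniqueness in \<open>x\<close>. At a wall \<open>\<beta>\<close> not orthogonal to \<open>\<alpha>\<close> both sides change sign, and at an
  orthogonal one induction applies, provided that the signs for \<open>A\<close>, \<open>A \<union> {\<alpha>}\<close>, \<open>A \<union> {\<beta>}\<close> and
  \<open>A \<union> {\<alpha>, \<beta>}\<close> are compatible (\<open>rel_sign_corner\<close>).
  
  That \<open>-1\<close> belongs to the Weyl group enters through the theorem that the stabilizer of a vector is
  generated by the reflections that it contains (\<open>stabilizer_generated_by_reflections\<close>): it implies that
  \<open>perp A\<close> inherits the property, so that the recursion can be iterated until \<open>perp A\<close> is empty and
  \<open>A\<close> is an orthogonal basis.
\<close>

lemma mult_neg_iff_of_same_sign:
  fixes a b c :: real
  assumes "a * b > 0"
  shows "c * b < 0 \<longleftrightarrow> c * a < 0"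
  using assms by (auto simp: zero_less_mult_iff mult_less_0_iff)

section \<open>Reflections in a symmetric bilinear form\<close>

text \<open>
  The form is defined on the whole type and only assumed symmetric. Later it is positive definite on a
  subspace that contains all reflecting vectors, and vectors outside matter only through their inner products
  with these. This avoids carrier sets for the points.
\<close>

locale symmetric_form =
  fixes ip :: "'v::real_vector \<Rightarrow> 'v \<Rightarrow> real"
  assumes ip_sym: "ip x y = ip y x"
    and ip_add: "ip (x + y) z = ip x z + ip y z"
    and ip_scale: "ip (a *\<^sub>R x) z = a * ip x z"
begin

lemma ip_add_right: "ip z (x + y) = ip z x + ip z y"
  by (metis ip_add ip_sym)

lemma ip_scale_right: "ip z (a *\<^sub>R x) = a * ip z x"
  by (metis ip_scale ip_sym)

lemma ip_zero [simp]: "ip 0 x = 0" "ip x 0 = 0"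
  using ip_scale[of 0 0 x] ip_scale_right[of x 0 0] by simp_all

lemma ip_minus [simp]: "ip (- x) y = - ip x y" "ip y (- x) = - ip y x"
  using ip_scale[of "-1" x y] ip_scale_right[of y "-1" x] by simp_all

lemma ip_diff: "ip (x - y) z = ip x z - ip y z" "ip z (x - y) = ip z x - ip z y"
  using ip_add[of x "- y" z] ip_add_right[of z x "- y"] by simp_all

lemma ip_sum: "ip (\<Sum>i\<in>I. f i) z = (\<Sum>i\<in>I. ip (f i) z)"
  by (induction I rule: infinite_finite_induct) (auto simp: ip_add)

lemma ip_sum_right: "ip z (\<Sum>i\<in>I. f i) = (\<Sum>i\<in>I. ip z (f i))"
  by (simp add: ip_sum ip_sym[of z])

lemmas ip_linear = ip_add ip_add_right ip_scale ip_scale_right ip_diff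

definition refl :: "'v \<Rightarrow> 'v \<Rightarrow> 'v"
  where "refl h x = x - (2 * ip x h / ip h h) *\<^sub>R h"

inductive_set group_of :: "'v set \<Rightarrow> ('v \<Rightarrow> 'v) set" for Q :: "'v set" where
  group_id: "id \<in> group_of Q"
| group_refl: "h \<in> Q \<Longrightarrow> w \<in> group_of Q \<Longrightarrow> refl h \<circ> w \<in> group_of Q"

definition reg :: "'v set \<Rightarrow> 'v \<Rightarrow> bool"
  where "reg Q x \<longleftrightarrow> (\<forall>h\<in>Q. ip x h \<noteq> 0)"

text \<open>
  The strict inequalities force both points to be regular, here and for adjacency.
\<close>

definition same_chamber :: "'v set \<Rightarrow> 'v \<Rightarrow> 'v \<Rightarrow> bool"
  where "same_chamber Q x x' \<longleftrightarrow> (\<forall>h\<in>Q. ip x h * ip x' h > 0)"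

definition adjacent :: "'v set \<Rightarrow> 'v \<Rightarrow> 'v \<Rightarrow> 'v \<Rightarrow> bool"
  where "adjacent Q \<beta> x x' \<longleftrightarrow> \<beta> \<in> Q \<and> ip x \<beta> * ip x' \<beta> < 0 \<and>
           (\<forall>h\<in>Q. h \<noteq> \<beta> \<longrightarrow> h \<noteq> - \<beta> \<longrightarrow> ip x h * ip x' h > 0)"

lemma group_comp: "u \<in> group_of Q \<Longrightarrow> w \<in> group_of Q \<Longrightarrow> u \<circ> w \<in> group_of Q"
  by (induction u rule: group_of.induct) (auto intro: group_of.intros simp: o_assoc[symmetric])

lemma group_single: "h \<in> Q \<Longrightarrow> refl h \<in> group_of Q"
  using group_refl[OF _ group_id, of h Q] by simp

lemma group_mono: assumes "Q \<subseteq> Q'" shows "group_of Q \<subseteq> group_of Q'"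
proof
  fix w assume "w \<in> group_of Q" then show "w \<in> group_of Q'"
    by (induction rule: group_of.induct) (use assms group_of.intros in blast)+
qed

lemma refl_refl: assumes "ip h h \<noteq> 0" shows "refl h (refl h x) = x"
  using assms by (simp add: refl_def ip_linear field_simps)

lemma refl_isometry: assumes "ip h h \<noteq> 0" shows "ip (refl h x) (refl h y) = ip x y"
  using assms by (simp add: refl_def ip_linear field_simps ip_sym[of h y])

lemma refl_adjoint: assumes "ip h h \<noteq> 0" shows "ip (refl h x) y = ip x (refl h y)"
  using refl_isometry[OF assms, of x "refl h y"] refl_refl[OF assms] by simp

lemma refl_linear: "linear (refl h)"
  by (rule linearI) (auto simp: refl_def ip_linear algebra_simps add_divide_distrib)

lemma refl_minus [simp]: "refl h (- x) = - refl h x"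
  by (simp add: refl_def)

lemma refl_neg [simp]: "refl (- h) = refl h"
  by (rule ext) (simp add: refl_def)

lemma refl_self: assumes "ip h h \<noteq> 0" shows "refl h h = - h"
  using assms scaleR_2[of h] by (simp add: refl_def)

lemma refl_fix: "ip x h = 0 \<Longrightarrow> refl h x = x"
  by (simp add: refl_def)

lemma refl_conj:
  assumes "linear w" "\<And>x y. ip (w x) (w y) = ip x y"
  shows "refl (w h) (w x) = w (refl h x)"
  by (simp add: refl_def assms linear_diff linear_cmul)

lemma same_chamber_trans:
  "same_chamber Q x y \<Longrightarrow> same_chamber Q y z \<Longrightarrow> same_chamber Q x z"
  unfolding same_chamber_def by (meson zero_less_mult_iff less_asym)

lemma same_chamber_sym: "same_chamber Q x y \<Longrightarrow> same_chamber Q y x"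
  by (simp add: same_chamber_def mult.commute)

lemma same_chamber_refl: "reg Q x \<Longrightarrow> same_chamber Q x x"
  by (metis same_chamber_def reg_def not_real_square_gt_zero)

lemma same_chamber_reg: "same_chamber Q x y \<Longrightarrow> reg Q x" "same_chamber Q x y \<Longrightarrow> reg Q y"
  by (force simp: same_chamber_def reg_def)+

lemma same_chamber_mono: "same_chamber Q x y \<Longrightarrow> Q' \<subseteq> Q \<Longrightarrow> same_chamber Q' x y"
  by (auto simp: same_chamber_def)

lemma reg_mono: "reg Q x \<Longrightarrow> Q' \<subseteq> Q \<Longrightarrow> reg Q' x"
  by (auto simp: reg_def)

lemma adjacent_same_left: "same_chamber Q u x \<Longrightarrow> adjacent Q \<beta> x x' \<Longrightarrow> adjacent Q \<beta> u x'"
  unfolding same_chamber_def adjacent_def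
  by (smt (verit, ccfv_threshold) mult_less_0_iff zero_less_mult_iff)

lemma adjacent_reg: "adjacent Q \<beta> x x' \<Longrightarrow> reg Q x" "adjacent Q \<beta> x x' \<Longrightarrow> reg Q x'"
proof -
  assume a: "adjacent Q \<beta> x x'"
  have "ip x h \<noteq> 0 \<and> ip x' h \<noteq> 0" if "h \<in> Q" for h
  proof (cases "h = \<beta> \<or> h = - \<beta>")
    case True
    then show ?thesis using a by (auto simp: adjacent_def)
  next
    case False
    then have "ip x h * ip x' h > 0" using a that by (auto simp: adjacent_def)
    then show ?thesis by auto
  qed
  then show "reg Q x" "reg Q x'" by (auto simp: reg_def)
qed

text \<open>
  Adjacency fixes the sign at every vector, so a chamber has only one neighbour across a given wall.
\<close>

lemma adjacent_unique:
  assumes "adjacent Q \<beta> x u" "adjacent Q \<beta> x v"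
  shows "same_chamber Q u v"
  unfolding same_chamber_def
proof
  fix h assume h: "h \<in> Q"
  consider "h = \<beta>" | "h = - \<beta>" | "h \<noteq> \<beta>" "h \<noteq> - \<beta>" by blast
  then show "ip u h * ip v h > 0"
    by cases (use assms h in \<open>auto simp: adjacent_def zero_less_mult_iff mult_less_0_iff\<close>, (metis less_asym)+)
qed

lemma reg_negate: "reg Q x \<Longrightarrow> reg Q (- x)"
  by (simp add: reg_def)

end

section \<open>Chambers of a finite reflection system\<close>

lemma small_step_keeps_signs:
  fixes a b :: "'a \<Rightarrow> real"
  assumes "finite T"
  shows "\<exists>\<epsilon>>0. \<forall>u\<in>T. a u \<noteq> 0 \<longrightarrow> a u * (a u + \<epsilon> * b u) > 0"
proof -
  have "eventually (\<lambda>\<epsilon>. a u \<noteq> 0 \<longrightarrow> a u * (a u + \<epsilon> * b u) > 0) (at_right 0)" for u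
  proof (cases "a u = 0")
    case False
    have "((\<lambda>\<epsilon>. a u * (a u + \<epsilon> * b u)) \<longlongrightarrow> a u * (a u + 0 * b u)) (at_right 0)"
      by (intro tendsto_intros)
    moreover have "a u * (a u + 0 * b u) > 0" using False by (metis add_0_right mult_zero_left not_real_square_gt_zero)
    ultimately show ?thesis by (auto dest: order_tendstoD(1) elim: eventually_mono)
  qed simp
  then have "eventually (\<lambda>\<epsilon>. \<forall>u\<in>T. a u \<noteq> 0 \<longrightarrow> a u * (a u + \<epsilon> * b u) > 0) (at_right 0)"
    using assms by (simp add: eventually_ball_finite)
  moreover have "eventually (\<lambda>\<epsilon>::real. \<epsilon> > 0) (at_right 0)"
    by (simp add: eventually_at_right_less)
  ultimately have "eventually (\<lambda>\<epsilon>. \<epsilon> > 0 \<and> (\<forall>u\<in>T. a u \<noteq> 0 \<longrightarrow> a u * (a u + \<epsilon> * b u) > 0)) (at_right 0)"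
    by eventually_elim auto
  then show ?thesis
    using eventually_happens' trivial_limit_at_right_real by blast
qed

locale reflection_system = symmetric_form ip for ip :: "'v::real_vector \<Rightarrow> 'v \<Rightarrow> real" +
  fixes H :: "'v set"
  assumes finite_H: "finite H"
    and zero_notin_H: "0 \<notin> H"
    and ip_pos: "x \<in> span H \<Longrightarrow> x \<noteq> 0 \<Longrightarrow> ip x x > 0"
    and refl_closed: "h \<in> H \<Longrightarrow> k \<in> H \<Longrightarrow> refl h k \<in> H"
    and reduced: "h \<in> H \<Longrightarrow> t *\<^sub>R h \<in> H \<Longrightarrow> t = 1 \<or> t = -1"
begin

lemma norm_pos: "h \<in> H \<Longrightarrow> ip h h > 0"
  using ip_pos[of h] zero_notin_H span_base by metis

lemma norm_nz: "h \<in> H \<Longrightarrow> ip h h \<noteq> 0"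
  using norm_pos by force

lemma neg_closed: "h \<in> H \<Longrightarrow> - h \<in> H"
  using refl_closed[of h h] refl_self norm_nz by metis

lemma subsystem:
  assumes "Q \<subseteq> H" "\<And>h k. h \<in> Q \<Longrightarrow> k \<in> Q \<Longrightarrow> refl h k \<in> Q"
  shows "reflection_system ip Q"
proof unfold_locales
  show "finite Q" using assms finite_H finite_subset by blast
  show "0 \<notin> Q" using assms zero_notin_H by blast
  show "x \<in> span Q \<Longrightarrow> x \<noteq> 0 \<Longrightarrow> ip x x > 0" for x
    using ip_pos span_mono[OF assms(1)] by blast
  show "h \<in> Q \<Longrightarrow> t *\<^sub>R h \<in> Q \<Longrightarrow> t = 1 \<or> t = -1" for h t
    using assms(1) reduced by blast
qed (use assms in auto)

text \<open>
  The vectors \<open>f \<in> S\<close> are treated one at a time: a small step in the direction \<open>f\<close> moves the point off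
  the hyperplane of \<open>f\<close> without changing any of the finitely many signs already obtained.
\<close>

lemma perturb:
  assumes "finite T" "finite S" "\<And>f. f \<in> S \<Longrightarrow> ip f f > 0"
  shows "\<exists>x'. (\<forall>f\<in>S. ip x' f \<noteq> 0) \<and> (\<forall>u\<in>T. ip x u \<noteq> 0 \<longrightarrow> ip x u * ip x' u > 0)"
  using assms(2,3)
proof (induction S)
  case empty
  then show ?case by (intro exI[of _ x]) (use not_real_square_gt_zero in blast)
next
  case (insert f S)
  then obtain x1 where x1: "\<forall>f\<in>S. ip x1 f \<noteq> 0" "\<forall>u\<in>T. ip x u \<noteq> 0 \<longrightarrow> ip x u * ip x1 u > 0" by auto
  obtain e where e: "e > 0" "\<forall>u\<in>T \<union> S \<union> {f}. ip x1 u \<noteq> 0 \<longrightarrow> ip x1 u * (ip x1 u + e * ip f u) > 0"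
    using small_step_keeps_signs[of "T \<union> S \<union> {f}" "ip x1" "ip f"] assms(1) insert by auto
  have f: "ip f f > 0" using insert by auto
  show ?case
  proof (intro exI[of _ "x1 + e *\<^sub>R f"] conjI ballI impI)
    fix g assume g: "g \<in> insert f S"
    show "ip (x1 + e *\<^sub>R f) g \<noteq> 0"
    proof (cases "ip x1 g = 0")
      case True then show ?thesis using g x1 f e(1) by (auto simp: ip_linear)
    next
      case False then have "ip x1 g * (ip x1 g + e * ip f g) > 0" using e g by auto
      then show ?thesis by (auto simp: ip_linear)
    qed
  next
    fix u assume u: "u \<in> T" "ip x u \<noteq> 0"
    then have "ip x u * ip x1 u > 0" using x1 by auto
    moreover have "ip x1 u \<noteq> 0" using calculation by auto
    then have "ip x1 u * (ip x1 u + e * ip f u) > 0" using e(2) u(1) by blast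
    ultimately show "ip x u * ip (x1 + e *\<^sub>R f) u > 0"
      by (simp only: ip_linear zero_less_mult_iff) linarith
  qed
qed

lemma perturb_regular:
  assumes "finite T"
  shows "\<exists>x'. reg H x' \<and> (\<forall>u\<in>T. ip x u \<noteq> 0 \<longrightarrow> ip x u * ip x' u > 0)"
  using perturb[OF assms finite_H norm_pos] by (auto simp: reg_def)

lemma not_parallel:
  assumes "h \<in> H" "k \<in> H" "k \<noteq> h" "k \<noteq> - h" "a \<noteq> 0"
  shows "ip (a *\<^sub>R k + b *\<^sub>R h) (a *\<^sub>R k + b *\<^sub>R h) > 0"
proof (rule ip_pos)
  show "a *\<^sub>R k + b *\<^sub>R h \<in> span H"
    using assms by (intro span_add span_scale span_base)
  show "a *\<^sub>R k + b *\<^sub>R h \<noteq> 0"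
  proof
    assume 0: "a *\<^sub>R k + b *\<^sub>R h = 0"
    have "k = (1 / a) *\<^sub>R (a *\<^sub>R k)" using assms by simp
    also have "a *\<^sub>R k = (- b) *\<^sub>R h" using 0 by (simp add: eq_neg_iff_add_eq_0)
    finally have "k = (- b / a) *\<^sub>R h" by simp
    with reduced[of h "- b / a"] assms show False by auto
  qed
qed

text \<open>
  Chambers are connected through walls. After a perturbation of \<open>x'\<close> to \<open>y\<close>, the segment from \<open>x\<close> to
  \<open>y\<close> crosses the separating hyperplanes one at a time, and one moves to a point just behind the first of
  them. The point at which it meets the hyperplane of \<open>h\<close> is governed by \<open>\<rho> h = - ip y h / ip x h\<close>:
  the larger this ratio, the earlier the crossing.
\<close>

lemma chamber_chain:
  assumes "reg H x" "reg H x'" "P x"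
    and step: "\<And>\<beta> u u'. adjacent H \<beta> u u' \<Longrightarrow> P u \<Longrightarrow> P u'"
    and same: "\<And>u u'. same_chamber H u u' \<Longrightarrow> P u \<Longrightarrow> P u'"
  shows "P x'"
  using assms(1-3)
proof (induction "card {h\<in>H. ip x h * ip x' h < 0}" arbitrary: x x' rule: less_induct)
  case less
  let ?sep = "\<lambda>x x'. {h\<in>H. ip x h * ip x' h < 0}"
  show ?case
  proof (cases "?sep x x' = {}")
    case True
    have "ip x h * ip x' h > 0" if "h \<in> H" for h
    proof -
      have "ip x h \<noteq> 0" "ip x' h \<noteq> 0" using that less.prems by (auto simp: reg_def)
      then have "ip x h * ip x' h \<noteq> 0" by simp
      moreover have "\<not> ip x h * ip x' h < 0" using that True by blast
      ultimately show ?thesis by linarith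
    qed
    then have "same_chamber H x x'" by (simp add: same_chamber_def)
    then show ?thesis using same less.prems by blast
  next
    case False
    \<comment> \<open>at a point not orthogonal to any of these vectors, different hyperplanes have different ratios \<open>\<rho>\<close>\<close>
    define S where "S = (\<lambda>(h, k). ip x h *\<^sub>R k + (- ip x k) *\<^sub>R h) ` {(h, k) \<in> H \<times> H. k \<noteq> h \<and> k \<noteq> - h}"
    have "finite S"
      unfolding S_def by (intro finite_imageI finite_subset[OF _ finite_cartesian_product[OF finite_H finite_H]]) auto
    moreover have "ip f f > 0" if "f \<in> S" for f
      using that less.prems(1) by (auto simp: S_def reg_def simp del: scaleR_minus_left intro!: not_parallel)
    ultimately obtain y where y: "\<forall>f\<in>S. ip y f \<noteq> 0" "\<forall>u\<in>H. ip x' u \<noteq> 0 \<longrightarrow> ip x' u * ip y u > 0"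
      using perturb[OF finite_H, of S x'] by blast
    have same_y: "same_chamber H x' y" using y less.prems by (auto simp: same_chamber_def reg_def)
    then have reg_y: "reg H y" by (rule same_chamber_reg)
    have sep_y: "?sep x y = ?sep x x'"
    proof -
      have "ip x h * ip y h < 0 \<longleftrightarrow> ip x h * ip x' h < 0" if "h \<in> H" for h
        using same_y that by (intro mult_neg_iff_of_same_sign) (simp add: same_chamber_def)
      then show ?thesis by blast
    qed
    define \<rho> where "\<rho> h = - ip y h / ip x h" for h
    have \<rho>_inj: "\<rho> h \<noteq> \<rho> k" if "h \<in> H" "k \<in> H" "k \<noteq> h" "k \<noteq> - h" for h k
    proof
      assume "\<rho> h = \<rho> k"
      moreover have "ip x h \<noteq> 0" "ip x k \<noteq> 0" using that less.prems by (auto simp: reg_def)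
      ultimately have "ip x h * ip y k - ip x k * ip y h = 0" by (simp add: \<rho>_def field_simps)
      moreover have "ip x h *\<^sub>R k + (- ip x k) *\<^sub>R h \<in> S" unfolding S_def using that by force
      then have "ip y (ip x h *\<^sub>R k + (- ip x k) *\<^sub>R h) \<noteq> 0" using y by blast
      then have "ip x h * ip y k - ip x k * ip y h \<noteq> 0" by (simp add: ip_linear del: scaleR_minus_left)
      ultimately show False by simp
    qed
    have fin: "finite (?sep x y)" using finite_H by simp
    have "?sep x y \<noteq> {}" using False sep_y by simp
    then have "Max (\<rho> ` ?sep x y) \<in> \<rho> ` ?sep x y" using fin by (intro Max_in) auto
    then obtain \<beta> where \<beta>: "\<beta> \<in> ?sep x y" "Max (\<rho> ` ?sep x y) = \<rho> \<beta>" by auto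
    have \<beta>_max: "\<rho> h \<le> \<rho> \<beta>" if "h \<in> ?sep x y" for h
    proof -
      have "\<rho> h \<le> Max (\<rho> ` ?sep x y)" using that fin by (intro Max_ge) auto
      then show ?thesis using \<beta>(2) by simp
    qed
    have \<rho>\<beta>: "\<rho> \<beta> > 0" using \<beta>(1) by (auto simp: \<rho>_def mult_less_0_iff divide_less_0_iff)
    define M where "M = insert 0 (\<rho> ` (?sep x y - {\<beta>, - \<beta>}))"
    have "finite M" using fin by (simp add: M_def)
    have "m < \<rho> \<beta>" if m: "m \<in> M" for m
    proof (cases "m = 0")
      case True then show ?thesis using \<rho>\<beta> by simp
    next
      case False
      then obtain h where h: "h \<in> ?sep x y" "h \<noteq> \<beta>" "h \<noteq> - \<beta>" "m = \<rho> h"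
        using m by (auto simp: M_def)
      then show ?thesis using \<beta>_max[OF h(1)] \<rho>_inj[of \<beta> h] \<beta>(1) by auto
    qed
    then have "Max M < \<rho> \<beta>" using \<open>finite M\<close> by (simp add: M_def)
    then obtain r where r: "Max M < r" "r < \<rho> \<beta>" using dense by blast
    have rM: "m < r" if "m \<in> M" for m using Max_ge[OF \<open>finite M\<close> that] r(1) by linarith
    have r0: "r > 0" using rM by (simp add: M_def)
    define u where "u = r *\<^sub>R x + y"
    have ipu: "ip u h = r * ip x h + ip y h" for h by (simp add: u_def ip_linear)
    have sign_u: "ip u h * ip x h = (ip x h)\<^sup>2 * (r - \<rho> h)" if "h \<in> H" for h
    proof -
      have "ip x h \<noteq> 0" using that less.prems by (auto simp: reg_def)
      then show ?thesis by (simp add: ipu \<rho>_def field_simps power2_eq_square)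
    qed
    have \<beta>H: "\<beta> \<in> H" using \<beta> by simp
    have adj: "adjacent H \<beta> x u"
      unfolding adjacent_def
    proof (intro conjI ballI impI)
      show "\<beta> \<in> H" by (fact \<beta>H)
      have "ip x \<beta> \<noteq> 0" using \<beta> by auto
      then show "ip x \<beta> * ip u \<beta> < 0"
        using sign_u[OF \<beta>H] r(2) by (simp add: mult.commute mult_less_0_iff)
      fix h assume h: "h \<in> H" "h \<noteq> \<beta>" "h \<noteq> - \<beta>"
      have nz: "ip x h \<noteq> 0" using h less.prems by (auto simp: reg_def)
      have "\<rho> h < r"
      proof (cases "h \<in> ?sep x y")
        case True then show ?thesis using rM h by (auto simp: M_def)
      next
        case False
        then have "ip x h * ip y h \<ge> 0" using h by auto
        then have "\<rho> h \<le> 0" using nz by (auto simp: \<rho>_def divide_le_0_iff zero_le_mult_iff zero_le_divide_iff)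
        then show ?thesis using r0 by simp
      qed
      then show "ip x h * ip u h > 0" using sign_u[OF h(1)] nz by (simp add: mult.commute)
    qed
    have reg_u: "reg H u" using adjacent_reg adj by blast
    have "P u" using step[OF adj] less.prems by blast
    have sub: "?sep u y \<subseteq> ?sep x y - {\<beta>}"
    proof
      fix h assume h: "h \<in> ?sep u y"
      then have hH: "h \<in> H" by simp
      have "ip u h * ip y h = r * (ip x h * ip y h) + (ip y h)\<^sup>2"
        by (simp add: ipu power2_eq_square algebra_simps)
      moreover have "(ip y h)\<^sup>2 \<ge> 0" "ip u h * ip y h < 0" using h by auto
      ultimately have "r * (ip x h * ip y h) < 0" by linarith
      then have 1: "ip x h * ip y h < 0" using r0 by (auto simp: mult_less_0_iff)
      have "h \<noteq> \<beta>"
      proof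
        assume "h = \<beta>"
        then have "ip x h * ip u h < 0" using adj by (simp add: adjacent_def)
        then show False using 1 h by (auto simp: mult_less_0_iff)
      qed
      then show "h \<in> ?sep x y - {\<beta>}" using 1 hH by simp
    qed
    have "card (?sep u y) < card (?sep x y)"
      using sub \<beta>(1) fin by (intro psubset_card_mono) auto
    then have "P y" using less.hyps[of u y] sep_y reg_u reg_y \<open>P u\<close> by simp
    then show ?thesis using same same_chamber_sym[OF same_y] by blast
  qed
qed

end

section \<open>Stabilizers in the reflection group\<close>

context reflection_system
begin

lemma refl_image: assumes "h \<in> H" shows "refl h ` H = H"
proof
  show "refl h ` H \<subseteq> H" using assms refl_closed by blast
  show "H \<subseteq> refl h ` H"
  proof
    fix k assume "k \<in> H"
    then show "k \<in> refl h ` H"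
      using refl_refl[OF norm_nz[OF assms], of k] refl_closed[OF assms, of k] by (metis imageI)
  qed
qed

lemma group_props:
  assumes "w \<in> group_of H"
  shows "linear w \<and> (\<forall>x y. ip (w x) (w y) = ip x y) \<and> w ` H = H \<and> bij w \<and> inv w \<in> group_of H"
  using assms
proof induction
  case group_id
  then show ?case using group_of.group_id[of H] linear_id inv_id bij_id by (metis id_apply image_id)
next
  case (group_refl h w)
  have rr: "refl h (refl h x) = x" for x using refl_refl norm_nz group_refl.hyps(1) by blast
  have inv_h: "inv (refl h) = refl h" by (rule inv_equality) (rule rr)+
  have bij_h: "bij (refl h)" by (rule bijI[OF inj_on_inverseI[of _ "refl h"] surjI[of _ "refl h"]]) (rule rr)+
  have "inv (refl h \<circ> w) = inv w \<circ> refl h"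
    using inv_h bij_h group_refl by (simp add: o_inv_distrib)
  moreover have "inv w \<circ> refl h \<in> group_of H"
    using group_refl group_comp group_single by blast
  moreover have "(refl h \<circ> w) ` H = H" using group_refl refl_image by (metis image_comp)
  moreover have "linear (refl h \<circ> w)" using group_refl refl_linear linear_compose by blast
  moreover have "bij (refl h \<circ> w)" using group_refl bij_h bij_comp by blast
  moreover have "ip ((refl h \<circ> w) x) ((refl h \<circ> w) y) = ip x y" for x y
    using group_refl refl_isometry[OF norm_nz] by simp
  ultimately show ?case by metis
qed

lemmas group_linear = group_props[THEN conjunct1]
  and group_isometry = group_props[THEN conjunct2, THEN conjunct1, rule_format]
  and group_image = group_props[THEN conjunct2, THEN conjunct2, THEN conjunct1]
  and group_bij = group_props[THEN conjunct2, THEN conjunct2, THEN conjunct2, THEN conjunct1]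
  and group_inv = group_props[THEN conjunct2, THEN conjunct2, THEN conjunct2, THEN conjunct2]

lemma group_inv_apply:
  assumes "w \<in> group_of H" shows "inv w (w x) = x" "w (inv w x) = x"
  using group_bij[OF assms] by (simp_all add: bij_is_inj bij_is_surj surj_f_inv_f)

lemma group_adjoint:
  assumes "w \<in> group_of H" shows "ip (w x) y = ip x (inv w y)"
  using group_isometry[OF assms, of x "inv w y"] group_inv_apply[OF assms] by simp

lemma group_closed: "w \<in> group_of H \<Longrightarrow> h \<in> H \<Longrightarrow> w h \<in> H"
  using group_image by blast

lemma same_chamber_group:
  assumes "w \<in> group_of H" "same_chamber H x y" shows "same_chamber H (w x) (w y)"
  using assms(2) group_closed[OF group_inv[OF assms(1)]]
  by (simp add: same_chamber_def group_adjoint[OF assms(1)])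

lemma adjacent_group:
  assumes "w \<in> group_of H" "adjacent H \<beta> x y" shows "adjacent H (w \<beta>) (w x) (w y)"
  unfolding adjacent_def
proof (intro conjI ballI impI)
  show "w \<beta> \<in> H" using assms group_closed by (auto simp: adjacent_def)
  show "ip (w x) (w \<beta>) * ip (w y) (w \<beta>) < 0" using assms by (simp add: adjacent_def group_isometry)
  fix h assume h: "h \<in> H" "h \<noteq> w \<beta>" "h \<noteq> - w \<beta>"
  have "inv w h \<noteq> \<beta>" "inv w h \<noteq> - \<beta>"
    using h group_inv_apply[OF assms(1)] linear_neg[OF group_linear[OF assms(1)]] by metis+
  then show "ip (w x) h * ip (w y) h > 0"
    using assms(2) h group_closed[OF group_inv[OF assms(1)]]
    by (simp add: adjacent_def group_adjoint[OF assms(1)])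
qed

lemma reg_group: "w \<in> group_of H \<Longrightarrow> reg H x \<Longrightarrow> reg H (w x)"
  using group_closed[OF group_inv] by (simp add: reg_def group_adjoint)

text \<open>
  The reflection in a wall of a chamber permutes the positive vectors other than the wall itself. A point
  \<open>y\<close> in the relative interior of the wall shows this: it is fixed by the reflection, so it has the same
  inner product with \<open>h\<close> and with its image, and close to it all signs are those at \<open>x\<close>.
\<close>

lemma wall_reflection_keeps_sign:
  assumes "adjacent H \<beta> x x'" "h \<in> H" "h \<noteq> \<beta>" "h \<noteq> - \<beta>"
  shows "ip x h * ip x (refl \<beta> h) > 0"
proof -
  define k where "k = refl \<beta> h"
  have \<beta>: "\<beta> \<in> H" using assms by (simp add: adjacent_def)
  have k: "k \<in> H" "k \<noteq> \<beta>" "k \<noteq> - \<beta>"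
    using refl_closed[OF \<beta> assms(2)] assms(3,4) refl_refl[OF norm_nz[OF \<beta>], of h]
      refl_self[OF norm_nz[OF \<beta>]] unfolding k_def by (auto simp: minus_equation_iff)
  \<comment> \<open>the weights make the combination orthogonal to \<open>\<beta>\<close>\<close>
  define a where "a = \<bar>ip x' \<beta>\<bar>"
  define b where "b = \<bar>ip x \<beta>\<bar>"
  define y where "y = a *\<^sub>R x + b *\<^sub>R x'"
  have ab: "ip x \<beta> * ip x' \<beta> < 0" using assms(1) by (simp add: adjacent_def)
  then have pos: "a > 0" "b > 0" by (auto simp: a_def b_def)
  have "ip y \<beta> = 0"
    using ab by (auto simp: y_def ip_linear a_def b_def abs_if mult_less_0_iff)
  then have "ip y k = ip y h" using refl_fix refl_adjoint[OF norm_nz[OF \<beta>], of y h] by (simp add: k_def)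
  moreover have "ip x g * ip y g > 0" if "g \<in> H" "g \<noteq> \<beta>" "g \<noteq> - \<beta>" for g
  proof -
    have "ip x g * ip x' g > 0" using assms(1) that by (simp add: adjacent_def)
    moreover from this have "ip x g * ip x g > 0" by (auto simp: zero_less_mult_iff)
    moreover have "ip x g * ip y g = a * (ip x g * ip x g) + b * (ip x g * ip x' g)"
      by (simp add: y_def ip_linear algebra_simps)
    ultimately show ?thesis using pos by (simp add: add_pos_pos)
  qed
  from this[OF assms(2-4)] this[OF k] have "ip x h * ip y h > 0" "ip x k * ip y k > 0" .
  ultimately show ?thesis unfolding k_def[symmetric]
    by (auto simp: zero_less_mult_iff)
qed

lemma adjacent_refl:
  assumes "adjacent H \<beta> x x'" shows "adjacent H \<beta> x (refl \<beta> x)"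
proof -
  have \<beta>: "\<beta> \<in> H" using assms by (simp add: adjacent_def)
  have nz: "ip x \<beta> \<noteq> 0" using assms by (auto simp: adjacent_def)
  have "ip (refl \<beta> x) h = ip x (refl \<beta> h)" for h
    by (rule refl_adjoint[OF norm_nz[OF \<beta>]])
  moreover have "ip x \<beta> * ip x \<beta> > 0" using nz by (metis not_real_square_gt_zero)
  ultimately show ?thesis
    using wall_reflection_keeps_sign[OF assms] \<beta> refl_self[OF norm_nz[OF \<beta>]]
    by (simp add: adjacent_def)
qed

lemma group_refl_conj:
  assumes "w \<in> group_of H" shows "refl (w h) \<circ> w = w \<circ> refl h"
  using refl_conj[OF group_linear[OF assms] group_isometry[OF assms]] by (simp add: fun_eq_iff)

text \<open>
  If \<open>\<beta>\<close> is in this set then so is \<open>- \<beta>\<close>; both define the same reflection.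
\<close>

definition walls :: "'v \<Rightarrow> 'v set"
  where "walls x = {\<beta>. \<exists>x'. adjacent H \<beta> x x'}"

lemma walls_subset: "walls x \<subseteq> H"
  by (auto simp: walls_def adjacent_def)

text \<open>
  Each step of a chain of adjacent chambers is, transported back to \<open>x\<close> by the group element found so
  far, the reflection in a wall of \<open>x\<close>.
\<close>

lemma walls_transitive:
  assumes "reg H x" "reg H y"
  shows "\<exists>w\<in>group_of (walls x). same_chamber H (w x) y"
proof (rule chamber_chain[OF assms, where P = "\<lambda>y. \<exists>w\<in>group_of (walls x). same_chamber H (w x) y"])
  show "\<exists>w\<in>group_of (walls x). same_chamber H (w x) x"
    by (rule bexI[OF _ group_of.group_id]) (simp add: same_chamber_refl[OF assms(1)])
next
  fix u u' assume "same_chamber H u u'" "\<exists>w\<in>group_of (walls x). same_chamber H (w x) u"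
  then show "\<exists>w\<in>group_of (walls x). same_chamber H (w x) u'" using same_chamber_trans by blast
next
  fix \<beta> u u' assume adj: "adjacent H \<beta> u u'" and "\<exists>w\<in>group_of (walls x). same_chamber H (w x) u"
  then obtain w where w: "w \<in> group_of (walls x)" "same_chamber H (w x) u" by blast
  then have wH: "w \<in> group_of H" using group_mono[OF walls_subset] by blast
  have "adjacent H \<beta> (w x) u'" using adjacent_same_left[OF w(2) adj] .
  then have a: "adjacent H (inv w \<beta>) x (inv w u')"
    using adjacent_group[OF group_inv[OF wH]] group_inv_apply[OF wH] by metis
  then have "inv w \<beta> \<in> walls x" by (auto simp: walls_def)
  then have "w \<circ> refl (inv w \<beta>) \<in> group_of (walls x)" using w(1) group_comp group_single by blast
  moreover have "same_chamber H (refl (inv w \<beta>) x) (inv w u')"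
    using adjacent_unique adjacent_refl a by blast
  then have "same_chamber H ((w \<circ> refl (inv w \<beta>)) x) u'"
    using same_chamber_group[OF wH] group_inv_apply[OF wH] by (metis comp_apply)
  ultimately show "\<exists>w\<in>group_of (walls x). same_chamber H (w x) u'" by blast
qed

text \<open>
  Take a point of the hyperplane of \<open>\<beta>\<close> that lies on no other hyperplane, and move off it slightly in
  the directions \<open>\<plusminus> \<beta>\<close>.
\<close>

lemma exists_adjacent:
  assumes "\<beta> \<in> H"
  shows "\<exists>x. adjacent H \<beta> x (refl \<beta> x)"
proof -
  define p where "p h = 1 *\<^sub>R h + (- (ip h \<beta> / ip \<beta> \<beta>)) *\<^sub>R \<beta>" for h
  let ?S = "p ` (H - {\<beta>, - \<beta>})"
  have n: "ip \<beta> \<beta> \<noteq> 0" "ip \<beta> \<beta> > 0" using norm_nz norm_pos assms by auto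
  have "ip f f > 0" if "f \<in> ?S" for f
    using that assms by (auto simp: p_def simp del: scaleR_one scaleR_minus_left intro!: not_parallel)
  then obtain y1 where y1: "\<forall>f\<in>?S. ip y1 f \<noteq> 0"
    using perturb[of "{}" ?S] finite_H by auto
  define y where "y = y1 - (ip y1 \<beta> / ip \<beta> \<beta>) *\<^sub>R \<beta>"
  have y\<beta>: "ip y \<beta> = 0" using n by (simp add: y_def ip_linear)
  have "ip y h = ip y1 (p h)" for h
    by (simp add: y_def p_def ip_linear ip_sym[of \<beta> h])
  then have yh: "ip y h \<noteq> 0" if "h \<in> H" "h \<noteq> \<beta>" "h \<noteq> - \<beta>" for h using y1 that by auto
  obtain e where e: "e > 0" "\<forall>h\<in>H. ip y h \<noteq> 0 \<longrightarrow> ip y h * (ip y h + e * ip \<beta> h) > 0"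
    using small_step_keeps_signs[OF finite_H, of "ip y" "ip \<beta>"] by blast
  define x where "x = y + e *\<^sub>R \<beta>"
  have rx: "refl \<beta> x = y - e *\<^sub>R \<beta>"
    using refl_linear[of \<beta>] refl_self[OF n(1)] refl_fix[OF y\<beta>] by (simp add: x_def linear_add linear_cmul)
  have "adjacent H \<beta> x (refl \<beta> x)"
    unfolding adjacent_def
  proof (intro conjI ballI impI)
    show "ip x \<beta> * ip (refl \<beta> x) \<beta> < 0"
      using e n y\<beta> unfolding rx by (simp add: x_def ip_linear)
    fix h assume h: "h \<in> H" "h \<noteq> \<beta>" "h \<noteq> - \<beta>"
    have "refl \<beta> h \<noteq> \<beta>" "refl \<beta> h \<noteq> - \<beta>"
      using h refl_refl[OF n(1), of h] refl_self[OF n(1)] by (auto simp: minus_equation_iff)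
    then have "ip y (refl \<beta> h) \<noteq> 0" "refl \<beta> h \<in> H" using yh refl_closed assms h by blast+
    then have "ip y (refl \<beta> h) * (ip y (refl \<beta> h) + e * ip \<beta> (refl \<beta> h)) > 0" using e by blast
    moreover have "ip y (refl \<beta> h) = ip y h" "ip \<beta> (refl \<beta> h) = - ip \<beta> h"
      using refl_adjoint[OF n(1), symmetric] refl_fix[OF y\<beta>] refl_self[OF n(1)] by simp_all
    ultimately have "ip y h * (ip y h - e * ip \<beta> h) > 0" by simp
    moreover have "ip y h * (ip y h + e * ip \<beta> h) > 0" using e yh h by blast
    ultimately show "ip x h * ip (refl \<beta> x) h > 0"
      unfolding rx by (auto simp: x_def ip_linear zero_less_mult_iff)
  qed (fact assms)
  then show ?thesis by blast
qed

text \<open>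
  Every hyperplane is a wall of some chamber, and some product of reflections in walls of \<open>x\<close> carries the
  chamber of \<open>x\<close> to that one. So every reflection is conjugate, by such a product, to one in a wall of
  \<open>x\<close>.
\<close>

lemma group_of_walls:
  assumes "reg H x" shows "group_of (walls x) = group_of H"
proof
  show sub: "group_of (walls x) \<subseteq> group_of H" by (rule group_mono[OF walls_subset])
  have single: "refl \<beta> \<in> group_of (walls x)" if \<beta>: "\<beta> \<in> H" for \<beta>
  proof -
    obtain u where u: "adjacent H \<beta> u (refl \<beta> u)" using exists_adjacent[OF \<beta>] by blast
    obtain w where w: "w \<in> group_of (walls x)" "same_chamber H (w x) u"
      using walls_transitive[OF assms] adjacent_reg[OF u] by blast
    have wH: "w \<in> group_of H" using w sub by blast
    have "adjacent H (inv w \<beta>) x (inv w (refl \<beta> u))"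
      using adjacent_group[OF group_inv[OF wH] adjacent_same_left[OF w(2) u]] group_inv_apply[OF wH] by simp
    then have wall: "inv w \<beta> \<in> walls x" by (auto simp: walls_def)
    obtain v where v: "v \<in> group_of (walls x)" "\<And>z. v (w z) = z"
    proof -
      have "\<exists>v\<in>group_of (walls x). v \<circ> w = id" using w(1)
      proof induction
        case (group_refl h w)
        then obtain v where "v \<in> group_of (walls x)" "v \<circ> w = id" by blast
        moreover have "refl h \<circ> refl h = id"
          using refl_refl norm_nz group_refl walls_subset by (force simp: fun_eq_iff)
        ultimately have "(v \<circ> refl h) \<circ> (refl h \<circ> w) = id" by (metis comp_assoc comp_id)
        then show ?case using group_comp group_single \<open>v \<in> _\<close> group_refl by blast
      qed (use group_of.group_id comp_id in blast)
      then show thesis using that by (metis comp_apply id_apply)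
    qed
    have "refl \<beta> = w \<circ> refl (inv w \<beta>) \<circ> v"
    proof
      fix z
      have "z = w (v z)" using v(2) group_inv_apply[OF wH] by metis
      then have "refl \<beta> z = (refl (w (inv w \<beta>)) \<circ> w) (v z)" by (simp add: group_inv_apply[OF wH])
      then show "refl \<beta> z = (w \<circ> refl (inv w \<beta>) \<circ> v) z" unfolding group_refl_conj[OF wH] by simp
    qed
    then show ?thesis using group_comp group_single wall w v by metis
  qed
  show "group_of H \<subseteq> group_of (walls x)"
  proof
    fix w assume "w \<in> group_of H" then show "w \<in> group_of (walls x)"
      by induction (use group_of.group_id group_comp single in blast)+
  qed
qed

definition word :: "'v list \<Rightarrow> 'v \<Rightarrow> 'v"
  where "word hs = foldr (\<circ>) (map refl hs) id"

lemma word_Nil [simp]: "word [] = id"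
  by (simp add: word_def)

lemma word_Cons [simp]: "word (h # hs) = refl h \<circ> word hs"
  by (simp add: word_def)

lemma group_word: assumes "w \<in> group_of Q" shows "\<exists>hs. set hs \<subseteq> Q \<and> w = word hs"
  using assms
proof induction
  case group_id then show ?case by (intro exI[of _ "[]"]) simp
next
  case (group_refl h w)
  then obtain hs where "set hs \<subseteq> Q" "w = word hs" by blast
  then show ?case using group_refl by (intro exI[of _ "h # hs"]) simp
qed

text \<open>
  The exchange condition. If the first letter \<open>\<delta>\<close> of the word is not \<open>\<plusminus> \<beta>\<close>, it can be moved to the
  other side of the reflection in \<open>\<beta>\<close>, turning \<open>\<beta>\<close> into \<open>refl \<delta> \<beta>\<close>, which has the same sign at
  \<open>x\<close> because \<open>\<delta>\<close> is a wall of \<open>x\<close>. The hypothesis thus passes to a shorter word, and it fails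
  for the empty one, so at some point a letter cancels.
\<close>

lemma exchange:
  assumes "\<beta> \<in> H" "set ks \<subseteq> walls x" "ip (word ks x) \<beta> * ip x \<beta> < 0"
  shows "\<exists>ls. Suc (length ls) = length ks \<and> set ls \<subseteq> walls x \<and> refl \<beta> \<circ> word ks = word ls"
  using assms
proof (induction ks arbitrary: \<beta>)
  case Nil
  then show ?case by (simp add: not_square_less_zero)
next
  case (Cons \<delta> ks)
  have \<delta>: "\<delta> \<in> walls x" "\<delta> \<in> H" using Cons walls_subset by auto
  then obtain x' where adj: "adjacent H \<delta> x x'" by (auto simp: walls_def)
  note n = norm_nz[OF \<delta>(2)]
  show ?case
  proof (cases "\<beta> = \<delta> \<or> \<beta> = - \<delta>")
    case True
    then have "refl \<beta> = refl \<delta>" by auto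
    then have "refl \<beta> \<circ> word (\<delta> # ks) = word ks" using refl_refl[OF n] by (simp add: fun_eq_iff)
    moreover have "Suc (length ks) = length (\<delta> # ks)" "set ks \<subseteq> walls x" using Cons.prems by simp_all
    ultimately show ?thesis by blast
  next
    case False
    define \<gamma> where "\<gamma> = refl \<delta> \<beta>"
    have "ip (word (\<delta> # ks) x) \<beta> = ip (word ks x) \<gamma>"
      using refl_adjoint[OF n] by (simp add: \<gamma>_def)
    moreover have "ip x \<beta> * ip x \<gamma> > 0"
      unfolding \<gamma>_def using wall_reflection_keeps_sign[OF adj Cons.prems(1)] False by blast
    ultimately have "ip (word ks x) \<gamma> * ip x \<gamma> < 0"
      using Cons.prems(3) by (auto simp: mult_less_0_iff zero_less_mult_iff)
    moreover have "\<gamma> \<in> H" unfolding \<gamma>_def using refl_closed \<delta> Cons.prems by blast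
    ultimately obtain ls where ls: "Suc (length ls) = length ks" "set ls \<subseteq> walls x" "refl \<gamma> \<circ> word ks = word ls"
      using Cons.IH[of \<gamma>] Cons.prems(2) by (metis set_subset_Cons subset_trans)
    have "refl \<beta> \<circ> refl \<delta> = refl \<delta> \<circ> refl \<gamma>"
      using group_refl_conj[OF group_single[OF \<delta>(2)], of \<gamma>] refl_refl[OF n] by (simp add: \<gamma>_def)
    then have "refl \<beta> \<circ> word (\<delta> # ks) = word (\<delta> # ls)"
      using ls(3) by (metis word_Cons o_assoc)
    moreover have "Suc (length (\<delta> # ls)) = length (\<delta> # ks)" "set (\<delta> # ls) \<subseteq> walls x"
      using ls \<delta> by simp_all
    ultimately show ?thesis by blast
  qed
qed

text \<open>
  If the word were not empty, its first letter would separate the image of \<open>x\<close> under the remaining letters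
  from \<open>x\<close>, and the exchange condition would give an expression of the same element shorter by two.
\<close>

lemma word_fixing_chamber:
  assumes "reg H x" "set hs \<subseteq> walls x" "same_chamber H (word hs x) x"
  shows "word hs = id"
  using assms(2,3)
proof (induction "length hs" arbitrary: hs rule: less_induct)
  case less
  show ?case
  proof (cases hs)
    case (Cons \<beta> ks)
    have \<beta>: "\<beta> \<in> H" using less Cons walls_subset by auto
    have "ip (word hs x) \<beta> = - ip (word ks x) \<beta>"
      using refl_adjoint[OF norm_nz[OF \<beta>]] refl_self[OF norm_nz[OF \<beta>]] by (simp add: Cons)
    moreover have "ip (word hs x) \<beta> * ip x \<beta> > 0" using less \<beta> by (simp add: same_chamber_def)
    ultimately have "ip (word ks x) \<beta> * ip x \<beta> < 0" by simp
    then obtain ls where ls: "Suc (length ls) = length ks" "set ls \<subseteq> walls x" "refl \<beta> \<circ> word ks = word ls"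
      using exchange[OF \<beta>, of ks x] less.prems Cons by auto
    then have "word hs = word ls" by (simp add: Cons)
    then show ?thesis using less.hyps[of ls] less.prems ls Cons by auto
  qed simp
qed

theorem group_fixing_chamber:
  assumes "reg H x" "w \<in> group_of H" "same_chamber H (w x) x"
  shows "w = id"
proof -
  have "w \<in> group_of (walls x)" using assms group_of_walls by simp
  then show ?thesis using group_word word_fixing_chamber assms by metis
qed

lemma perp_subsystem: "reflection_system ip {h\<in>H. \<forall>a\<in>A. ip h a = 0}"
  using refl_closed by (intro subsystem) (auto simp: refl_def ip_linear)

text \<open>
  Choose \<open>x\<close> regular and close to \<open>v\<close>. Then \<open>w x\<close> is also close to \<open>v\<close>, so only hyperplanes
  through \<open>v\<close> separate it from \<open>x\<close>. The group generated by the corresponding reflections is transitive on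
  its own chambers, hence contains an element that agrees with \<open>w\<close> on the chamber of \<open>x\<close>, and by simple
  transitivity this element is \<open>w\<close>.
\<close>

theorem stabilizer_generated_by_reflections:
  assumes "w \<in> group_of H" "w v = v"
  shows "w \<in> group_of {h\<in>H. ip h v = 0}"
proof -
  let ?Hv = "{h\<in>H. ip h v = 0}"
  have sub: "?Hv \<subseteq> H" by auto
  interpret Hv: reflection_system ip ?Hv using perp_subsystem[of "{v}"] by simp
  obtain x where x: "reg H x" "\<forall>h\<in>H. ip v h \<noteq> 0 \<longrightarrow> ip v h * ip x h > 0"
    using perturb_regular[OF finite_H] by blast
  have near: "ip v h * ip (u x) h > 0" if u: "u \<in> group_of H" "u v = v" and h: "h \<in> H" "ip v h \<noteq> 0" for u h
  proof -
    have "ip v (inv u h) = ip v h" using group_adjoint[OF u(1), of v h] u(2) by simp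
    moreover have "inv u h \<in> H" using group_closed[OF group_inv[OF u(1)]] h by blast
    ultimately show ?thesis using x(2) h(2) group_adjoint[OF u(1), of x h] by metis
  qed
  have reg: "reg ?Hv x" "reg ?Hv (w x)" using reg_mono[OF _ sub] x(1) reg_group[OF assms(1)] by blast+
  then obtain u where u: "u \<in> group_of ?Hv" "same_chamber ?Hv (u x) (w x)"
    using Hv.walls_transitive[OF reg] unfolding Hv.group_of_walls[OF reg(1)] by blast
  have uv: "u v = v" using u(1)
    by induction (auto intro!: refl_fix simp: ip_sym[of v])
  have uH: "u \<in> group_of H" using u(1) group_mono[OF sub] by blast
  have "ip (u x) h * ip (w x) h > 0" if h: "h \<in> H" for h
  proof (cases "ip h v = 0")
    case True then show ?thesis using u(2) h by (simp add: same_chamber_def)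
  next
    case False
    then have "ip v h \<noteq> 0" by (simp add: ip_sym)
    then show ?thesis using near[OF uH uv h] near[OF assms h] by (auto simp: zero_less_mult_iff)
  qed
  then have "same_chamber H (w x) (u x)" by (simp add: same_chamber_def mult.commute)
  then have "same_chamber H ((inv u \<circ> w) x) x"
    using same_chamber_group[OF group_inv[OF uH]] group_inv_apply[OF uH] by (metis comp_apply)
  then have "inv u \<circ> w = id"
    using group_fixing_chamber[OF x(1)] group_comp[OF group_inv[OF uH] assms(1)] by blast
  then have "w = u" using group_inv_apply[OF uH] by (metis comp_apply ext id_apply)
  then show ?thesis using u(1) by simp
qed

end

section \<open>Relative signs of chambers\<close>

lemma even_card_of_involution:
  assumes "finite U" "\<And>x. x \<in> U \<Longrightarrow> j x \<in> U" "\<And>x. x \<in> U \<Longrightarrow> j (j x) = x" "\<And>x. x \<in> U \<Longrightarrow> j x \<noteq> x"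
  shows "even (card U)"
  using assms
proof (induction "card U" arbitrary: U rule: less_induct)
  case less
  show ?case
  proof (cases "U = {}")
    case False
    then obtain x where x: "x \<in> U" by blast
    let ?V = "U - {x, j x}"
    have jx: "j x \<in> U" "j x \<noteq> x" using less.prems x by blast+
    have "card U = card ?V + card {x, j x}"
      using card_Diff_subset[of "{x, j x}" U] card_mono[of U "{x, j x}"] less.prems(1) x jx by simp
    then have c: "card U = card ?V + 2" using jx by simp
    have "j z \<in> ?V" if "z \<in> ?V" for z
      using that less.prems(2,3) x by (metis DiffD1 DiffD2 DiffI insert_iff singletonD)
    then have "even (card ?V)"
      using less.hyps[of ?V] less.prems c by auto
    then show ?thesis using c by simp
  qed simp
qed

context symmetric_form
begin

text \<open>
  A half contains one vector of each pair \<open>\<plusminus> h\<close>, so it plays the role of a positive system.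
  Halves that do not come from a chamber are included, so that they can be adapted to a computation.
\<close>

definition is_half :: "'v set \<Rightarrow> 'v set \<Rightarrow> bool"
  where "is_half Q P \<longleftrightarrow> P \<subseteq> Q \<and> (\<forall>h\<in>Q. - h \<in> Q \<and> (h \<in> P \<longleftrightarrow> - h \<notin> P))"

lemma prod_half:
  assumes "is_half Q P1" "is_half Q P2" "\<And>h. h \<in> Q \<Longrightarrow> f (- h) = f h"
  shows "prod f P1 = prod f P2"
proof (rule prod.reindex_bij_witness)
  let ?i = "\<lambda>P h. if h \<in> P then h else - h"
  show "?i P1 (?i P2 h) = h" "?i P2 h \<in> P2" "f (?i P2 h) = f h" if "h \<in> P1" for h
    using that assms unfolding is_half_def by (auto split: if_splits)
  show "?i P2 (?i P1 h) = h" "?i P1 h \<in> P1" if "h \<in> P2" for h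
    using that assms unfolding is_half_def by (auto split: if_splits)
qed

text \<open>
  The factors do not change under \<open>h \<mapsto> - h\<close>, so every half gives the same product. For \<open>y = w x\<close>
  with \<open>w\<close> in the reflection group this is the determinant of \<open>w\<close>.
\<close>

definition rel_sign :: "'v set \<Rightarrow> 'v \<Rightarrow> 'v \<Rightarrow> real"
  where "rel_sign Q x y = (\<Prod>h\<in>(SOME P. is_half Q P). sgn (ip x h * ip y h))"

lemma rel_sign_half:
  assumes "is_half Q P" shows "rel_sign Q x y = (\<Prod>h\<in>P. sgn (ip x h * ip y h))"
  unfolding rel_sign_def
  by (rule prod_half[of Q]) (use someI[of "is_half Q", OF assms] assms in auto)

lemma rel_sign_commute: "rel_sign Q x y = rel_sign Q y x"
  by (simp add: rel_sign_def mult.commute)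

lemma is_half_filter:
  assumes "is_half Q P" "\<And>h. C (- h) = C h" shows "is_half {h\<in>Q. C h} {h\<in>P. C h}"
  unfolding is_half_def
proof (intro conjI ballI)
  show "{h\<in>P. C h} \<subseteq> {h\<in>Q. C h}" using assms(1) by (auto simp: is_half_def)
  fix h assume h: "h \<in> {h\<in>Q. C h}"
  then have "- h \<in> Q" "h \<in> P \<longleftrightarrow> - h \<notin> P" using assms(1) unfolding is_half_def by blast+
  then show "- h \<in> {h\<in>Q. C h}" "h \<in> {h\<in>P. C h} \<longleftrightarrow> - h \<notin> {h\<in>P. C h}" using assms(2)[of h] h by simp_all
qed

lemma card_half:
  assumes "finite Q" "is_half Q P" shows "card Q = 2 * card P"
proof -
  have "Q = P \<union> uminus ` P"
  proof (intro equalityI subsetI)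
    fix h assume "h \<in> Q"
    then have "h \<in> P \<or> - h \<in> P" using assms(2) unfolding is_half_def by blast
    then show "h \<in> P \<union> uminus ` P" using image_eqI[of h uminus "- h"] by auto
  next
    fix h assume "h \<in> P \<union> uminus ` P"
    then show "h \<in> Q" using assms(2) unfolding is_half_def by blast
  qed
  moreover have "P \<inter> uminus ` P = {}"
  proof -
    have "- h \<in> P" if "h \<in> uminus ` P" for h using that by auto
    then show ?thesis using assms(2) unfolding is_half_def by blast
  qed
  moreover have "finite P" using assms finite_subset unfolding is_half_def by blast
  ultimately show ?thesis by (simp add: card_Un_disjoint card_image)
qed

text \<open>
  Near a wall \<open>\<alpha>\<close> the convenient half consists of the vectors with positive inner product with
  \<open>\<alpha>\<close>; a regular \<open>z\<close> decides for those orthogonal to \<open>\<alpha>\<close>.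
\<close>

lemma is_half_lexicographic:
  assumes "uminus ` Q \<subseteq> Q" "reg Q z"
  shows "is_half Q ({h\<in>Q. ip h \<alpha> = 0 \<and> ip h z > 0} \<union> {h\<in>Q. ip h \<alpha> > 0})"
  using assms by (auto simp: is_half_def reg_def ip_sym[of z] not_less less_le)

end

lemma sgn_same_sign:
  fixes a b :: real assumes "a * b > 0" shows "sgn a = sgn b"
  using assms by (auto simp: zero_less_mult_iff)

context reflection_system
begin

lemma uminus_H: "uminus ` H \<subseteq> H"
  using neg_closed by blast

lemma exists_regular: "\<exists>z. reg H z"
  using perturb_regular[of "{}"] by blast

lemma exists_half: "\<exists>P. is_half H P"
proof -
  obtain z where "reg H z" using exists_regular by blast
  from is_half_lexicographic[OF uminus_H this, of 0] show ?thesis by blast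
qed

lemma rel_sign_same_chamber:
  assumes "same_chamber H x x'" shows "rel_sign H x y = rel_sign H x' y"
proof -
  obtain P where P: "is_half H P" using exists_half by blast
  have "sgn (ip x h) = sgn (ip x' h)" if "h \<in> P" for h
    using sgn_same_sign assms P that by (auto simp: same_chamber_def is_half_def)
  then show ?thesis by (simp add: rel_sign_half[OF P] sgn_mult)
qed

lemma rel_sign_square:
  assumes "reg H x" "reg H y" shows "rel_sign H x y * rel_sign H x y = 1"
proof -
  obtain P where P: "is_half H P" using exists_half by blast
  have "sgn (ip x h * ip y h) * sgn (ip x h * ip y h) = 1" if "h \<in> P" for h
  proof -
    have "ip x h \<noteq> 0" "ip y h \<noteq> 0" using that P assms by (auto simp: reg_def is_half_def)
    then show ?thesis by (simp add: sgn_mult sgn_real_def)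
  qed
  then show ?thesis by (simp add: rel_sign_half[OF P] flip: prod.distrib)
qed

lemma rel_sign_adjacent:
  assumes "adjacent H \<beta> x x'" shows "rel_sign H x' y = - rel_sign H x y"
proof -
  obtain P where P: "is_half H P" using exists_half by blast
  have \<beta>: "\<beta> \<in> H" using assms by (simp add: adjacent_def)
  define b where "b = (if \<beta> \<in> P then \<beta> else - \<beta>)"
  have b: "b \<in> P" "- b \<notin> P" "ip x b * ip x' b < 0"
  proof -
    have "\<beta> \<in> P \<longleftrightarrow> - \<beta> \<notin> P" using P \<beta> unfolding is_half_def by blast
    then show "b \<in> P" "- b \<notin> P" unfolding b_def by (simp_all split: if_split)
    show "ip x b * ip x' b < 0" using assms by (simp add: b_def adjacent_def)
  qed
  have fin: "finite P" using P finite_H finite_subset by (auto simp: is_half_def)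
  have "sgn (ip x' h) = sgn (ip x h)" if "h \<in> P - {b}" for h
  proof -
    have "h \<in> P" "h \<noteq> b" "h \<noteq> - b" using that b by auto
    then have "h \<noteq> \<beta>" "h \<noteq> - \<beta>" "h \<in> H" using P unfolding b_def is_half_def by (auto split: if_splits)
    then have "ip x h * ip x' h > 0" using assms by (simp add: adjacent_def)
    then show ?thesis using sgn_same_sign by metis
  qed
  then have "(\<Prod>h\<in>P - {b}. sgn (ip x' h * ip y h)) = (\<Prod>h\<in>P - {b}. sgn (ip x h * ip y h))"
    by (intro prod.cong) (auto simp: sgn_mult)
  moreover have "sgn (ip x' b) = - sgn (ip x b)" using b(3) by (auto simp: mult_less_0_iff)
  ultimately show ?thesis
    by (simp add: rel_sign_half[OF P] prod.remove[OF fin b(1)] sgn_mult)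
qed

lemma card_split:
  "card H = card {h\<in>H. ip h \<alpha> = 0} + 2 * card {h\<in>H. ip h \<alpha> > 0}"
proof -
  have "is_half {h\<in>H. ip h \<alpha> \<noteq> 0} {h\<in>H. ip h \<alpha> > 0}"
    using neg_closed by (auto simp: is_half_def)
  then have "card {h\<in>H. ip h \<alpha> \<noteq> 0} = 2 * card {h\<in>H. ip h \<alpha> > 0}"
    using finite_H by (intro card_half) auto
  moreover have "card ({h\<in>H. ip h \<alpha> = 0} \<union> {h\<in>H. ip h \<alpha> \<noteq> 0}) = card {h\<in>H. ip h \<alpha> = 0} + card {h\<in>H. ip h \<alpha> \<noteq> 0}"
    using finite_H by (intro card_Un_disjoint) auto
  moreover have "{h\<in>H. ip h \<alpha> = 0} \<union> {h\<in>H. ip h \<alpha> \<noteq> 0} = H" by auto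
  ultimately show ?thesis by simp
qed

text \<open>
  The map \<open>h \<mapsto> - refl \<alpha> h\<close> is an involution of this set, and \<open>\<alpha>\<close> is its only fixed point.
\<close>

lemma odd_card_half:
  assumes "\<alpha> \<in> H" shows "odd (card {h\<in>H. ip h \<alpha> > 0})"
proof -
  let ?U = "{h\<in>H. ip h \<alpha> > 0}"
  note n = norm_nz[OF assms]
  let ?j = "\<lambda>h. - refl \<alpha> h"
  have jj: "?j (?j h) = h" for h using refl_refl[OF n] by simp
  have "even (card (?U - {\<alpha>}))"
  proof (rule even_card_of_involution)
    fix h assume h: "h \<in> ?U - {\<alpha>}"
    have "ip (?j h) \<alpha> = ip h \<alpha>" using refl_adjoint[OF n] refl_self[OF n] by simp
    moreover have "?j h \<in> H" using refl_closed assms neg_closed h by blast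
    moreover have "?j h \<noteq> \<alpha>"
    proof
      assume "?j h = \<alpha>"
      then have "?j \<alpha> = h" using jj[of h] by simp
      then show False using refl_self[OF n] h by simp
    qed
    ultimately show "?j h \<in> ?U - {\<alpha>}" using h by simp
    show "?j h \<noteq> h"
    proof
      assume e: "?j h = h"
      have "2 *\<^sub>R h + (- (2 * ip h \<alpha> / ip \<alpha> \<alpha>)) *\<^sub>R \<alpha> = h + refl \<alpha> h"
        by (simp add: refl_def scaleR_2)
      also have "refl \<alpha> h = - h" using e by (metis minus_minus)
      finally have "2 *\<^sub>R h + (- (2 * ip h \<alpha> / ip \<alpha> \<alpha>)) *\<^sub>R \<alpha> = 0" by simp
      moreover have "h \<noteq> - \<alpha>" using h norm_pos[OF assms] by auto
      ultimately show False using not_parallel[OF assms, of h 2 "- (2 * ip h \<alpha> / ip \<alpha> \<alpha>)"] h by auto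
    qed
  qed (use jj finite_H in auto)
  moreover have "card ?U = Suc (card (?U - {\<alpha>}))"
    using finite_H assms norm_pos by (intro card.remove) auto
  ultimately show ?thesis by simp
qed

text \<open>
  The vectors orthogonal neither to \<open>\<alpha>\<close> nor to \<open>\<beta>\<close>, up to sign, form the disjoint union of \<open>T\<close>
  and its image under \<open>refl \<alpha>\<close>. For \<open>h \<in> T\<close>, the signs of \<open>y\<close> at \<open>h\<close> and \<open>refl \<alpha> h\<close> agree,
  since \<open>\<alpha>\<close> is a wall of \<open>y\<close>. Since \<open>\<beta>\<close> is a wall of \<open>x\<close>, the sign of \<open>x\<close> at
  \<open>refl \<alpha> h\<close> is opposite to that at \<open>j h = - refl \<beta> (refl \<alpha> h)\<close>, and \<open>j\<close> permutes \<open>T\<close>.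
  Therefore the signs of \<open>x\<close> cancel in the product over \<open>T\<close>, leaving a factor \<open>-1\<close> for each
  element of \<open>T\<close>.
\<close>

lemma orthogonal_walls_sign:
  assumes adj: "adjacent H \<alpha> y y'" "adjacent H \<beta> x x'" and orth: "ip \<alpha> \<beta> = 0"
  defines "T \<equiv> {h\<in>H. ip h \<alpha> > 0 \<and> ip h \<beta> > 0}"
  shows "(\<Prod>h\<in>{h\<in>H. ip h \<alpha> \<noteq> 0 \<and> ip h \<beta> > 0}. sgn (ip x h * ip y h)) = (-1) ^ card T"
    and "card {h\<in>H. ip h \<alpha> \<noteq> 0 \<and> ip h \<beta> > 0} = 2 * card T"
proof -
  have ab: "\<alpha> \<in> H" "\<beta> \<in> H" using adj by (auto simp: adjacent_def)
  note na = norm_nz[OF ab(1)] and nb = norm_nz[OF ab(2)]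
  have ipa: "ip (refl \<alpha> h) \<alpha> = - ip h \<alpha>" "ip (refl \<alpha> h) \<beta> = ip h \<beta>" for h
    using refl_adjoint[OF na, of h] refl_self[OF na] refl_fix[of \<beta> \<alpha>] orth by (simp_all add: ip_sym[of \<beta>])
  have ipb: "ip (refl \<beta> h) \<alpha> = ip h \<alpha>" "ip (refl \<beta> h) \<beta> = - ip h \<beta>" for h
    using refl_adjoint[OF nb, of h] refl_self[OF nb] refl_fix[of \<alpha> \<beta>] orth by simp_all
  let ?T' = "{h\<in>H. ip h \<alpha> < 0 \<and> ip h \<beta> > 0}"
  have T': "?T' = refl \<alpha> ` T"
  proof
    show "refl \<alpha> ` T \<subseteq> ?T'" using ipa refl_closed ab by (auto simp: T_def)
    show "?T' \<subseteq> refl \<alpha> ` T"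
    proof
      fix h assume "h \<in> ?T'"
      then have "refl \<alpha> h \<in> T" "h = refl \<alpha> (refl \<alpha> h)"
        using ipa refl_closed ab refl_refl[OF na] by (auto simp: T_def)
      then show "h \<in> refl \<alpha> ` T" by blast
    qed
  qed
  have inj: "inj_on (refl \<alpha>) T" by (metis inj_onI refl_refl[OF na])
  have finT: "finite T" "finite ?T'" using finite_H by (auto simp: T_def)
  have split: "{h\<in>H. ip h \<alpha> \<noteq> 0 \<and> ip h \<beta> > 0} = T \<union> ?T'" "T \<inter> ?T' = {}" by (auto simp: T_def)
  show "card {h\<in>H. ip h \<alpha> \<noteq> 0 \<and> ip h \<beta> > 0} = 2 * card T"
    unfolding split(1) card_Un_disjoint[OF finT split(2)] unfolding T' card_image[OF inj] by simp
  let ?f = "\<lambda>h. sgn (ip x h * ip y h)"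
  let ?j = "\<lambda>h. - refl \<beta> (refl \<alpha> h)"
  have comm: "refl \<alpha> (refl \<beta> z) = refl \<beta> (refl \<alpha> z)" for z
    using group_refl_conj[OF group_single[OF ab(2)], of \<alpha>] refl_fix[of \<alpha> \<beta>] orth
    by (simp add: fun_eq_iff)
  have jj: "?j (?j h) = h" for h
    by (simp add: comm refl_refl[OF na] refl_refl[OF nb])
  have jT: "?j h \<in> T" if "h \<in> T" for h
    using that ipa ipb neg_closed refl_closed ab by (simp add: T_def)
  have key: "?f h * ?f (refl \<alpha> h) = - (sgn (ip x h) * sgn (ip x (?j h)))" if h: "h \<in> T" for h
  proof -
    have 1: "h \<in> H" "h \<noteq> \<alpha>" "h \<noteq> - \<alpha>"
      using h norm_pos[OF ab(1)] orth by (auto simp: T_def)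
    have "ip (refl \<alpha> h) \<alpha> \<noteq> 0" using h ipa(1) by (simp add: T_def)
    then have 2: "refl \<alpha> h \<in> H" "refl \<alpha> h \<noteq> \<beta>" "refl \<alpha> h \<noteq> - \<beta>"
      using refl_closed[OF ab(1) 1(1)] orth ip_sym[of \<beta> \<alpha>] by fastforce+
    have "sgn (ip y h) * sgn (ip y (refl \<alpha> h)) = 1"
      using wall_reflection_keeps_sign[OF adj(1) 1] by (simp add: sgn_mult[symmetric])
    moreover have "sgn (ip x (refl \<beta> (refl \<alpha> h))) = sgn (ip x (refl \<alpha> h))"
      using wall_reflection_keeps_sign[OF adj(2) 2] sgn_same_sign by force
    ultimately show ?thesis by (simp add: sgn_mult sgn_minus mult.left_commute[of "sgn (ip y h)"])
  qed
  have "(\<Prod>h\<in>T \<union> ?T'. ?f h) = (\<Prod>h\<in>T. ?f h) * (\<Prod>h\<in>refl \<alpha> ` T. ?f h)"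
    unfolding prod.union_disjoint[OF finT split(2)] unfolding T' ..
  also have "\<dots> = (\<Prod>h\<in>T. ?f h * ?f (refl \<alpha> h))"
    by (simp add: prod.reindex[OF inj] prod.distrib o_def)
  also have "\<dots> = (\<Prod>h\<in>T. (-1) * (sgn (ip x h) * sgn (ip x (?j h))))"
    using key by (intro prod.cong) auto
  also have "\<dots> = (-1) ^ card T * ((\<Prod>h\<in>T. sgn (ip x h)) * (\<Prod>h\<in>T. sgn (ip x (?j h))))"
    by (simp only: prod.distrib prod_constant)
  also have "(\<Prod>h\<in>T. sgn (ip x (?j h))) = (\<Prod>h\<in>T. sgn (ip x h))"
    by (rule prod.reindex_bij_witness[of _ ?j ?j]) (use jj jT in auto)
  also have "(\<Prod>h\<in>T. sgn (ip x h)) * (\<Prod>h\<in>T. sgn (ip x h)) = 1"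
  proof -
    have "sgn (ip x h) * sgn (ip x h) = 1" if "h \<in> T" for h
      using adjacent_reg(1)[OF adj(2)] that by (auto simp: reg_def T_def sgn_real_def)
    then show ?thesis by (simp flip: prod.distrib)
  qed
  finally show "(\<Prod>h\<in>{h\<in>H. ip h \<alpha> \<noteq> 0 \<and> ip h \<beta> > 0}. ?f h) = (-1) ^ card T"
    unfolding split(1) by simp
qed

text \<open>
  Vectors orthogonal to \<open>\<alpha>\<close> contribute trivially. On the half where the inner product with \<open>\<alpha>\<close> is
  positive, the involution \<open>h \<mapsto> - refl \<alpha> h\<close> makes the signs of \<open>x\<close> cancel, and a factor \<open>-1\<close>
  remains for each of an odd number of vectors.
\<close>

lemma rel_sign_refl:
  assumes "\<alpha> \<in> H" "reg H x" shows "rel_sign H x (refl \<alpha> x) = -1"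
proof -
  note n = norm_nz[OF assms(1)]
  obtain z where z: "reg H z" using exists_regular by blast
  let ?f = "\<lambda>h. sgn (ip x h * ip (refl \<alpha> x) h)"
  let ?U = "{h\<in>H. ip h \<alpha> > 0}" and ?j = "\<lambda>h. - refl \<alpha> h" and ?Z = "{h\<in>H. ip h \<alpha> = 0 \<and> ip h z > 0}"
  have fin: "finite ?Z" "finite ?U" "?Z \<inter> ?U = {}" using finite_H by auto
  have nz: "ip x h \<noteq> 0" if "h \<in> H" for h using that assms(2) by (simp add: reg_def)
  have "rel_sign H x (refl \<alpha> x) = prod ?f ?Z * prod ?f ?U"
    unfolding rel_sign_half[OF is_half_lexicographic[OF uminus_H z, of \<alpha>]] by (rule prod.union_disjoint[OF fin])
  also have "prod ?f ?Z = 1"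
  proof (rule prod.neutral, rule ballI)
    fix h assume h: "h \<in> ?Z"
    then have "ip (refl \<alpha> x) h = ip x h" using refl_adjoint[OF n] refl_fix by simp
    moreover have "ip x h * ip x h > 0" using nz h not_real_square_gt_zero by (metis (mono_tags, lifting) mem_Collect_eq)
    ultimately show "?f h = 1" by (metis sgn_pos)
  qed
  also have "prod ?f ?U = (\<Prod>h\<in>?U. (-1) * (sgn (ip x h) * sgn (ip x (?j h))))"
    using refl_adjoint[OF n] by (intro prod.cong) (auto simp: sgn_mult sgn_minus)
  also have "\<dots> = (-1) ^ card ?U * ((\<Prod>h\<in>?U. sgn (ip x h)) * (\<Prod>h\<in>?U. sgn (ip x (?j h))))"
    by (simp only: prod.distrib prod_constant)
  also have "(\<Prod>h\<in>?U. sgn (ip x (?j h))) = (\<Prod>h\<in>?U. sgn (ip x h))"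
    using refl_refl[OF n] refl_closed[OF assms(1)] neg_closed refl_adjoint[OF n] refl_self[OF n]
    by (intro prod.reindex_bij_witness[of _ ?j ?j]) auto
  also have "(\<Prod>h\<in>?U. sgn (ip x h)) * (\<Prod>h\<in>?U. sgn (ip x h)) = 1"
  proof -
    have "sgn (ip x h) * sgn (ip x h) = 1" if "h \<in> ?U" for h
      using nz that by (auto simp: sgn_real_def)
    then show ?thesis by (simp flip: prod.distrib)
  qed
  finally show ?thesis using odd_card_half[OF assms(1)] by simp
qed

lemma rel_sign_trans:
  assumes "reg H y" shows "rel_sign H x y * rel_sign H y z = rel_sign H x z"
proof -
  obtain P where P: "is_half H P" using exists_half by blast
  have "sgn (ip x h * ip y h) * sgn (ip y h * ip z h) = sgn (ip x h * ip z h)" if "h \<in> P" for h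
  proof -
    have "ip y h \<noteq> 0" using that P assms unfolding reg_def is_half_def by blast
    then have "sgn (ip y h) * sgn (ip y h) = 1" by (simp add: sgn_real_def)
    then show ?thesis by (simp add: sgn_mult mult.left_commute[of "sgn (ip y h)"] mult.assoc)
  qed
  then show ?thesis by (simp add: rel_sign_half[OF P] flip: prod.distrib)
qed

lemma rel_sign_isometry:
  assumes "w \<in> group_of H" shows "rel_sign H (w x) (w y) = rel_sign H x y"
proof -
  obtain P where P: "is_half H P" using exists_half by blast
  have i: "linear (inv w)" "inj (inv w)" "inv w ` H = H" 
    using group_inv[OF assms] group_linear group_image group_bij bij_is_inj by blast+
  have half: "is_half H (inv w ` P)"
    unfolding is_half_def
  proof (intro conjI ballI)
    show "inv w ` P \<subseteq> H" using P i(3) by (auto simp: is_half_def)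
    fix h assume "h \<in> H"
    then obtain k where k: "k \<in> H" "h = inv w k" using i(3) by blast
    have "- h = inv w (- k)" using k linear_neg[OF i(1)] by simp
    then have "h \<in> inv w ` P \<longleftrightarrow> k \<in> P" "- h \<in> inv w ` P \<longleftrightarrow> - k \<in> P"
      using k(2) inj_image_mem_iff[OF i(2)] by metis+
    then show "(h \<in> inv w ` P) = (- h \<notin> inv w ` P)" using k(1) P unfolding is_half_def by blast
    show "- h \<in> H" using neg_closed \<open>h \<in> H\<close> by blast
  qed
  show ?thesis
    using inj_on_subset[OF i(2)] rel_sign_half[OF P, of "w x" "w y"] rel_sign_half[OF half, of x y]
    by (simp add: prod.reindex o_def group_adjoint[OF assms])
qed

lemma rel_sign_word:
  assumes "set hs \<subseteq> H" "reg H x" shows "rel_sign H x (word hs x) = (-1) ^ length hs"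
  using assms(1)
proof (induction hs)
  case Nil
  then show ?case using rel_sign_square[OF assms(2,2)] rel_sign_trans[OF assms(2), of x x] by simp
next
  case (Cons h hs)
  have "rel_sign H (refl h x) (refl h (word hs x)) = rel_sign H x (word hs x)"
    using rel_sign_isometry group_single Cons.prems by simp
  moreover have "rel_sign H x (refl h x) * rel_sign H (refl h x) (refl h (word hs x))
      = rel_sign H x (refl h (word hs x))"
    using rel_sign_trans reg_group group_single assms(2) Cons.prems by simp
  ultimately show ?case using Cons rel_sign_refl[of h x] assms(2) by simp
qed

text \<open>
  Without walls, a chain of adjacent chambers starting at \<open>x\<close> could never leave the chamber of \<open>x\<close>, yet
  it reaches the opposite one.
\<close>

lemma exists_wall:
  assumes "H \<noteq> {}" "reg H x" shows "\<exists>\<beta> x'. adjacent H \<beta> x x'"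
proof (rule ccontr)
  assume no: "\<nexists>\<beta> x'. adjacent H \<beta> x x'"
  have "same_chamber H x (- x)"
  proof (rule chamber_chain[OF assms(2) reg_negate[OF assms(2)]])
    show "same_chamber H x x" using assms(2) by (rule same_chamber_refl)
    show "same_chamber H x u'" if "adjacent H \<beta> u u'" "same_chamber H x u" for \<beta> u u'
      using no adjacent_same_left that by blast
    show "same_chamber H x u'" if "same_chamber H u u'" "same_chamber H x u" for u u'
      using same_chamber_trans that by blast
  qed
  then show False using assms(1) not_square_less_zero by (force simp: same_chamber_def)
qed

text \<open>
  The zero spreads along a chain of adjacent chambers. All uniqueness arguments below rest on this principle.
\<close>

lemma vanishes_if_antisymmetric_across_walls:
  fixes f :: "'v \<Rightarrow> real"
  assumes same: "\<And>u u'. same_chamber H u u' \<Longrightarrow> f u = f u'"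
    and adj: "\<And>\<beta> u u'. adjacent H \<beta> u u' \<Longrightarrow> f u + f u' = 0"
    and "reg H x0" "f x0 = 0" "reg H x"
  shows "f x = 0"
proof (rule chamber_chain[OF assms(3,5), of "\<lambda>x. f x = 0"])
  show "f x0 = 0" by (fact assms(4))
  show "f u' = 0" if "adjacent H \<beta> u u'" "f u = 0" for \<beta> u u' using adj[OF that(1)] that(2) by simp
  show "f u' = 0" if "same_chamber H u u'" "f u = 0" for u u' using same[OF that(1)] that(2) by simp
qed

end

section \<open>Orthogonal subsystems when the group contains minus one\<close>

locale minus_one_system = reflection_system +
  assumes minus_one: "\<exists>w\<in>group_of H. \<forall>x\<in>span H. w x = - x"
begin

definition orth :: "'a set \<Rightarrow> bool"
  where "orth A \<longleftrightarrow> A \<subseteq> H \<and> (\<forall>a\<in>A. \<forall>b\<in>A. a \<noteq> b \<longrightarrow> ip a b = 0)"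

text \<open>
  For \<open>A = {\<alpha>\<^sup>\<or>}\<close> this is the set of coroots of \<open>R\<^sub>Y\<close>, where \<open>Y\<close> is the hyperplane of
  \<open>\<alpha>\<close>. In general it is the set of coroots of the system reached after restricting to the hyperplanes of
  all elements of \<open>A\<close> in turn.
\<close>

definition perp :: "'a set \<Rightarrow> 'a set"
  where "perp A = {h\<in>H. \<forall>a\<in>A. ip h a = 0}"

definition proj :: "'a set \<Rightarrow> 'a \<Rightarrow> 'a"
  where "proj A y = y - (\<Sum>a\<in>A. (ip y a / ip a a) *\<^sub>R a)"

lemma perp_subset: "perp A \<subseteq> H"
  by (auto simp: perp_def)

lemma perp_empty [simp]: "perp {} = H"
  by (simp add: perp_def)

lemma perp_insert: "perp (insert \<beta> A) = {h\<in>perp A. ip h \<beta> = 0}"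
  by (auto simp: perp_def)

lemma perp_insert_subset: "perp (insert \<beta> A) \<subseteq> perp A"
  by (auto simp: perp_insert)

lemma orth_empty: "orth {}"
  by (simp add: orth_def)

lemma orth_finite: "orth A \<Longrightarrow> finite A"
  using finite_H finite_subset by (auto simp: orth_def)

lemma perp_system: "reflection_system ip (perp A)"
  unfolding perp_def by (rule perp_subsystem)

lemma finite_perp: "finite (perp A)"
  using finite_H finite_subset[OF perp_subset] by blast

lemma not_self_perp: "\<beta> \<in> H \<Longrightarrow> \<beta> \<notin> perp (insert \<beta> A)"
  using norm_nz by (auto simp: perp_def)

lemma orth_insert:
  assumes "orth A" "\<beta> \<in> perp A" shows "orth (insert \<beta> A)"
proof -
  have "ip \<beta> a = 0" "ip a \<beta> = 0" if "a \<in> A" for a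
    using that assms(2) ip_sym[of a \<beta>] by (auto simp: perp_def)
  then show ?thesis using assms by (auto simp: orth_def perp_def)
qed

lemma perp_notin: "\<beta> \<in> perp A \<Longrightarrow> \<beta> \<notin> A"
  using norm_nz by (auto simp: perp_def)

lemma card_perp_insert: assumes "\<beta> \<in> perp A" shows "card (perp (insert \<beta> A)) < card (perp A)"
  using assms perp_insert_subset[of \<beta> A] not_self_perp[of \<beta> A] perp_subset finite_perp
  by (intro psubset_card_mono) blast+

text \<open>
  Suppose that \<open>w\<close> acts as \<open>-1\<close> on the complement of \<open>A\<close>. For a further \<open>a\<close> in this complement,
  \<open>refl a \<circ> w\<close> fixes \<open>a\<close> and still acts as \<open>-1\<close> on the vectors orthogonal to \<open>A\<close> and
  \<open>a\<close>. By the stabilizer theorem, applied in \<open>perp A\<close>, it is a product of reflections orthogonal to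
  \<open>a\<close>.
\<close>

lemma minus_one_perp:
  assumes "orth A"
  shows "\<exists>w\<in>group_of (perp A). \<forall>x\<in>span H. (\<forall>a\<in>A. ip x a = 0) \<longrightarrow> w x = - x"
  using orth_finite[OF assms] assms
proof (induction A)
  case empty
  then show ?case using minus_one by simp
next
  case (insert a A)
  have orth: "orth A" using insert.prems by (auto simp: orth_def)
  then obtain w where w: "w \<in> group_of (perp A)" "\<forall>x\<in>span H. (\<forall>a\<in>A. ip x a = 0) \<longrightarrow> w x = - x"
    using insert.IH by blast
  have aH: "a \<in> H" using insert.prems by (simp add: orth_def)
  have "ip a b = 0" if "b \<in> A" for b
  proof -
    have "a \<noteq> b" using insert.hyps(2) that by blast
    then show ?thesis using insert.prems that by (simp add: orth_def)
  qed
  then have a: "a \<in> perp A" using aH by (simp add: perp_def)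
  have "w a = - a" using w(2) a span_base[OF aH] by (simp add: perp_def)
  then have fix_a: "(refl a \<circ> w) a = a" using refl_self[OF norm_nz[OF aH]] by simp
  interpret P: reflection_system ip "perp A" by (rule perp_system)
  have "refl a \<circ> w \<in> group_of (perp A)" using a w(1) group_of.group_refl by blast
  then have "refl a \<circ> w \<in> group_of (perp (insert a A))"
    using P.stabilizer_generated_by_reflections[where w = "refl a \<circ> w" and v = a] fix_a
    by (simp only: perp_insert)
  moreover have "(refl a \<circ> w) x = - x" if "x \<in> span H" "\<forall>b\<in>insert a A. ip x b = 0" for x
    using w(2) that refl_fix[of "- x" a] by simp
  ultimately show ?case by blast
qed

text \<open>
  Here the group of \<open>perp A\<close> is trivial, while it contains an element that acts as \<open>-1\<close> on the
  complement of \<open>A\<close>.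
\<close>

lemma orth_complete:
  assumes "orth A" "perp A = {}" "x \<in> span H" "\<And>a. a \<in> A \<Longrightarrow> ip x a = 0"
  shows "x = 0"
proof -
  have "w = id" if "w \<in> group_of {}" for w using that by cases auto
  then have "x = - x" using minus_one_perp[OF assms(1)] assms by (metis id_apply)
  then show ?thesis by (simp add: eq_neg_iff_add_eq_0 flip: scaleR_2)
qed

lemma ip_sum_orth:
  assumes "orth A" "b \<in> A" shows "ip (\<Sum>a\<in>A. u a *\<^sub>R a) b = u b * ip b b"
proof -
  have "ip (\<Sum>a\<in>A. u a *\<^sub>R a) b = (\<Sum>a\<in>A. if a = b then u b * ip b b else 0)"
    unfolding ip_sum using assms by (intro sum.cong) (auto simp: orth_def ip_scale)
  then show ?thesis using assms orth_finite by simp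
qed

lemma proj_orthogonal:
  assumes "orth A" "a \<in> A" shows "ip (proj A y) a = 0"
  using ip_sum_orth[OF assms] norm_nz assms by (auto simp: proj_def ip_diff orth_def)

lemma proj_adjoint: "ip x (proj A y) = ip (proj A x) y"
  by (simp add: proj_def ip_diff ip_sum ip_sum_right ip_scale ip_scale_right ip_sym[of _ y] mult.commute)

lemma proj_perp: "h \<in> perp A \<Longrightarrow> proj A h = h"
  by (simp add: proj_def perp_def)

lemma ip_perp_proj: "h \<in> perp A \<Longrightarrow> ip h (proj A y) = ip h y"
  by (simp add: proj_adjoint proj_perp)

lemma orth_independent: assumes "orth A" shows "independent A"
proof
  assume "dependent A"
  then obtain u v where u: "v \<in> A" "u v \<noteq> 0" "(\<Sum>a\<in>A. u a *\<^sub>R a) = 0"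
    using dependent_finite[OF orth_finite[OF assms]] by blast
  then have "u v * ip v v = 0" using ip_sum_orth[OF assms u(1), of u] by simp
  then show False using u norm_nz assms by (auto simp: orth_def)
qed

lemma card_orth_le: assumes "orth A" shows "card A \<le> dim H"
proof -
  obtain B where B: "B \<subseteq> H" "H \<subseteq> span B" "card B = dim H" using basis_exists by metis
  then have "card A \<le> card B"
    using independent_span_bound[OF _ orth_independent[OF assms]] finite_subset[OF _ finite_H] assms
    by (metis orth_def subset_trans)
  then show ?thesis using B by simp
qed

lemma card_orth_complete: assumes "orth A" "perp A = {}" shows "card A = dim H"
proof -
  have "h \<in> span A" if h: "h \<in> H" for h
  proof -
    have A: "a \<in> span H" if "a \<in> A" for a using assms that span_base by (auto simp: orth_def)
    have "proj A h \<in> span H" unfolding proj_def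
      using h A by (intro span_diff span_sum span_scale) (auto intro: span_base)
    then have "proj A h = 0" using orth_complete[OF assms] proj_orthogonal[OF assms(1)] by blast
    then have "h = (\<Sum>a\<in>A. (ip h a / ip a a) *\<^sub>R a)" by (simp add: proj_def)
    moreover have "(\<Sum>a\<in>A. (ip h a / ip a a) *\<^sub>R a) \<in> span A"
      by (intro span_sum span_scale span_base)
    ultimately show ?thesis by metis
  qed
  then have "span A = span H"
    using assms(1) by (metis orth_def span_eq span_superset subset_eq subset_trans)
  then show ?thesis using dim_eq_card[OF _ orth_independent[OF assms(1)]] by metis
qed

section \<open>Parity\<close>

text \<open>
  This is \<open>q\<close> of the system \<open>perp A\<close>, which has \<open>card (perp A) / 2\<close> positive elements and rank
  \<open>dim H - card A\<close>; half the sum of these two numbers is \<open>q\<close>.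
\<close>

definition q_exponent :: "'a set \<Rightarrow> nat"
  where "q_exponent A = (card (perp A) + 2 * (dim H - card A)) div 4"

text \<open>
  Adding \<open>\<alpha>\<close> to \<open>A\<close> lowers the rank by one and removes from \<open>perp A\<close> twice an odd number of vectors,
  so divisibility for \<open>insert \<alpha> A\<close> gives it for \<open>A\<close>. The induction starts with the sets \<open>A\<close> for
  which \<open>perp A\<close> is empty; these have \<open>dim H\<close> elements.
\<close>

lemma four_dvd:
  assumes "orth A" shows "4 dvd card (perp A) + 2 * (dim H - card A)"
  using assms
proof (induction "card (perp A)" arbitrary: A rule: less_induct)
  case less
  show ?case
  proof (cases "perp A = {}")
    case True
    then show ?thesis using card_orth_complete[OF less.prems] by simp
  next
    case False
    then obtain \<alpha> where \<alpha>: "\<alpha> \<in> perp A" by blast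
    note orth = orth_insert[OF less.prems \<alpha>]
    interpret P: reflection_system ip "perp A" by (rule perp_system)
    obtain k where "4 * k = card (perp (insert \<alpha> A)) + 2 * (dim H - card (insert \<alpha> A))"
      using less.hyps[OF card_perp_insert[OF \<alpha>] orth] by (metis dvdE)
    moreover have "card (insert \<alpha> A) = Suc (card A)"
      using perp_notin[OF \<alpha>] orth_finite[OF less.prems] by simp
    moreover have "Suc (card A) \<le> dim H" using card_orth_le[OF orth] calculation by simp
    moreover obtain m where "card {h \<in> perp A. ip h \<alpha> > 0} = 2 * m + 1"
      using P.odd_card_half[OF \<alpha>] by (metis oddE)
    moreover have "card (perp A) = card (perp (insert \<alpha> A)) + 2 * card {h \<in> perp A. ip h \<alpha> > 0}"
      using P.card_split[of \<alpha>] by (simp add: perp_insert)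
    ultimately have "card (perp A) + 2 * (dim H - card A) = 4 * (k + m + 1)" by simp
    then show ?thesis by simp
  qed
qed

lemma q_exponent_eq: "orth A \<Longrightarrow> 4 * q_exponent A = card (perp A) + 2 * (dim H - card A)"
  unfolding q_exponent_def using four_dvd dvd_mult_div_cancel by blast

text \<open>
  In the product of all four relative signs, a vector orthogonal to \<open>\<alpha>\<close> or to \<open>\<beta>\<close> occurs an even
  number of times. What remains is the product over the vectors orthogonal to neither, which is
  \<open>(-1) ^ card T\<close>. There are \<open>4 card T\<close> such vectors, and the ranks cancel in the alternating sum of the
  four values of \<open>q\<close>, so the powers of \<open>-1\<close> contribute the same sign.
\<close>

lemma rel_sign_corner:
  assumes A: "orth A" and adj: "adjacent (perp A) \<alpha> y y'" "adjacent (perp A) \<beta> x x'" and orth: "ip \<alpha> \<beta> = 0"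
  defines "s \<equiv> \<lambda>B. (-1) ^ q_exponent B * rel_sign (perp B) x y"
  shows "s A * s (insert \<alpha> A) = s (insert \<beta> A) * s (insert \<alpha> (insert \<beta> A))"
proof -
  let ?Q = "perp A" and ?a = "insert \<alpha> A" and ?b = "insert \<beta> A" and ?ab = "insert \<alpha> (insert \<beta> A)"
  define T where "T = {h\<in>?Q. ip h \<alpha> > 0 \<and> ip h \<beta> > 0}"
  define N where "N = {h\<in>?Q. ip h \<alpha> \<noteq> 0 \<and> ip h \<beta> > 0}"
  interpret P: reflection_system ip ?Q by (rule perp_system)
  have in_perp: "\<alpha> \<in> ?Q" "\<beta> \<in> ?Q" using adj by (auto simp: adjacent_def)
  then have in_perp': "\<alpha> \<in> perp ?b" "\<beta> \<in> perp ?a" using orth by (auto simp: perp_insert ip_sym)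
  have orths: "orth ?a" "orth ?b" "orth ?ab" using orth_insert A in_perp in_perp' by blast+
  have signs: "(\<Prod>h\<in>N. sgn (ip x h * ip y h)) = (-1) ^ card T" and cN: "card N = 2 * card T"
    using P.orthogonal_walls_sign[OF adj orth] by (simp_all add: N_def T_def)
  have fin: "finite ?Q" by (rule finite_perp)
  obtain z0 where z0: "reg ?Q z0" using P.exists_regular by blast
  \<comment> \<open>the half for which \<open>orthogonal_walls_sign\<close> gives the product over the vectors orthogonal to neither wall\<close>
  define P0 where "P0 = {h\<in>?Q. ip h \<beta> = 0 \<and> ip h z0 > 0} \<union> {h\<in>?Q. ip h \<beta> > 0}"
  have half: "is_half {h\<in>?Q. C h} {h\<in>P0. C h}" if "\<And>h. C (- h) = C h" for C
    unfolding P0_def by (rule is_half_filter, rule is_half_lexicographic) (use P.uminus_H z0 that in auto)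
  let ?E = "\<lambda>S. (\<Prod>h\<in>S. sgn (ip x h * ip y h))"
  have E: "rel_sign {h\<in>?Q. C h} x y = ?E {h\<in>P0. C h}" if "\<And>h. C (- h) = C h" for C
    by (rule rel_sign_half, rule half) (rule that)
  define Z where "Z = {h\<in>P0. ip h \<alpha> = 0 \<and> ip h \<beta> = 0}"
  define Za where "Za = {h\<in>P0. ip h \<alpha> = 0 \<and> ip h \<beta> \<noteq> 0}"
  define Zb where "Zb = {h\<in>P0. ip h \<alpha> \<noteq> 0 \<and> ip h \<beta> = 0}"
  have N': "N = {h\<in>P0. ip h \<alpha> \<noteq> 0 \<and> ip h \<beta> \<noteq> 0}" by (auto simp: N_def P0_def)
  have finP: "finite P0" using fin by (simp add: P0_def)
  note defs = Z_def Za_def Zb_def N'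
  have fins: "finite Z" "finite Za" "finite Zb" "finite N" using finP unfolding defs by auto
  have unions: "{h\<in>P0. True} = (Z \<union> Za) \<union> (Zb \<union> N)" "{h\<in>P0. ip h \<alpha> = 0} = Z \<union> Za" "{h\<in>P0. ip h \<beta> = 0} = Z \<union> Zb"
    unfolding defs by auto
  have disj: "(Z \<union> Za) \<inter> (Zb \<union> N) = {}" "Z \<inter> Za = {}" "Zb \<inter> N = {}" "Z \<inter> Zb = {}"
    unfolding defs by auto
  have parts:
    "?E {h\<in>P0. True} = (?E Z * ?E Za) * (?E Zb * ?E N)" "?E {h\<in>P0. ip h \<alpha> = 0} = ?E Z * ?E Za"
    "?E {h\<in>P0. ip h \<beta> = 0} = ?E Z * ?E Zb"
    "card {h\<in>P0. True} = (card Z + card Za) + (card Zb + card N)"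
    "card {h\<in>P0. ip h \<alpha> = 0} = card Z + card Za" "card {h\<in>P0. ip h \<beta> = 0} = card Z + card Zb"
    unfolding unions using fins disj by (simp_all add: prod.union_disjoint card_Un_disjoint)
  have perps: "?Q = {h\<in>?Q. True}" "perp ?a = {h\<in>?Q. ip h \<alpha> = 0}" "perp ?b = {h\<in>?Q. ip h \<beta> = 0}"
    "perp ?ab = {h\<in>?Q. ip h \<alpha> = 0 \<and> ip h \<beta> = 0}" by (auto simp: perp_insert)
  have sq: "t * t = 1" if "t \<in> {?E Z, ?E Za, ?E Zb}" for t
  proof -
    have "sgn (ip x h * ip y h) * sgn (ip x h * ip y h) = 1" if "h \<in> P0" for h
      using that adjacent_reg(1)[OF adj(1)] adjacent_reg(1)[OF adj(2)]
      by (auto simp: P0_def reg_def sgn_mult sgn_real_def)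
    then show ?thesis using that by (auto simp: Z_def Za_def Zb_def simp flip: prod.distrib)
  qed
  have rs: "rel_sign ?Q x y = ?E {h\<in>P0. True}" "rel_sign (perp ?a) x y = ?E {h\<in>P0. ip h \<alpha> = 0}"
     "rel_sign (perp ?b) x y = ?E {h\<in>P0. ip h \<beta> = 0}" "rel_sign (perp ?ab) x y = ?E Z"
    using E[of "\<lambda>_. True"] E[of "\<lambda>h. ip h \<alpha> = 0"] E[of "\<lambda>h. ip h \<beta> = 0"]
      E[of "\<lambda>h. ip h \<alpha> = 0 \<and> ip h \<beta> = 0"] perps by (simp_all add: Z_def)
  have half_card: "card {h\<in>?Q. C h} = 2 * card {h\<in>P0. C h}" if "\<And>h. C (- h) = C h" for C
    by (rule card_half[OF _ half]) (use fin that in auto)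
  have cards: "card ?Q = 2 * (card Z + card Za + card Zb + card N)" "card (perp ?a) = 2 * (card Z + card Za)"
     "card (perp ?b) = 2 * (card Z + card Zb)" "card (perp ?ab) = 2 * card Z"
    using half_card[of "\<lambda>_. True"] half_card[of "\<lambda>h. ip h \<alpha> = 0"] half_card[of "\<lambda>h. ip h \<beta> = 0"]
      half_card[of "\<lambda>h. ip h \<alpha> = 0 \<and> ip h \<beta> = 0"] parts perps by (simp_all add: Z_def)
  have "card ?a = Suc (card A)" "card ?b = Suc (card A)" "card ?ab = Suc (Suc (card A))"
    using perp_notin[OF in_perp(1)] perp_notin[OF in_perp(2)] perp_notin[OF in_perp'(1)] orth_finite[OF A]
    by simp_all
  moreover have "card ?ab \<le> dim H" using card_orth_le orths by blast
  ultimately have "4 * (q_exponent A + q_exponent ?ab) = 4 * (q_exponent ?a + q_exponent ?b + card T)"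
    using q_exponent_eq[OF A] orths[THEN q_exponent_eq] cN cards by simp
  then have q: "q_exponent A + q_exponent ?ab = q_exponent ?a + q_exponent ?b + card T" by simp
  define e where "e k = (-1::real) ^ k" for k :: nat
  have e_add: "e (j + k) = e j * e k" and e_sq: "e k * e k = 1" for j k
    by (simp_all add: e_def power_add flip: power_mult_distrib)
  have "e (q_exponent A) * e (q_exponent ?ab) = e (q_exponent ?a) * e (q_exponent ?b) * e (card T)"
    using q by (simp flip: e_add)
  then have "e (q_exponent A) = e (q_exponent ?a) * e (q_exponent ?b) * e (card T) * e (q_exponent ?ab)"
    using e_sq[of "q_exponent ?ab"] by (metis mult.assoc mult.right_neutral)
  then have qq: "e (q_exponent A) * e (q_exponent ?a) * e (card T) = e (q_exponent ?b) * e (q_exponent ?ab)"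
    using e_sq[of "q_exponent ?a"] e_sq[of "card T"] by (simp add: algebra_simps)
  have "s A * s ?a = (e (q_exponent A) * e (q_exponent ?a) * e (card T)) * ((?E Z * ?E Z) * (?E Za * ?E Za) * ?E Zb)"
    unfolding s_def rs parts signs e_def by (simp only: mult_ac)
  also have "\<dots> = (e (q_exponent ?b) * e (q_exponent ?ab)) * ((?E Z * ?E Z) * ?E Zb)"
    unfolding qq by (simp add: sq)
  also have "\<dots> = s ?b * s ?ab" by (simp add: s_def rs parts e_def)
  finally show ?thesis .
qed

section \<open>The recursion for the stable constants\<close>

text \<open>
  The three clauses are the initial condition, the support condition and the wall-crossing formula, for all
  systems \<open>perp A\<close> at once. The pairing of the projections of \<open>x\<close> and \<open>y\<close> is \<open>ip x (proj A y)\<close>.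
  Values at points that are not regular are unconstrained, except in the first clause, where every point is
  regular.
\<close>

definition ds_recursion :: "('a set \<Rightarrow> 'a \<Rightarrow> 'a \<Rightarrow> real) \<Rightarrow> bool" where
  "ds_recursion F \<longleftrightarrow> (\<forall>A. orth A \<longrightarrow>
     (\<forall>x y. perp A = {} \<longrightarrow> F A x y = 1) \<and>
     (\<forall>x y. reg (perp A) x \<longrightarrow> reg (perp A) y \<longrightarrow> ip x (proj A y) > 0 \<longrightarrow> F A x y = 0) \<and>
     (\<forall>\<beta> x x' y t. adjacent (perp A) \<beta> x x' \<longrightarrow> reg (perp A) y \<longrightarrow> 0 \<le> t \<longrightarrow> t \<le> 1 \<longrightarrow>
        ip ((1 - t) *\<^sub>R x + t *\<^sub>R x') \<beta> = 0 \<longrightarrow>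
        F A x y + F A x' y = 2 * F (insert \<beta> A) ((1 - t) *\<^sub>R x + t *\<^sub>R x') y))"

lemma ds_recursion_empty: "ds_recursion F \<Longrightarrow> orth A \<Longrightarrow> perp A = {} \<Longrightarrow> F A x y = 1"
  unfolding ds_recursion_def by blast

lemma ds_recursion_support:
  "ds_recursion F \<Longrightarrow> orth A \<Longrightarrow> reg (perp A) x \<Longrightarrow> reg (perp A) y \<Longrightarrow> ip x (proj A y) > 0 \<Longrightarrow> F A x y = 0"
  unfolding ds_recursion_def by blast

lemma wall_point_same_chamber:
  assumes "adjacent Q \<beta> x x'" "0 \<le> t" "t \<le> 1" "ip \<beta> \<beta> \<noteq> 0"
  shows "same_chamber {h\<in>Q. ip h \<beta> = 0} x ((1 - t) *\<^sub>R x + t *\<^sub>R x')"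
  unfolding same_chamber_def
proof
  fix h assume h: "h \<in> {h\<in>Q. ip h \<beta> = 0}"
  then have "h \<noteq> \<beta>" "h \<noteq> - \<beta>" using assms(4) by auto
  then have p: "ip x h * ip x' h > 0" using assms(1) h by (simp add: adjacent_def)
  then have q: "ip x h * ip x h > 0" by (auto simp: zero_less_mult_iff)
  have "ip x h * ip ((1 - t) *\<^sub>R x + t *\<^sub>R x') h = (1 - t) * (ip x h * ip x h) + t * (ip x h * ip x' h)"
    by (simp add: ip_linear algebra_simps)
  also have "\<dots> > 0"
  proof (cases "t = 0")
    case False
    then have "t * (ip x h * ip x' h) > 0" "(1 - t) * (ip x h * ip x h) \<ge> 0" using assms p q by simp_all
    then show ?thesis by linarith
  qed (use q in simp)
  finally show "ip x h * ip ((1 - t) *\<^sub>R x + t *\<^sub>R x') h > 0" .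
qed

lemma wall_point_exists:
  assumes "adjacent Q \<beta> x x'"
  shows "\<exists>t. 0 \<le> t \<and> t \<le> 1 \<and> ip ((1 - t) *\<^sub>R x + t *\<^sub>R x') \<beta> = 0"
proof -
  let ?a = "ip x \<beta>" and ?b = "ip x' \<beta>"
  have ab: "?a * ?b < 0" using assms by (simp add: adjacent_def)
  then have "0 \<le> ?a / (?a - ?b)" "?a / (?a - ?b) \<le> 1"
    by (auto simp: mult_less_0_iff zero_le_divide_iff divide_le_eq)
  moreover have "?a / (?a - ?b) * (?a - ?b) = ?a" using ab by (auto simp: mult_less_0_iff)
  then have "(1 - ?a / (?a - ?b)) * ?a + ?a / (?a - ?b) * ?b = 0" by (simp only: algebra_simps)
  ultimately show ?thesis by (intro exI[of _ "?a / (?a - ?b)"]) (simp add: ip_linear)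
qed

text \<open>
  Two points of the same chamber have a common neighbour across any wall, so the values there differ by twice
  the difference of two values for the wall, which vanishes by induction.
\<close>

lemma ds_recursion_same_x:
  assumes "ds_recursion F" "orth A" "same_chamber (perp A) x1 x2" "reg (perp A) y"
  shows "F A x1 y = F A x2 y"
  using assms(2-4)
proof (induction "card (perp A)" arbitrary: A x1 x2 rule: less_induct)
  case less
  show ?case
  proof (cases "perp A = {}")
    case True
    then show ?thesis using ds_recursion_empty[OF assms(1) less.prems(1)] by simp
  next
    case False
    interpret P: reflection_system ip "perp A" by (rule perp_system)
    obtain \<beta> x' where a1: "adjacent (perp A) \<beta> x1 x'"
      using P.exists_wall[OF False] same_chamber_reg less.prems(2) by blast
    have a2: "adjacent (perp A) \<beta> x2 x'" using adjacent_same_left[OF same_chamber_sym[OF less.prems(2)] a1] .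
    have \<beta>: "\<beta> \<in> perp A" using a1 by (simp add: adjacent_def)
    then have n: "ip \<beta> \<beta> \<noteq> 0" using P.norm_nz by blast
    obtain t1 where t1: "0 \<le> t1" "t1 \<le> 1" "ip ((1 - t1) *\<^sub>R x1 + t1 *\<^sub>R x') \<beta> = 0"
      using wall_point_exists[OF a1] by blast
    obtain t2 where t2: "0 \<le> t2" "t2 \<le> 1" "ip ((1 - t2) *\<^sub>R x2 + t2 *\<^sub>R x') \<beta> = 0"
      using wall_point_exists[OF a2] by blast
    let ?z1 = "(1 - t1) *\<^sub>R x1 + t1 *\<^sub>R x'" and ?z2 = "(1 - t2) *\<^sub>R x2 + t2 *\<^sub>R x'"
    have "same_chamber (perp (insert \<beta> A)) x1 ?z1" "same_chamber (perp (insert \<beta> A)) x2 ?z2"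
      using wall_point_same_chamber a1 a2 t1 t2 n by (simp_all add: perp_insert)
    moreover have "same_chamber (perp (insert \<beta> A)) x1 x2"
      using same_chamber_mono[OF less.prems(2) perp_insert_subset] .
    ultimately have "same_chamber (perp (insert \<beta> A)) ?z1 ?z2"
      using same_chamber_trans same_chamber_sym by blast
    then have "F (insert \<beta> A) ?z1 y = F (insert \<beta> A) ?z2 y"
      using less.hyps[OF card_perp_insert[OF \<beta>] orth_insert[OF less.prems(1) \<beta>]]
        reg_mono[OF less.prems(3) perp_insert_subset] by blast
    moreover have "F A x1 y + F A x' y = 2 * F (insert \<beta> A) ?z1 y" "F A x2 y + F A x' y = 2 * F (insert \<beta> A) ?z2 y"
      using assms(1) less.prems a1 a2 t1 t2 unfolding ds_recursion_def by blast+
    ultimately show ?thesis by simp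
  qed
qed

lemma ds_recursion_adjacent:
  assumes "ds_recursion F" "orth A" "adjacent (perp A) \<beta> x x'" "reg (perp A) y"
  shows "F A x y + F A x' y = 2 * F (insert \<beta> A) x y"
proof -
  have \<beta>: "\<beta> \<in> perp A" "\<beta> \<in> H" using assms(3) perp_subset by (auto simp: adjacent_def)
  obtain t where t: "0 \<le> t" "t \<le> 1" "ip ((1 - t) *\<^sub>R x + t *\<^sub>R x') \<beta> = 0"
    using wall_point_exists[OF assms(3)] by blast
  have "F A x y + F A x' y = 2 * F (insert \<beta> A) ((1 - t) *\<^sub>R x + t *\<^sub>R x') y"
    using assms t unfolding ds_recursion_def by blast
  moreover have "same_chamber (perp (insert \<beta> A)) x ((1 - t) *\<^sub>R x + t *\<^sub>R x')"
    using wall_point_same_chamber[OF assms(3) t(1,2) norm_nz[OF \<beta>(2)]] by (simp add: perp_insert)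
  ultimately show ?thesis
    using ds_recursion_same_x[OF assms(1) orth_insert[OF assms(2) \<beta>(1)]] reg_mono[OF assms(4) perp_insert_subset]
    by metis
qed

lemma regular_point_positive:
  assumes "\<gamma> \<in> perp A" "finite T" "\<And>v. v \<in> T \<Longrightarrow> ip \<gamma> v > 0"
  shows "\<exists>x. reg H x \<and> (\<forall>v\<in>T. ip x v > 0)"
proof -
  obtain x where "reg H x" "\<forall>v\<in>T. ip \<gamma> v \<noteq> 0 \<longrightarrow> ip \<gamma> v * ip x v > 0"
    using perturb_regular[OF assms(2)] by blast
  then show ?thesis using assms(3) by (metis less_irrefl zero_less_mult_pos)
qed

lemma exists_positive_root:
  assumes "perp A \<noteq> {}" "reg (perp A) y" shows "\<exists>\<gamma>\<in>perp A. ip \<gamma> y > 0"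
proof -
  interpret P: reflection_system ip "perp A" by (rule perp_system)
  obtain \<gamma> where \<gamma>: "\<gamma> \<in> perp A" "ip \<gamma> y \<noteq> 0" using assms ip_sym by (metis all_not_in_conv reg_def)
  show ?thesis
  proof (cases "ip \<gamma> y > 0")
    case False
    then have "ip (- \<gamma>) y > 0" using \<gamma> by simp
    then show ?thesis using P.neg_closed \<gamma> by blast
  qed (use \<gamma> in blast)
qed

text \<open>
  By induction the difference changes sign at every wall, so it suffices to find one regular \<open>x\<close> at which the
  support condition makes both terms vanish. A small perturbation of some \<open>\<gamma> \<in> perp A\<close> with
  \<open>ip \<gamma> y1 > 0\<close> will do: since \<open>y2\<close> lies in the same chamber, \<open>ip \<gamma> y2 > 0\<close> too, and projecting
  \<open>y1\<close> and \<open>y2\<close> does not change these inner products.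
\<close>

theorem ds_recursion_unique_chamberwise:
  assumes "ds_recursion F" "ds_recursion G" "orth A" "reg (perp A) x" "same_chamber (perp A) y1 y2"
  shows "F A x y1 = G A x y2"
  using assms(3-5)
proof (induction "card (perp A)" arbitrary: A x rule: less_induct)
  case less
  have reg_y: "reg (perp A) y1" "reg (perp A) y2" using same_chamber_reg less.prems(3) by blast+
  show ?case
  proof (cases "perp A = {}")
    case True
    then show ?thesis
      using ds_recursion_empty[OF assms(1) less.prems(1)] ds_recursion_empty[OF assms(2) less.prems(1)] by simp
  next
    case False
    interpret P: reflection_system ip "perp A" by (rule perp_system)
    obtain \<gamma> where \<gamma>: "\<gamma> \<in> perp A" "ip \<gamma> y1 > 0" using exists_positive_root[OF False reg_y(1)] by blast
    have "ip y1 \<gamma> * ip y2 \<gamma> > 0" using less.prems(3) \<gamma>(1) by (simp add: same_chamber_def)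
    then have "ip \<gamma> y2 > 0" using \<gamma>(2) by (simp add: ip_sym[of _ \<gamma>] zero_less_mult_iff)
    then have "\<exists>x. reg H x \<and> (\<forall>v\<in>{proj A y1, proj A y2}. ip x v > 0)"
      using ip_perp_proj[OF \<gamma>(1)] \<gamma>(2) by (intro regular_point_positive[OF \<gamma>(1)]) auto
    then obtain x0 where x0: "reg H x0" "ip x0 (proj A y1) > 0" "ip x0 (proj A y2) > 0" by auto
    then have reg0: "reg (perp A) x0" using reg_mono perp_subset by blast
    have "F A x y1 - G A x y2 = 0"
    proof (rule P.vanishes_if_antisymmetric_across_walls[of "\<lambda>x. F A x y1 - G A x y2", OF _ _ reg0 _ less.prems(2)])
      show "F A x0 y1 - G A x0 y2 = 0"
        using ds_recursion_support[OF assms(1) less.prems(1) reg0 reg_y(1) x0(2)]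
          ds_recursion_support[OF assms(2) less.prems(1) reg0 reg_y(2) x0(3)] by simp
      show "F A u y1 - G A u y2 = F A u' y1 - G A u' y2" if "same_chamber (perp A) u u'" for u u'
        using ds_recursion_same_x[OF assms(1) less.prems(1) that reg_y(1)]
          ds_recursion_same_x[OF assms(2) less.prems(1) that reg_y(2)] by simp
      show "F A u y1 - G A u y2 + (F A u' y1 - G A u' y2) = 0" if adj: "adjacent (perp A) \<beta> u u'" for \<beta> u u'
      proof -
        have \<beta>: "\<beta> \<in> perp A" using adj by (simp add: adjacent_def)
        have "F (insert \<beta> A) u y1 = G (insert \<beta> A) u y2"
          using less.hyps[OF card_perp_insert[OF \<beta>] orth_insert[OF less.prems(1) \<beta>]]
            reg_mono[OF adjacent_reg(1)[OF adj] perp_insert_subset]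
            same_chamber_mono[OF less.prems(3) perp_insert_subset] by blast
        then show ?thesis
          using ds_recursion_adjacent[OF assms(1) less.prems(1) adj reg_y(1)]
            ds_recursion_adjacent[OF assms(2) less.prems(1) adj reg_y(2)] by simp
      qed
    qed
    then show ?thesis by simp
  qed
qed

corollary ds_recursion_unique:
  assumes "ds_recursion F" "ds_recursion G" "orth A" "reg (perp A) x" "reg (perp A) y"
  shows "F A x y = G A x y"
  using ds_recursion_unique_chamberwise[OF assms(1-4) same_chamber_refl[OF assms(5)]] .

corollary ds_recursion_same_y:
  assumes "ds_recursion F" "orth A" "same_chamber (perp A) y1 y2" "reg (perp A) x"
  shows "F A x y1 = F A x y2"
  using ds_recursion_unique_chamberwise[OF assms(1,1,2,4,3)] .

text \<open>
  As functions of \<open>x\<close>, both sides change sign at a wall \<open>\<beta>\<close> not orthogonal to \<open>\<alpha>\<close>: on the left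
  because \<open>y\<close> and \<open>y'\<close> are in the same chamber of \<open>perp (insert \<beta> A)\<close>, on the right because of
  the factor \<open>s A x\<close>. At a wall orthogonal to \<open>\<alpha>\<close> both signs on the right change, so the sum over the
  two sides of the wall is given by the recursion for \<open>insert \<alpha> A\<close>, and on the left by the induction
  hypothesis for \<open>insert \<beta> A\<close>; the signs agree by \<open>rel_sign_corner\<close>. It remains to find one point where the two sides agree. In general this is
  a point where all three terms vanish by the support condition; if \<open>perp (insert \<alpha> A)\<close> is empty, then
  \<open>perp A = {\<alpha>, - \<alpha>}\<close> has rank one and the values are computed directly.
\<close>

theorem ds_recursion_wall_formula:
  assumes F: "ds_recursion F"
    and "orth A" "adjacent (perp A) \<alpha> y y'" "reg (perp A) x"
  defines "s \<equiv> \<lambda>A x. (-1) ^ q_exponent A * rel_sign (perp A) x y"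
  shows "F A x y - F A x y' = 2 * (s A x * s (insert \<alpha> A) x) * F (insert \<alpha> A) x y"
  using assms(2-4)
proof (induction "card (perp A)" arbitrary: A x rule: less_induct)
  case less
  note A = less.prems(1) and adj_y = less.prems(2)
  have \<alpha>: "\<alpha> \<in> perp A" "\<alpha> \<in> H" using adj_y perp_subset by (auto simp: adjacent_def)
  have reg_y: "reg (perp A) y" "reg (perp A) y'" using adjacent_reg[OF adj_y] by blast+
  let ?a = "insert \<alpha> A"
  have oa: "orth ?a" using orth_insert A \<alpha> by blast
  have reg_ya: "reg (perp ?a) y" using reg_mono[OF reg_y(1) perp_insert_subset] .
  interpret P: reflection_system ip "perp A" by (rule perp_system)
  interpret Pa: reflection_system ip "perp ?a" by (rule perp_system)
  let ?f = "\<lambda>x. F A x y - F A x y' - 2 * (s A x * s ?a x) * F ?a x y"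
  have "\<exists>x0. reg (perp A) x0 \<and> ?f x0 = 0"
  proof (cases "perp ?a = {}")
    case True
    have rank1: "h = \<alpha> \<or> h = - \<alpha>" if h: "h \<in> perp A" for h
    proof -
      let ?c = "ip h \<alpha> / ip \<alpha> \<alpha>"
      have hH: "h \<in> H" using h perp_subset by blast
      have "h - ?c *\<^sub>R \<alpha> \<in> span H" using hH \<alpha>(2) by (intro span_diff span_scale span_base)
      moreover have "ip (h - ?c *\<^sub>R \<alpha>) a = 0" if "a \<in> ?a" for a
        using that h \<alpha>(1) norm_nz[OF \<alpha>(2)] by (auto simp: ip_linear perp_def)
      ultimately have "h - ?c *\<^sub>R \<alpha> = 0" using orth_complete[OF oa True] by blast
      then obtain c where "h = c *\<^sub>R \<alpha>" by (metis eq_iff_diff_eq_0)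
      then show ?thesis using reduced[OF \<alpha>(2), of c] hH by auto
    qed
    \<comment> \<open>a point of the chamber of \<open>y\<close>, so that the support condition applies to it and \<open>y\<close>, and to its negative and \<open>y'\<close>\<close>
    define x0 where "x0 = ip y \<alpha> *\<^sub>R \<alpha>"
    have yy: "ip y \<alpha> * ip y' \<alpha> < 0" using adj_y by (simp add: adjacent_def)
    then have y0: "ip y \<alpha> * ip y \<alpha> > 0" by (auto simp: mult_less_0_iff zero_less_mult_iff)
    have n: "ip \<alpha> \<alpha> > 0" by (rule norm_pos[OF \<alpha>(2)])
    have adj0: "adjacent (perp A) \<alpha> x0 (- x0)"
      unfolding adjacent_def
    proof (intro conjI ballI impI)
      have "ip x0 \<alpha> * ip (- x0) \<alpha> = - (ip y \<alpha> * ip y \<alpha>) * (ip \<alpha> \<alpha> * ip \<alpha> \<alpha>)"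
        by (simp add: x0_def ip_linear)
      also have "\<dots> < 0" using y0 n by (simp add: mult_pos_pos)
      finally show "ip x0 \<alpha> * ip (- x0) \<alpha> < 0" .
    qed (use rank1 \<alpha> in auto)
    have reg0: "reg (perp A) x0" "reg (perp A) (- x0)" using adjacent_reg[OF adj0] by blast+
    have ip\<alpha>: "ip \<alpha> (proj A v) = ip v \<alpha>" for v using ip_perp_proj[OF \<alpha>(1)] ip_sym by metis
    have "F A x0 y = 0"
      using y0 \<alpha>(1) by (intro ds_recursion_support[OF F A reg0(1) reg_y(1)])
        (simp add: x0_def ip_scale ip\<alpha>)
    moreover have "F A (- x0) y' = 0"
      using yy \<alpha>(1) by (intro ds_recursion_support[OF F A reg0(2) reg_y(2)])
        (simp add: x0_def ip_scale ip\<alpha>)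
    moreover have "F A x0 y' + F A (- x0) y' = 2"
      using ds_recursion_adjacent[OF F A adj0 reg_y(2)] ds_recursion_empty[OF F oa True] by simp
    moreover have "F ?a x0 y = 1" using ds_recursion_empty[OF F oa True] .
    moreover have "s A x0 * s ?a x0 = -1"
    proof -
      have perpA: "perp A = {\<alpha>, - \<alpha>}" using rank1 P.neg_closed \<alpha>(1) by blast
      have ne: "\<alpha> \<noteq> - \<alpha>" using n by (metis ip_minus(1) less_irrefl neg_less_0_iff_less order_less_trans)
      have "is_half (perp A) {\<alpha>}" using ne unfolding perpA is_half_def by auto
      then have "rel_sign (perp A) x0 y = sgn (ip x0 \<alpha> * ip y \<alpha>)" by (simp add: rel_sign_half)
      also have "ip x0 \<alpha> * ip y \<alpha> = (ip y \<alpha> * ip y \<alpha>) * ip \<alpha> \<alpha>" by (simp add: x0_def ip_linear)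
      also have "sgn \<dots> = 1" using y0 n by (metis mult_pos_pos sgn_pos)
      finally have r1: "rel_sign (perp A) x0 y = 1" .
      have "is_half (perp ?a) {}" unfolding True is_half_def by simp
      then have r2: "rel_sign (perp ?a) x0 y = 1" by (simp add: rel_sign_half)
      have "card ?a = dim H" using card_orth_complete[OF oa True] .
      moreover have "card ?a = Suc (card A)" using perp_notin[OF \<alpha>(1)] orth_finite[OF A] by simp
      ultimately have "q_exponent A = 1" "q_exponent ?a = 0"
        using ne by (simp_all add: q_exponent_def True perpA)
      then show ?thesis by (simp add: s_def r1 r2)
    qed
    ultimately show ?thesis using reg0(1) by (intro exI[of _ x0]) simp
  next
    case False
    obtain \<gamma> where \<gamma>: "\<gamma> \<in> perp ?a" "ip \<gamma> y > 0" using exists_positive_root[OF False reg_ya] by blast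
    have \<gamma>A: "\<gamma> \<in> perp A" using \<gamma> perp_insert_subset by blast
    have "\<gamma> \<noteq> \<alpha>" "\<gamma> \<noteq> - \<alpha>" using \<gamma>(1) norm_nz[OF \<alpha>(2)] by (auto simp: perp_def)
    then have "ip y \<gamma> * ip y' \<gamma> > 0" using adj_y \<gamma>A by (simp add: adjacent_def)
    then have "ip \<gamma> y' > 0" using \<gamma>(2) by (simp add: ip_sym[of _ \<gamma>] zero_less_mult_iff)
    then have "\<exists>x. reg H x \<and> (\<forall>v\<in>{proj A y, proj A y', proj ?a y}. ip x v > 0)"
      using ip_perp_proj[OF \<gamma>A] ip_perp_proj[OF \<gamma>(1)] \<gamma>(2) by (intro regular_point_positive[OF \<gamma>(1)]) auto
    then obtain x0 where x0: "reg H x0" "ip x0 (proj A y) > 0" "ip x0 (proj A y') > 0" "ip x0 (proj ?a y) > 0"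
      by auto
    then have reg0: "reg (perp A) x0" "reg (perp ?a) x0" using reg_mono perp_subset by blast+
    have "F A x0 y = 0" "F A x0 y' = 0" "F ?a x0 y = 0"
      using ds_recursion_support[OF F A reg0(1)] ds_recursion_support[OF F oa reg0(2) reg_ya] reg_y x0 by simp_all
    then show ?thesis using reg0(1) by (intro exI[of _ x0]) simp
  qed
  then obtain x0 where x0: "reg (perp A) x0" "?f x0 = 0" by blast
  have "?f x = 0"
  proof (rule P.vanishes_if_antisymmetric_across_walls[of ?f, OF _ _ x0 less.prems(3)])
    fix u u' assume same: "same_chamber (perp A) u u'"
    have same_a: "same_chamber (perp ?a) u u'" using same_chamber_mono[OF same perp_insert_subset] .
    show "?f u = ?f u'"
      using ds_recursion_same_x[OF F A same] ds_recursion_same_x[OF F oa same_a reg_ya] reg_y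
        P.rel_sign_same_chamber[OF same] Pa.rel_sign_same_chamber[OF same_a] by (simp add: s_def)
  next
    fix \<beta> u u' assume adj: "adjacent (perp A) \<beta> u u'"
    let ?b = "insert \<beta> A"
    have \<beta>: "\<beta> \<in> perp A" "\<beta> \<in> H" using adj perp_subset by (auto simp: adjacent_def)
    have ob: "orth ?b" using orth_insert A \<beta> by blast
    have sA: "s A u' = - s A u" using P.rel_sign_adjacent[OF adj] by (simp add: s_def)
    have sum: "F A u y + F A u' y = 2 * F ?b u y" "F A u y' + F A u' y' = 2 * F ?b u y'"
      using ds_recursion_adjacent[OF F A adj] reg_y by blast+
    have reg_u: "reg (perp A) u" using adjacent_reg[OF adj] by blast
    have reg_ub: "reg (perp ?b) u" using reg_mono[OF reg_u perp_insert_subset] .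
    show "?f u + ?f u' = 0"
    proof (cases "ip \<alpha> \<beta> = 0")
      case False
      have "same_chamber (perp ?b) y y'"
        unfolding same_chamber_def
      proof
        fix h assume h: "h \<in> perp ?b"
        then have "h \<noteq> \<alpha>" "h \<noteq> - \<alpha>" using False by (auto simp: perp_def)
        then show "ip y h * ip y' h > 0" using adj_y h by (simp add: adjacent_def perp_insert)
      qed
      then have "F ?b u y = F ?b u y'" using ds_recursion_same_y[OF F ob _ reg_ub] by blast
      moreover have same_a: "same_chamber (perp ?a) u u'"
        unfolding same_chamber_def
      proof
        fix h assume h: "h \<in> perp ?a"
        then have "h \<noteq> \<beta>" "h \<noteq> - \<beta>" using False by (auto simp: perp_def ip_sym[of \<beta>])
        then show "ip u h * ip u' h > 0" using adj h by (simp add: adjacent_def perp_insert)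
      qed
      then have "F ?a u y = F ?a u' y" using ds_recursion_same_x[OF F oa _ reg_ya] by blast
      moreover have "s ?a u = s ?a u'" using Pa.rel_sign_same_chamber[OF same_a] by (simp add: s_def)
      ultimately show ?thesis using sum sA by simp
    next
      case True
      have \<alpha>b: "\<alpha> \<in> perp ?b" and \<beta>a: "\<beta> \<in> perp ?a" using True \<alpha> \<beta> by (auto simp: perp_insert ip_sym)
      have adj_yb: "adjacent (perp ?b) \<alpha> y y'"
        using adj_y \<alpha>b by (auto simp: adjacent_def perp_insert)
      have adj_a: "adjacent (perp ?a) \<beta> u u'"
        using adj \<beta>a by (auto simp: adjacent_def perp_insert)
      have comm: "insert \<alpha> ?b = insert \<beta> ?a" by blast
      have "F ?b u y - F ?b u y' = 2 * (s ?b u * s (insert \<beta> ?a) u) * F (insert \<beta> ?a) u y"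
        using less.hyps[OF card_perp_insert[OF \<beta>(1)] ob adj_yb reg_ub] unfolding comm .
      moreover have corner: "s A u * s ?a u = s ?b u * s (insert \<beta> ?a) u"
        using rel_sign_corner[OF A adj_y adj True] unfolding comm s_def by blast
      ultimately have diff: "F ?b u y - F ?b u y' = 2 * (s A u * s ?a u) * F (insert \<beta> ?a) u y" by simp
      have sum_a: "F ?a u y + F ?a u' y = 2 * F (insert \<beta> ?a) u y"
        using ds_recursion_adjacent[OF F oa adj_a reg_ya] .
      have "s ?a u' = - s ?a u" using Pa.rel_sign_adjacent[OF adj_a] by (simp add: s_def)
      then have ss: "s A u' * s ?a u' = s A u * s ?a u" using sA by simp
      have "?f u + ?f u' = (F A u y + F A u' y) - (F A u y' + F A u' y')
          - 2 * (s A u * s ?a u) * (F ?a u y + F ?a u' y)"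
        unfolding ss by (simp add: algebra_simps)
      also have "\<dots> = 2 * (F ?b u y - F ?b u y') - 4 * (s A u * s ?a u) * F (insert \<beta> ?a) u y"
        unfolding sum sum_a by simp
      also have "\<dots> = 0" unfolding diff by simp
      finally show ?thesis .
    qed
  qed
  then show ?case by simp
qed

text \<open>
  The right-hand side satisfies the recursion: the support condition is symmetric in \<open>x\<close> and \<open>y\<close>, and
  the wall-crossing formula is the preceding theorem, as the change of sign at the wall turns the sum into a
  difference.
\<close>

theorem ds_recursion_swap:
  assumes F: "ds_recursion F" and "orth A" "reg (perp A) x" "reg (perp A) y"
  shows "F A x y = (-1) ^ q_exponent A * rel_sign (perp A) x y * F A y x"
proof -
  let ?s = "\<lambda>A x y. (-1) ^ q_exponent A * rel_sign (perp A) x y"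
  have "ds_recursion (\<lambda>A x y. ?s A x y * F A y x)"
    unfolding ds_recursion_def
  proof (intro allI impI conjI)
    fix A x y assume A: "orth A" "perp A = {}"
    have "is_half (perp A) {}" unfolding A is_half_def by simp
    then have "rel_sign (perp A) x y = 1" by (simp add: rel_sign_half)
    moreover have "q_exponent A = 0" using card_orth_complete[OF A] by (simp add: q_exponent_def A)
    ultimately show "?s A x y * F A y x = 1" using ds_recursion_empty[OF F A] by simp
  next
    fix A x y assume a: "orth A" "reg (perp A) x" "reg (perp A) y" "ip x (proj A y) > 0"
    then have "ip y (proj A x) > 0" by (metis proj_adjoint ip_sym)
    then show "?s A x y * F A y x = 0"
      using ds_recursion_support[OF F a(1,3,2)] by simp
  next
    fix A \<beta> x x' y and t :: real
    assume A: "orth A" and adj: "adjacent (perp A) \<beta> x x'" and y: "reg (perp A) y"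
      and t: "0 \<le> t" "t \<le> 1" "ip ((1 - t) *\<^sub>R x + t *\<^sub>R x') \<beta> = 0"
    interpret P: reflection_system ip "perp A" by (rule perp_system)
    let ?b = "insert \<beta> A" and ?z = "(1 - t) *\<^sub>R x + t *\<^sub>R x'"
    interpret Pb: reflection_system ip "perp ?b" by (rule perp_system)
    have \<beta>: "\<beta> \<in> perp A" "\<beta> \<in> H" using adj perp_subset by (auto simp: adjacent_def)
    have ob: "orth ?b" using orth_insert A \<beta> by blast
    have same: "same_chamber (perp ?b) x ?z"
      using wall_point_same_chamber[OF adj t(1,2) norm_nz[OF \<beta>(2)]] by (simp add: perp_insert)
    have yb: "reg (perp ?b) y" using reg_mono[OF y perp_insert_subset] .
    have "F A y x - F A y x' = 2 * (?s A y x * ?s ?b y x) * F ?b y x"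
      using ds_recursion_wall_formula[OF F A adj y] .
    moreover have "F ?b y x = F ?b y ?z" using ds_recursion_same_y[OF F ob same yb] .
    moreover have "rel_sign (perp ?b) x y = rel_sign (perp ?b) ?z y" using Pb.rel_sign_same_chamber[OF same] .
    moreover have "rel_sign (perp A) x' y = - rel_sign (perp A) x y" using P.rel_sign_adjacent[OF adj] .
    moreover have "?s A x y * ?s A x y = 1"
    proof -
      have "?s A x y * ?s A x y = ((-1) ^ q_exponent A * (-1) ^ q_exponent A) * (rel_sign (perp A) x y * rel_sign (perp A) x y)"
        by (simp only: mult_ac)
      then show ?thesis using P.rel_sign_square[OF adjacent_reg(1)[OF adj] y] by (simp flip: power_mult_distrib)
    qed
    ultimately have d: "F A y x - F A y x' = 2 * (?s A x y * ?s ?b ?z y) * F ?b y ?z" and pp: "?s A x y * ?s A x y = 1"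
      by (simp_all only: rel_sign_commute[of "perp A" y x] rel_sign_commute[of "perp ?b" y x])
    have "?s A x y * (F A y x - F A y x') = (?s A x y * ?s A x y) * (2 * (?s ?b ?z y * F ?b y ?z))"
      unfolding d by (simp only: mult_ac)
    then have "?s A x y * (F A y x - F A y x') = 2 * (?s ?b ?z y * F ?b y ?z)"
      unfolding pp by simp
    then show "?s A x y * F A y x + ?s A x' y * F A y x' = 2 * (?s ?b ?z y * F ?b y ?z)"
      using \<open>rel_sign (perp A) x' y = - rel_sign (perp A) x y\<close> by (simp add: algebra_simps)
  qed
  from ds_recursion_unique[OF F this assms(2-4)] show ?thesis .
qed

text \<open>
  The function transported by the reflection satisfies the same recursion.
\<close>

theorem ds_recursion_invariant:
  assumes F: "ds_recursion F" and "h \<in> H" "reg H x" "reg H y"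
  shows "F {} (refl h x) (refl h y) = F {} x y"
proof -
  note n = norm_nz[OF assms(2)]
  let ?s = "refl h"
  note ss = refl_refl[OF n] and iso = refl_isometry[OF n] and adjoint = refl_adjoint[OF n]
  have inj: "inj ?s" by (rule inj_on_inverseI[of _ ?s]) (rule ss)
  have perp: "perp (?s ` A) = ?s ` perp A" for A
  proof -
    have "k \<in> ?s ` perp A" if "k \<in> perp (?s ` A)" for k
    proof -
      have "?s k \<in> perp A" using that refl_closed[OF assms(2)] adjoint by (auto simp: perp_def)
      then show ?thesis using ss by (metis imageI)
    qed
    moreover have "?s k \<in> perp (?s ` A)" if "k \<in> perp A" for k
      using that refl_closed[OF assms(2)] iso by (auto simp: perp_def)
    ultimately show ?thesis by blast
  qed
  have orth: "orth (?s ` A)" if "orth A" for A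
    using that iso refl_closed[OF assms(2)] by (auto simp: orth_def)
  have reg: "reg (?s ` Q) (?s x) = reg Q x" for Q x by (simp add: reg_def iso)
  have adj: "adjacent (?s ` Q) (?s \<beta>) (?s x) (?s x')" if "adjacent Q \<beta> x x'" for Q \<beta> x x'
    using that by (auto simp: adjacent_def iso simp flip: refl_minus)
  have proj: "proj (?s ` A) (?s y) = ?s (proj A y)" for A y
    using inj_on_subset[OF inj subset_UNIV, of A]
    by (simp add: proj_def linear_diff[OF refl_linear] linear_sum[OF refl_linear] linear_cmul[OF refl_linear]
      sum.reindex iso)
  have "ds_recursion (\<lambda>A x y. F (?s ` A) (?s x) (?s y))"
    unfolding ds_recursion_def
  proof (intro allI impI conjI)
    fix A x y assume "orth A" "perp A = {}"
    then show "F (?s ` A) (?s x) (?s y) = 1" using ds_recursion_empty[OF F orth] perp by simp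
  next
    fix A x y assume "orth A" "reg (perp A) x" "reg (perp A) y" "ip x (proj A y) > 0"
    then show "F (?s ` A) (?s x) (?s y) = 0"
      using ds_recursion_support[OF F orth] perp reg proj iso by simp
  next
    fix A \<beta> x x' y and t :: real
    assume A: "orth A" and a: "adjacent (perp A) \<beta> x x'" and y: "reg (perp A) y"
      and t: "0 \<le> t" "t \<le> 1" "ip ((1 - t) *\<^sub>R x + t *\<^sub>R x') \<beta> = 0"
    have z: "?s ((1 - t) *\<^sub>R x + t *\<^sub>R x') = (1 - t) *\<^sub>R ?s x + t *\<^sub>R ?s x'"
      by (simp add: linear_add[OF refl_linear] linear_cmul[OF refl_linear])
    have "adjacent (perp (?s ` A)) (?s \<beta>) (?s x) (?s x')" "reg (perp (?s ` A)) (?s y)"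
      using adj[OF a] y reg perp by simp_all
    moreover have "ip ((1 - t) *\<^sub>R ?s x + t *\<^sub>R ?s x') (?s \<beta>) = 0" using t(3) iso z by metis
    ultimately have "F (?s ` A) (?s x) (?s y) + F (?s ` A) (?s x') (?s y)
        = 2 * F (insert (?s \<beta>) (?s ` A)) ((1 - t) *\<^sub>R ?s x + t *\<^sub>R ?s x') (?s y)"
      using F orth[OF A] t(1,2) unfolding ds_recursion_def by blast
    then show "F (?s ` A) (?s x) (?s y) + F (?s ` A) (?s x') (?s y)
        = 2 * F (?s ` insert \<beta> A) (?s ((1 - t) *\<^sub>R x + t *\<^sub>R x')) (?s y)"
      unfolding z by simp
  qed
  from ds_recursion_unique[OF this F orth_empty] assms(3,4) show ?thesis by simp
qed

end

section \<open>Root systems as reflection systems\<close>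

lemma dual_spaceD:
  assumes "f \<in> dual_space X" "subspace X" "x \<in> X"
  shows "y \<in> X \<Longrightarrow> f (x + y) = f x + f y" "f (a *\<^sub>R x) = a * f x"
    "y \<in> X \<Longrightarrow> f (x - y) = f x - f y" "f (- x) = - f x"
proof -
  have add: "f (u + v) = f u + f v" if "u \<in> X" "v \<in> X" for u v using assms(1) that by (simp add: dual_space_def)
  have scale: "f (a *\<^sub>R u) = a * f u" if "u \<in> X" for a u using assms(1) that by (simp add: dual_space_def)
  have neg: "f (- u) = - f u" "- u \<in> X" if "u \<in> X" for u
    using scale[OF that, of "-1"] subspace_neg[OF assms(2) that] by simp_all
  show "y \<in> X \<Longrightarrow> f (x + y) = f x + f y" "f (a *\<^sub>R x) = a * f x" "f (- x) = - f x"
    using add scale neg assms(3) by auto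
  show "y \<in> X \<Longrightarrow> f (x - y) = f x - f y" using add[OF assms(3) neg(2)] neg(1) by simp
qed

lemma dual_space_outside: "f \<in> dual_space X \<Longrightarrow> x \<notin> X \<Longrightarrow> f x = 0"
  by (simp add: dual_space_def)

lemma dual_space_zero: "f \<in> dual_space X \<Longrightarrow> subspace X \<Longrightarrow> f 0 = 0"
  using dual_spaceD(2)[of f X 0 0] subspace_0 by auto

lemma subspace_dual_space: "subspace (dual_space X)"
  unfolding subspace_def by (auto simp: dual_space_def algebra_simps)

lemma restrict_linear_in_dual: "linear f \<Longrightarrow> subspace X \<Longrightarrow> restrict_functional X f \<in> dual_space X"
  by (auto simp: restrict_functional_def dual_space_def linear_add linear_cmul subspace_add subspace_scale)

lemma restrict_in_dual:
  "f \<in> dual_space X \<Longrightarrow> subspace X \<Longrightarrow> subspace Y \<Longrightarrow> Y \<subseteq> X \<Longrightarrow> restrict_functional Y f \<in> dual_space Y"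
  by (auto simp: restrict_functional_def dual_space_def subspace_add subspace_scale subset_eq)

lemma restrict_self: "f \<in> dual_space X \<Longrightarrow> restrict_functional X f = f"
  by (auto simp: restrict_functional_def dual_space_def fun_eq_iff)

lemma dual_separates:
  assumes "subspace X" "x \<in> X" "x \<noteq> 0" shows "\<exists>f\<in>dual_space X. f x \<noteq> 0"
proof -
  have "independent {x}" using assms(3) by simp
  then obtain g :: "'a \<Rightarrow> real" where g: "linear g" "g x = 1"
    using linear_independent_extend[of "{x}" "\<lambda>_. 1"] by auto
  then show ?thesis
    using restrict_linear_in_dual[OF g(1) assms(1)] assms(2)
    by (intro bexI[of _ "restrict_functional X g"]) (auto simp: restrict_functional_def)
qed

lemma image_eq_of_involution:
  assumes "f ` S \<subseteq> S" "\<And>s. s \<in> S \<Longrightarrow> f (f s) = s" shows "f ` S = S"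
  using assms by force

locale root_datum =
  fixes X :: "'a::real_vector set" and R :: "('a \<Rightarrow> real) set"
  assumes root_system: "root_system X R"
begin

abbreviation cr :: "('a \<Rightarrow> real) \<Rightarrow> 'a" where "cr \<equiv> coroot X R"

lemma finite_dim: "finite_dim_subspace X"
  and finite_R: "finite R"
  and R_dual: "R \<subseteq> dual_space X"
  and span_R: "span R = dual_space X"
  using root_system by (auto simp: root_system_def)

lemma subspace_X: "subspace X"
  using finite_dim by (auto simp: finite_dim_subspace_def)

lemma R_reduced: "\<alpha> \<in> R \<Longrightarrow> t *\<^sub>R \<alpha> \<in> R \<Longrightarrow> t = 1 \<or> t = -1"
  using root_system unfolding root_system_def by blast

lemma root_linear:
  assumes "\<alpha> \<in> R" "x \<in> X"
  shows "y \<in> X \<Longrightarrow> \<alpha> (x + y) = \<alpha> x + \<alpha> y" "\<alpha> (a *\<^sub>R x) = a * \<alpha> x"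
    "y \<in> X \<Longrightarrow> \<alpha> (x - y) = \<alpha> x - \<alpha> y" "\<alpha> (- x) = - \<alpha> x"
  using dual_spaceD[OF _ subspace_X assms(2)] R_dual assms(1) by blast+

lemma roots_separate:
  assumes "x \<in> X" "\<And>\<gamma>. \<gamma> \<in> R \<Longrightarrow> \<gamma> x = 0" shows "x = 0"
proof (rule ccontr)
  assume "x \<noteq> 0"
  then obtain f where f: "f \<in> span R" "f x \<noteq> 0" using dual_separates subspace_X assms(1) span_R by blast
  have "f x = 0" using f(1)
    by (induction rule: span_induct_alt) (auto simp: assms(2))
  then show False using f by simp
qed

text \<open>
  Two coroots \<open>h\<close> and \<open>h'\<close> of \<open>\<alpha>\<close> define reflections whose product is the unipotent map
  \<open>\<beta> \<mapsto> \<beta> + (\<beta> h' - \<beta> h) \<alpha>\<close>. It preserves the finite set \<open>R\<close>, so it fixes every root.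
\<close>

lemma coroot_unique:
  assumes \<alpha>: "\<alpha> \<in> R" and h: "is_coroot X R \<alpha> h" "is_coroot X R \<alpha> h'"
  shows "h = h'"
proof -
  have hX: "h \<in> X" "h' \<in> X" "\<alpha> h = 2" "\<alpha> h' = 2" using h by (auto simp: is_coroot_def)
  have refl: "\<beta> - \<beta> h *\<^sub>R \<alpha> \<in> R" "\<beta> - \<beta> h' *\<^sub>R \<alpha> \<in> R" if "\<beta> \<in> R" for \<beta>
    using h that unfolding is_coroot_def by blast+
  have "\<beta> h = \<beta> h'" if \<beta>: "\<beta> \<in> R" for \<beta>
  proof (rule ccontr)
    assume ne: "\<beta> h \<noteq> \<beta> h'"
    define d where "d = \<beta> h' - \<beta> h"
    have mem: "\<beta> + (real n * d) *\<^sub>R \<alpha> \<in> R" for n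
    proof (induction n)
      case (Suc n)
      let ?\<beta> = "\<beta> + (real n * d) *\<^sub>R \<alpha>"
      let ?\<gamma> = "?\<beta> - ?\<beta> h' *\<^sub>R \<alpha>"
      have "?\<gamma> - ?\<gamma> h *\<^sub>R \<alpha> = \<beta> + (real (Suc n) * d) *\<^sub>R \<alpha>"
        by (rule ext) (simp add: hX d_def algebra_simps)
      then show ?case using refl Suc by metis
    qed (use \<beta> in simp)
    have "inj (\<lambda>n. \<beta> + (real n * d) *\<^sub>R \<alpha>)"
    proof (rule injI)
      fix m n assume "\<beta> + (real m * d) *\<^sub>R \<alpha> = \<beta> + (real n * d) *\<^sub>R \<alpha>"
      then have "(\<beta> + (real m * d) *\<^sub>R \<alpha>) h = (\<beta> + (real n * d) *\<^sub>R \<alpha>) h" by metis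
      then show "m = n" using hX ne by (simp add: d_def)
    qed
    moreover have "finite (range (\<lambda>n. \<beta> + (real n * d) *\<^sub>R \<alpha>))"
      by (rule finite_subset[OF _ finite_R]) (use mem in blast)
    ultimately show False using finite_imageD infinite_UNIV_nat by blast
  qed
  then have "\<gamma> (h - h') = 0" if "\<gamma> \<in> R" for \<gamma> using that hX by (simp add: root_linear)
  then have "h - h' = 0" using roots_separate hX subspace_X subspace_diff by blast
  then show ?thesis by simp
qed

lemma coroot_is: assumes "\<alpha> \<in> R" shows "is_coroot X R \<alpha> (cr \<alpha>)"
proof -
  obtain h where h: "is_coroot X R \<alpha> h" using root_system assms unfolding root_system_def by blast
  show ?thesis unfolding coroot_def by (rule theI[where P = "is_coroot X R \<alpha>", OF h], rule coroot_unique[OF assms _ h])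
qed

lemma coroot_eqI: "\<alpha> \<in> R \<Longrightarrow> is_coroot X R \<alpha> h \<Longrightarrow> cr \<alpha> = h"
  using coroot_unique coroot_is by blast

lemma cr_X: "\<alpha> \<in> R \<Longrightarrow> cr \<alpha> \<in> X"
  and cr_2: "\<alpha> \<in> R \<Longrightarrow> \<alpha> (cr \<alpha>) = 2"
  and root_refl_image: "\<alpha> \<in> R \<Longrightarrow> (\<lambda>\<beta>. \<beta> - \<beta> (cr \<alpha>) *\<^sub>R \<alpha>) ` R = R"
  using coroot_is by (auto simp: is_coroot_def)

lemma root_refl: "\<alpha> \<in> R \<Longrightarrow> \<beta> \<in> R \<Longrightarrow> \<beta> - \<beta> (cr \<alpha>) *\<^sub>R \<alpha> \<in> R"
  using root_refl_image by blast

lemma cartan_integer: assumes "\<alpha> \<in> R" "\<beta> \<in> R" shows "\<beta> (cr \<alpha>) \<in> \<int>"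
proof -
  obtain h where "is_coroot X R \<alpha> h" "\<forall>\<beta>\<in>R. \<beta> h \<in> \<int>" using root_system assms unfolding root_system_def by blast
  then show ?thesis using coroot_eqI[OF assms(1)] assms(2) by blast
qed

text \<open>
  The reflection in the root \<open>s\<^sub>\<alpha> \<beta>\<close> is \<open>s\<^sub>\<alpha> s\<^sub>\<beta> s\<^sub>\<alpha>\<close>, so it preserves \<open>R\<close>.
\<close>

lemma cr_refl:
  assumes "\<alpha> \<in> R" "\<beta> \<in> R"
  shows "cr (\<beta> - \<beta> (cr \<alpha>) *\<^sub>R \<alpha>) = cr \<beta> - \<alpha> (cr \<beta>) *\<^sub>R cr \<alpha>"
proof (rule coroot_eqI)
  let ?s = "\<lambda>\<gamma>. \<gamma> - \<gamma> (cr \<alpha>) *\<^sub>R \<alpha>" and ?t = "\<lambda>\<gamma>. \<gamma> - \<gamma> (cr \<beta>) *\<^sub>R \<beta>"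
  let ?h = "cr \<beta> - \<alpha> (cr \<beta>) *\<^sub>R cr \<alpha>"
  show "?s \<beta> \<in> R" using root_refl assms .
  have hX: "?h \<in> X" using cr_X assms subspace_X subspace_diff subspace_scale by metis
  have ev: "\<gamma> ?h = \<gamma> (cr \<beta>) - \<alpha> (cr \<beta>) * \<gamma> (cr \<alpha>)" if "\<gamma> \<in> R" for \<gamma>
    using root_linear(3)[OF that cr_X[OF assms(2)] subspace_scale[OF subspace_X cr_X[OF assms(1)]]]
      root_linear(2)[OF that cr_X[OF assms(1)]] by simp
  have "(\<lambda>\<gamma>. \<gamma> - \<gamma> ?h *\<^sub>R ?s \<beta>) ` R = (\<lambda>\<gamma>. ?s (?t (?s \<gamma>))) ` R"
  proof (rule image_cong)
    fix \<gamma> assume \<gamma>: "\<gamma> \<in> R"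
    show "\<gamma> - \<gamma> ?h *\<^sub>R ?s \<beta> = ?s (?t (?s \<gamma>))"
      unfolding ev[OF \<gamma>] by (rule ext) (simp add: cr_2 assms algebra_simps)
  qed simp
  also have "\<dots> = ?s ` (?t ` (?s ` R))" by (simp only: image_image)
  also have "\<dots> = R" using root_refl_image assms by simp
  finally show "is_coroot X R (?s \<beta>) ?h"
    using hX ev[OF assms(1)] ev[OF assms(2)] by (simp add: is_coroot_def cr_2 assms)
qed

lemma neg_root: "\<alpha> \<in> R \<Longrightarrow> - \<alpha> \<in> R"
  using root_refl[of \<alpha> \<alpha>] cr_2[of \<alpha>] scaleR_2[of \<alpha>] by simp

lemma cr_neg: assumes "\<alpha> \<in> R" shows "cr (- \<alpha>) = - cr \<alpha>"
proof (rule coroot_eqI[OF neg_root[OF assms]])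
  have "(\<lambda>\<beta>. \<beta> - \<beta> (- cr \<alpha>) *\<^sub>R (- \<alpha>)) ` R = (\<lambda>\<beta>. \<beta> - \<beta> (cr \<alpha>) *\<^sub>R \<alpha>) ` R"
    using cr_X[OF assms] by (intro image_cong) (auto simp: root_linear)
  then show "is_coroot X R (- \<alpha>) (- cr \<alpha>)"
    using subspace_neg[OF subspace_X cr_X[OF assms]] root_linear(4)[OF assms cr_X[OF assms]]
      cr_2[OF assms] root_refl_image[OF assms] by (simp add: is_coroot_def)
qed

text \<open>
  A linear projection of the whole type onto \<open>X\<close>. It serves to define the invariant form on the whole type.
\<close>

definition pr :: "'a \<Rightarrow> 'a"
  where "pr = (SOME p. linear p \<and> (\<forall>x. p x \<in> X) \<and> (\<forall>x\<in>X. p x = x))"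

lemma pr: "linear pr" "pr x \<in> X" "x \<in> X \<Longrightarrow> pr x = x"
proof -
  have "\<exists>p. linear p \<and> (\<forall>x. p x \<in> X) \<and> (\<forall>x\<in>X. p x = x)"
    using linear_exists_left_inverse_on[OF linear_ident subspace_X] by auto
  from someI_ex[OF this] show "linear pr" "pr x \<in> X" "x \<in> X \<Longrightarrow> pr x = x"
    unfolding pr_def by blast+
qed

definition form :: "'a \<Rightarrow> 'a \<Rightarrow> real"
  where "form x y = (\<Sum>\<gamma>\<in>R. \<gamma> (pr x) * \<gamma> (pr y))"

sublocale symmetric_form form
proof
  show "form x y = form y x" for x y by (simp add: form_def mult.commute)
  show "form (x + y) z = form x z + form y z" for x y z
    by (simp add: form_def linear_add[OF pr(1)] root_linear pr(2) distrib_right sum.distrib)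
  show "form (a *\<^sub>R x) z = a * form x z" for a x z
    by (simp add: form_def linear_cmul[OF pr(1)] root_linear pr(2) sum_distrib_left mult.assoc)
qed

lemma form_pr [simp]: "form (pr x) y = form x y" "form x (pr y) = form x y"
  by (simp_all add: form_def pr)

lemma form_pos: assumes "x \<in> X" "x \<noteq> 0" shows "form x x > 0"
proof -
  obtain \<gamma> where \<gamma>: "\<gamma> \<in> R" "\<gamma> x \<noteq> 0" using roots_separate assms by blast
  have "0 < \<gamma> (pr x) * \<gamma> (pr x)" using \<gamma> assms pr(3) by (metis not_real_square_gt_zero)
  then show ?thesis unfolding form_def using \<gamma> finite_R by (intro sum_pos2) auto
qed

lemma cr_nz: "\<alpha> \<in> R \<Longrightarrow> cr \<alpha> \<noteq> 0"
  using cr_2 root_linear(2)[of \<alpha> "cr \<alpha>" 0] cr_X by fastforce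

lemma form_cr_pos: "\<alpha> \<in> R \<Longrightarrow> form (cr \<alpha>) (cr \<alpha>) > 0"
  using form_pos cr_X cr_nz by blast

text \<open>
  Reindexing the sum over all roots by the reflection \<open>s\<^sub>\<alpha>\<close> changes the sign of \<open>\<gamma> (cr \<alpha>)\<close>. Adding
  the two expressions leaves a multiple of \<open>\<alpha>\<close>.
\<close>

lemma form_cr: assumes "\<alpha> \<in> R" shows "form (cr \<alpha>) x = form (cr \<alpha>) (cr \<alpha>) / 2 * \<alpha> (pr x)"
proof -
  let ?s = "\<lambda>\<gamma>. \<gamma> - \<gamma> (cr \<alpha>) *\<^sub>R \<alpha>"
  have ss: "?s (?s \<gamma>) = \<gamma>" for \<gamma> by (rule ext) (simp add: cr_2[OF assms])
  have "form (cr \<alpha>) x = (\<Sum>\<gamma>\<in>R. \<gamma> (cr \<alpha>) * \<gamma> (pr x))" by (simp add: form_def pr cr_X assms)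
  also have "\<dots> = (\<Sum>\<gamma>\<in>R. ?s \<gamma> (cr \<alpha>) * ?s \<gamma> (pr x))"
    using root_refl[OF assms] by (intro sum.reindex_bij_witness[of _ ?s ?s]) (simp_all only: ss)
  also have "\<dots> = (\<Sum>\<gamma>\<in>R. \<gamma> (cr \<alpha>) * \<gamma> (cr \<alpha>) * \<alpha> (pr x) - \<gamma> (cr \<alpha>) * \<gamma> (pr x))"
    by (intro sum.cong) (simp_all add: cr_2[OF assms] algebra_simps)
  also have "\<dots> = form (cr \<alpha>) (cr \<alpha>) * \<alpha> (pr x) - form (cr \<alpha>) x"
    by (simp add: sum_subtractf form_def pr cr_X assms sum_distrib_right)
  finally show ?thesis by simp
qed

lemma root_form: "\<alpha> \<in> R \<Longrightarrow> \<alpha> (pr x) = 2 / form (cr \<alpha>) (cr \<alpha>) * form (cr \<alpha>) x"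
  using form_cr[of \<alpha> x] form_cr_pos[of \<alpha>] by (simp add: field_simps)

lemma refl_cr: "\<alpha> \<in> R \<Longrightarrow> refl (cr \<alpha>) x = x - \<alpha> (pr x) *\<^sub>R cr \<alpha>"
  by (simp add: refl_def root_form ip_sym[of x])

lemma root_eqI:
  assumes "\<alpha> \<in> R" "\<beta> \<in> R" "cr \<beta> = t *\<^sub>R cr \<alpha>" shows "\<beta> = (1 / t) *\<^sub>R \<alpha>"
proof
  have t: "t \<noteq> 0" using assms cr_nz by auto
  fix x show "\<beta> x = ((1 / t) *\<^sub>R \<alpha>) x"
  proof (cases "x \<in> X")
    case True
    then have "\<beta> x = 2 / form (cr \<beta>) (cr \<beta>) * form (cr \<beta>) x" "\<alpha> x = 2 / form (cr \<alpha>) (cr \<alpha>) * form (cr \<alpha>) x"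
      using root_form[of _ x] assms pr(3) by metis+
    then show ?thesis using t unfolding assms(3) by (simp add: ip_scale ip_scale_right)
  next
    case False
    then have "\<beta> x = 0" "\<alpha> x = 0" using assms(1,2) R_dual dual_space_outside by blast+
    then show ?thesis by simp
  qed
qed

lemma inj_cr: "inj_on cr R"
  using root_eqI[of _ _ 1] by (intro inj_onI) simp

lemma span_coroots_subset: "span (coroots X R) \<subseteq> X"
  using cr_X by (intro span_minimal subspace_X) (auto simp: coroots_def)

sublocale reflection_system form "coroots X R"
proof
  show "finite (coroots X R)" using finite_R by (simp add: coroots_def)
  show "0 \<notin> coroots X R" using cr_nz by (auto simp: coroots_def)
  show "form x x > 0" if "x \<in> span (coroots X R)" "x \<noteq> 0" for x
    using form_pos that span_coroots_subset by blast
  show "refl h k \<in> coroots X R" if "h \<in> coroots X R" "k \<in> coroots X R" for h k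
  proof -
    obtain \<alpha> \<beta> where "\<alpha> \<in> R" "\<beta> \<in> R" "h = cr \<alpha>" "k = cr \<beta>" using \<open>h \<in> _\<close> \<open>k \<in> _\<close> by (auto simp: coroots_def)
    then have "refl h k = cr (\<beta> - \<beta> (cr \<alpha>) *\<^sub>R \<alpha>)" "\<beta> - \<beta> (cr \<alpha>) *\<^sub>R \<alpha> \<in> R"
      using cr_refl refl_cr pr(3) cr_X root_refl by simp_all
    then show ?thesis by (auto simp: coroots_def)
  qed
  show "t = 1 \<or> t = -1" if "h \<in> coroots X R" "t *\<^sub>R h \<in> coroots X R" for h t
  proof -
    obtain \<alpha> \<beta> where ab: "\<alpha> \<in> R" "\<beta> \<in> R" "h = cr \<alpha>" "t *\<^sub>R h = cr \<beta>" using \<open>h \<in> _\<close> \<open>t *\<^sub>R h \<in> _\<close> by (auto simp: coroots_def)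
    then have "\<beta> = (1 / t) *\<^sub>R \<alpha>" using root_eqI by metis
    then have "1 / t = 1 \<or> 1 / t = -1" using R_reduced[OF ab(1)] ab(2) by metis
    then show ?thesis by (auto simp: divide_eq_eq split: if_splits)
  qed
qed

lemma reflection_eq: "\<alpha> \<in> R \<Longrightarrow> x \<in> X \<Longrightarrow> reflection X R \<alpha> x = refl (cr \<alpha>) x"
  by (simp add: reflection_def refl_cr pr(3))

lemma refl_X: "\<alpha> \<in> R \<Longrightarrow> x \<in> X \<Longrightarrow> refl (cr \<alpha>) x \<in> X"
  using refl_cr cr_X subspace_X subspace_diff subspace_scale by metis

lemma group_X: assumes "w \<in> group_of (coroots X R)" "x \<in> X" shows "w x \<in> X"
  using assms by induction (auto simp: coroots_def refl_X)

lemma weyl_to_group: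
  assumes "w \<in> weyl_group X R"
  shows "\<exists>w'\<in>group_of (coroots X R). \<forall>x\<in>X. w x = w' x"
  using assms
proof induction
  case id then show ?case using group_of.group_id by blast
next
  case (reflection \<alpha> w)
  then obtain w' where w': "w' \<in> group_of (coroots X R)" "\<forall>x\<in>X. w x = w' x" by blast
  have "(reflection X R \<alpha> \<circ> w) x = (refl (cr \<alpha>) \<circ> w') x" if "x \<in> X" for x
    using that w' reflection.hyps(1) reflection_eq group_X by simp
  moreover have "refl (cr \<alpha>) \<circ> w' \<in> group_of (coroots X R)"
    using w'(1) reflection.hyps(1) by (intro group_of.group_refl) (auto simp: coroots_def)
  ultimately show ?case by blast
qed

lemma group_moves_in_span:
  assumes "w \<in> group_of Q" shows "x - w x \<in> span Q"
  using assms
proof induction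
  case group_id then show ?case by (simp add: span_zero)
next
  case (group_refl h w)
  have "x - (refl h \<circ> w) x = (x - w x) + (2 * form (w x) h / form h h) *\<^sub>R h" by (simp add: refl_def)
  then show ?case using group_refl span_add span_scale span_base by metis
qed

text \<open>
  The root with coroot \<open>h\<close>.
\<close>

definition rt :: "'a \<Rightarrow> 'a \<Rightarrow> real"
  where "rt h = inv_into R cr h"

lemma rt: "h \<in> coroots X R \<Longrightarrow> rt h \<in> R" "h \<in> coroots X R \<Longrightarrow> cr (rt h) = h"
  unfolding rt_def coroots_def by (auto intro: inv_into_into f_inv_into_f[of _ cr R])

lemma rt_cr: "\<alpha> \<in> R \<Longrightarrow> rt (cr \<alpha>) = \<alpha>"
  unfolding rt_def using inj_cr by simp

lemma rt_dual: "h \<in> coroots X R \<Longrightarrow> rt h \<in> dual_space X"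
  using rt(1) R_dual by blast

lemma coroot_X: "h \<in> coroots X R \<Longrightarrow> h \<in> X"
  using span_coroots_subset span_base by blast

lemma rt_neg: assumes "h \<in> coroots X R" shows "rt (- h) = - rt h"
  using rt_cr[OF neg_root[OF rt(1)[OF assms]]] cr_neg[OF rt(1)[OF assms]] rt(2)[OF assms] by simp

lemma rt_form: "h \<in> coroots X R \<Longrightarrow> x \<in> X \<Longrightarrow> rt h x = 2 / form h h * form h x"
  using root_form[OF rt(1), of h x] rt(2)[of h] pr(3)[of x] by simp

text \<open>
  The identification of \<open>X\<close> with \<open>X\<^sup>*\<close> through the invariant form.
\<close>

definition \<iota> :: "'a \<Rightarrow> 'a \<Rightarrow> real"
  where "\<iota> y = restrict_functional X (form y)"

lemma \<iota>_dual: "\<iota> y \<in> dual_space X"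
  unfolding \<iota>_def by (rule restrict_linear_in_dual[OF _ subspace_X]) (rule linearI, auto simp: ip_linear)

lemma \<iota>_apply: "x \<in> X \<Longrightarrow> \<iota> y x = form y x"
  by (simp add: \<iota>_def restrict_functional_def)

lemma \<iota>_linear: "\<iota> (x + y) = \<iota> x + \<iota> y" "\<iota> (a *\<^sub>R x) = a *\<^sub>R \<iota> x"
  by (auto simp: \<iota>_def restrict_functional_def fun_eq_iff ip_linear)

lemma \<iota>_coroot: assumes "h \<in> coroots X R" shows "\<iota> h = (form h h / 2) *\<^sub>R rt h"
proof
  fix x show "\<iota> h x = ((form h h / 2) *\<^sub>R rt h) x"
  proof (cases "x \<in> X")
    case True then show ?thesis using rt_form[OF assms True] norm_nz[OF assms] by (simp add: \<iota>_apply)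
  next
    case False
    then show ?thesis using rt(1)[OF assms] R_dual dual_space_outside by (fastforce simp: \<iota>_def restrict_functional_def)
  qed
qed

lemma \<iota>_surj: assumes "f \<in> dual_space X" shows "\<exists>y\<in>X. \<iota> y = f"
proof -
  have "f \<in> span R" using assms span_R by simp
  then show ?thesis
  proof (induction rule: span_induct_alt)
    case base
    have "\<iota> 0 = 0" using \<iota>_linear(2)[of 0 0] by simp
    then show ?case using subspace_0[OF subspace_X] by blast
  next
    case (step c \<gamma> g)
    then obtain y where y: "y \<in> X" "\<iota> y = g" by blast
    let ?h = "cr \<gamma>"
    have h: "?h \<in> coroots X R" using step by (simp add: coroots_def)
    let ?z = "(c * 2 / form ?h ?h) *\<^sub>R ?h + y"
    have "\<iota> ?z = c *\<^sub>R \<gamma> + g"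
      unfolding \<iota>_linear \<iota>_coroot[OF h] rt_cr[OF step(1)] y(2) using norm_nz[OF h] by simp
    moreover have "?z \<in> X" using y cr_X step subspace_X by (simp add: subspace_add subspace_scale)
    ultimately show ?case by blast
  qed
qed

end

locale root_datum_minus = root_datum +
  assumes minus_one_in_weyl: "minus_one_in_weyl X R"
begin

lemma minus_one_group: "\<exists>w\<in>group_of (coroots X R). \<forall>x\<in>X. w x = - x"
  using minus_one_in_weyl weyl_to_group unfolding minus_one_in_weyl_def by metis

text \<open>
  A product of reflections moves every vector by a combination of coroots, and \<open>-1\<close> moves \<open>x\<close> by
  \<open>2 x\<close>.
\<close>

lemma span_coroots: "span (coroots X R) = X"
proof
  show "X \<subseteq> span (coroots X R)"
  proof
    fix x assume x: "x \<in> X"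
    obtain w where w: "w \<in> group_of (coroots X R)" "w x = - x" using minus_one_group x by blast
    have "x - w x = 2 *\<^sub>R x" using w(2) by (simp add: scaleR_2)
    then have "(1/2) *\<^sub>R (2 *\<^sub>R x) \<in> span (coroots X R)"
      using group_moves_in_span[OF w(1), of x] span_scale by metis
    then show "x \<in> span (coroots X R)" by simp
  qed
qed (rule span_coroots_subset)

sublocale minus_one_system form "coroots X R"
  by unfold_locales (use minus_one_group span_coroots in simp)

section \<open>Restriction to the orthogonal complement of a set of coroots\<close>

text \<open>
  Iterated versions of \<open>Y\<close> and \<open>R\<^sub>Y\<close>, for a set \<open>A\<close> of coroots.
\<close>

definition subX :: "'a set \<Rightarrow> 'a set"
  where "subX A = {x\<in>X. \<forall>a\<in>A. form x a = 0}"

definition subR :: "'a set \<Rightarrow> ('a \<Rightarrow> real) set"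
  where "subR A = restrict_functional (subX A) ` rt ` perp A"

lemma subX_X: "subX A \<subseteq> X"
  by (auto simp: subX_def)

lemma subspace_subX: "subspace (subX A)"
  using subspace_X unfolding subspace_def subX_def by (auto simp: ip_linear)

lemma perp_subX: "h \<in> perp A \<Longrightarrow> h \<in> subX A"
  using perp_subset[of A] span_coroots span_base by (auto simp: subX_def perp_def)

lemma orth_X: "orth A \<Longrightarrow> a \<in> A \<Longrightarrow> a \<in> X"
  using span_coroots span_base by (auto simp: orth_def)

lemma proj_X: assumes "orth A" "x \<in> X" shows "proj A x \<in> X"
  unfolding proj_def using assms orth_X subspace_X
  by (intro subspace_diff subspace_sum subspace_scale) auto

lemma proj_subX: "orth A \<Longrightarrow> x \<in> X \<Longrightarrow> proj A x \<in> subX A"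
  using proj_X proj_orthogonal by (simp add: subX_def)

lemma proj_id: "x \<in> subX A \<Longrightarrow> proj A x = x"
  by (simp add: proj_def subX_def)

lemma finite_dim_subX: "finite_dim_subspace (subX A)"
proof -
  obtain B where B: "B \<subseteq> subX A" "independent B" "subX A \<subseteq> span B" using basis_exists by metis
  obtain B' where B': "finite B'" "span B' = X" using finite_dim by (auto simp: finite_dim_subspace_def)
  then have "finite B" using independent_span_bound[OF B'(1) B(2)] B(1) subX_X by blast
  moreover have "span B = subX A"
    using B span_minimal[OF B(1) subspace_subX] by blast
  ultimately show ?thesis by (auto simp: finite_dim_subspace_def)
qed

lemma rt_restrict: "h \<in> perp A \<Longrightarrow> x \<in> subX A \<Longrightarrow> restrict_functional (subX A) (rt h) x = 2 / form h h * form h x"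
  using rt_form[of h x] perp_subset subX_X by (auto simp: restrict_functional_def)

lemma perp_in_H: "h \<in> perp A \<Longrightarrow> h \<in> coroots X R"
  using perp_subset by blast

lemma form_restrict_in_span:
  assumes "u \<in> span (perp A)" shows "restrict_functional (subX A) (form u) \<in> span (subR A)"
  using assms
proof (induction rule: span_induct_alt)
  case base
  have "restrict_functional (subX A) (form 0) = 0" by (auto simp: restrict_functional_def fun_eq_iff)
  then show ?case using span_zero by metis
next
  case (step c h u)
  have n: "form h h \<noteq> 0" using norm_nz perp_in_H step by blast
  have "restrict_functional (subX A) (form (c *\<^sub>R h + u)) =
      (c * form h h / 2) *\<^sub>R restrict_functional (subX A) (rt h) + restrict_functional (subX A) (form u)"
  proof
    fix x show "restrict_functional (subX A) (form (c *\<^sub>R h + u)) x =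
      ((c * form h h / 2) *\<^sub>R restrict_functional (subX A) (rt h) + restrict_functional (subX A) (form u)) x"
      using n rt_restrict[OF step(1), of x]
      by (cases "x \<in> subX A") (auto simp: ip_linear restrict_functional_def)
  qed
  moreover have "restrict_functional (subX A) (rt h) \<in> subR A" using step by (simp add: subR_def)
  ultimately show ?case using step span_add span_scale span_base by metis
qed

text \<open>
  A functional on \<open>subX A\<close> extends to \<open>X\<close> through the projection, hence is given by the inner product with
  some \<open>p \<in> subX A\<close>. Since \<open>-1\<close> on \<open>subX A\<close> is a product of reflections in \<open>perp A\<close>, this \<open>p\<close>
  is a combination of elements of \<open>perp A\<close>.
\<close>

lemma span_subR: assumes "orth A" shows "span (subR A) = dual_space (subX A)"
proof
  show "span (subR A) \<subseteq> dual_space (subX A)"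
    using restrict_in_dual[OF rt_dual subspace_X subspace_subX subX_X] perp_in_H
    by (intro span_minimal subspace_dual_space) (auto simp: subR_def)
  show "dual_space (subX A) \<subseteq> span (subR A)"
  proof
    fix f assume f: "f \<in> dual_space (subX A)"
    define g where "g = restrict_functional X (\<lambda>x. f (proj A x))"
    have proj_lin: "proj A (x + y) = proj A x + proj A y" "proj A (c *\<^sub>R x) = c *\<^sub>R proj A x" for x y c
      by (simp_all add: proj_def ip_linear add_divide_distrib scaleR_add_left sum.distrib
          scaleR_diff_right scaleR_sum_right)
    have "g \<in> dual_space X"
      using dual_spaceD(1,2)[OF f subspace_subX] proj_subX[OF assms] subspace_X
      by (auto simp: g_def restrict_functional_def dual_space_def proj_lin subspace_add subspace_scale)
    then obtain y where y: "y \<in> X" "\<iota> y = g" using \<iota>_surj by blast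
    let ?p = "proj A y"
    have p: "?p \<in> subX A" using proj_subX assms y by blast
    obtain w where w: "w \<in> group_of (perp A)" "w ?p = - ?p"
      using minus_one_perp[OF assms] p span_coroots by (auto simp: subX_def)
    have "?p - w ?p = 2 *\<^sub>R ?p" using w(2) by (simp add: scaleR_2)
    then have "(1/2) *\<^sub>R (2 *\<^sub>R ?p) \<in> span (perp A)"
      using group_moves_in_span[OF w(1), of ?p] span_scale by metis
    then have "restrict_functional (subX A) (form ?p) \<in> span (subR A)"
      by (intro form_restrict_in_span) simp
    moreover have "restrict_functional (subX A) (form ?p) = f"
    proof
      fix x show "restrict_functional (subX A) (form ?p) x = f x"
      proof (cases "x \<in> subX A")
        case True
        then have xX: "x \<in> X" using subX_X by blast
        have "form ?p x = form y (proj A x)" by (simp add: proj_adjoint)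
        also have "\<dots> = g x" using True y(2)[symmetric] \<iota>_apply[OF xX] by (simp add: proj_id)
        also have "\<dots> = f x" using xX True by (simp add: g_def restrict_functional_def proj_id)
        finally show ?thesis using True by (simp add: restrict_functional_def)
      next
        case False
        then show ?thesis using dual_space_outside[OF f] by (simp add: restrict_functional_def)
      qed
    qed
    ultimately show "f \<in> span (subR A)" by simp
  qed
qed

text \<open>
  The coroot does not change under restriction, so that \<open>perp A\<close> is the set of coroots of the restricted system.
\<close>

lemma is_coroot_sub:
  assumes "orth A" "h \<in> perp A"
  shows "is_coroot (subX A) (subR A) (restrict_functional (subX A) (rt h)) h"
proof -
  let ?r = "\<lambda>k. restrict_functional (subX A) (rt k)"
  have hH: "h \<in> coroots X R" using assms perp_in_H by blast
  have rh: "?r h h = 2" using rt_restrict[OF assms(2) perp_subX[OF assms(2)]] norm_nz[OF hH] by simp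
  have map: "?r k - ?r k h *\<^sub>R ?r h = ?r (refl h k)" "refl h k \<in> perp A" if k: "k \<in> perp A" for k
  proof -
    interpret P: reflection_system form "perp A" by (rule perp_system)
    show "refl h k \<in> perp A" using P.refl_closed assms(2) k by blast
    have kH: "k \<in> coroots X R" using k perp_in_H by blast
    have hX: "h \<in> subX A" using perp_subX assms(2) by blast
    then have hXX: "h \<in> X" using subX_X by blast
    have "refl h k = cr (rt k - rt k h *\<^sub>R rt h)"
      using cr_refl[OF rt(1)[OF hH] rt(1)[OF kH]] refl_cr[OF rt(1)[OF hH], of k] rt(2)[OF hH] rt(2)[OF kH]
        pr(3)[OF cr_X[OF rt(1)[OF kH]]] by simp
    then have "rt (refl h k) = rt k - rt k h *\<^sub>R rt h"
      using rt_cr root_refl[OF rt(1)[OF hH] rt(1)[OF kH]] rt(2)[OF hH] by simp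
    then show "?r k - ?r k h *\<^sub>R ?r h = ?r (refl h k)"
      using hX by (simp add: restrict_functional_def fun_eq_iff)
  qed
  have "(\<lambda>\<beta>. \<beta> - \<beta> h *\<^sub>R ?r h) ` subR A = subR A"
  proof (rule image_eq_of_involution)
    show "(\<lambda>\<beta>. \<beta> - \<beta> h *\<^sub>R ?r h) ` subR A \<subseteq> subR A"
      using map by (auto simp: subR_def)
    fix \<beta> assume "\<beta> \<in> subR A"
    show "\<beta> - \<beta> h *\<^sub>R ?r h - (\<beta> - \<beta> h *\<^sub>R ?r h) h *\<^sub>R ?r h = \<beta>" using rh by (simp add: fun_eq_iff)
  qed
  then show ?thesis using perp_subX[OF assms(2)] rh by (simp add: is_coroot_def)
qed

lemma root_system_sub: assumes "orth A" shows "root_system (subX A) (subR A)"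
  unfolding root_system_def
proof (intro conjI ballI allI impI)
  let ?r = "\<lambda>k. restrict_functional (subX A) (rt k)"
  show "finite_dim_subspace (subX A)" by (rule finite_dim_subX)
  show "finite (subR A)" using finite_perp by (simp add: subR_def)
  show "span (subR A) = dual_space (subX A)" by (rule span_subR[OF assms])
  then show "subR A \<subseteq> dual_space (subX A)" using span_superset by blast
  have r2: "?r h h = 2" if "h \<in> perp A" for h
    using is_coroot_sub[OF assms that] by (simp add: is_coroot_def)
  then show "0 \<notin> subR A" by (force simp: subR_def)
  fix \<alpha> assume "\<alpha> \<in> subR A"
  then obtain h where h: "h \<in> perp A" "\<alpha> = ?r h" by (auto simp: subR_def)
  show "\<exists>h. is_coroot (subX A) (subR A) \<alpha> h \<and> (\<forall>\<beta>\<in>subR A. \<beta> h \<in> \<int>)"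
  proof (intro exI[of _ h] conjI ballI)
    show "is_coroot (subX A) (subR A) \<alpha> h" using is_coroot_sub[OF assms h(1)] h(2) by simp
    fix \<beta> assume "\<beta> \<in> subR A"
    then obtain k where k: "k \<in> perp A" "\<beta> = ?r k" by (auto simp: subR_def)
    then show "\<beta> h \<in> \<int>"
      using cartan_integer[OF rt(1) rt(1), of h k] rt(2)[of h] perp_in_H h(1) perp_subX[OF h(1)]
      by (simp add: restrict_functional_def)
  qed
  fix t :: real assume "t *\<^sub>R \<alpha> \<in> subR A"
  then obtain k where k: "k \<in> perp A" "t *\<^sub>R ?r h = ?r k" using h(2) by (auto simp: subR_def)
  have hk: "h \<in> coroots X R" "k \<in> coroots X R" using h k perp_in_H by blast+
  have ext: "rt j x = rt j (proj A x)" if "j \<in> perp A" "x \<in> X" for j x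
    using that rt_form perp_in_H proj_X[OF assms] ip_perp_proj by simp
  have "rt k = t *\<^sub>R rt h"
  proof
    fix x show "rt k x = (t *\<^sub>R rt h) x"
    proof (cases "x \<in> X")
      case True
      have "?r k (proj A x) = t * ?r h (proj A x)" using fun_cong[OF k(2), of "proj A x"] by simp
      then show ?thesis using ext[OF h(1) True] ext[OF k(1) True] proj_subX[OF assms True]
        by (simp add: restrict_functional_def)
    next
      case False
      then have "rt k x = 0" "rt h x = 0" using dual_space_outside rt_dual hk by blast+
      then show ?thesis by simp
    qed
  qed
  then show "t = 1 \<or> t = -1" using R_reduced[OF rt(1)[OF hk(1)], of t] rt(1)[OF hk(2)] by simp
qed

lemma coroot_sub:
  assumes "orth A" "h \<in> perp A"
  shows "coroot (subX A) (subR A) (restrict_functional (subX A) (rt h)) = h"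
proof -
  interpret S: root_datum "subX A" "subR A" by unfold_locales (rule root_system_sub[OF assms(1)])
  show ?thesis using is_coroot_sub[OF assms] assms(2) by (intro S.coroot_eqI) (auto simp: subR_def)
qed

lemma coroots_sub: "orth A \<Longrightarrow> coroots (subX A) (subR A) = perp A"
  using coroot_sub by (auto simp: coroots_def subR_def image_image)

lemma minus_one_sub: assumes "orth A" shows "minus_one_in_weyl (subX A) (subR A)"
proof -
  have "\<exists>w'\<in>weyl_group (subX A) (subR A). \<forall>x\<in>subX A. w x \<in> subX A \<and> w' x = w x"
    if "w \<in> group_of (perp A)" for w using that
  proof induction
    case group_id then show ?case using weyl_group.id by (metis id_apply)
  next
    case (group_refl h w)
    then obtain w' where w': "w' \<in> weyl_group (subX A) (subR A)" "\<forall>x\<in>subX A. w x \<in> subX A \<and> w' x = w x" by blast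
    let ?r = "restrict_functional (subX A) (rt h)"
    have r: "?r \<in> subR A" using group_refl by (simp add: subR_def)
    have refl: "reflection (subX A) (subR A) ?r x = refl h x" "refl h x \<in> subX A" if "x \<in> subX A" for x
    proof -
      show "reflection (subX A) (subR A) ?r x = refl h x"
        using rt_restrict[OF group_refl(1) that]
        by (simp add: reflection_def coroot_sub[OF assms group_refl(1)] refl_def ip_sym[of x])
      show "refl h x \<in> subX A"
        unfolding refl_def using that perp_subX[OF group_refl(1)] subspace_subX
        by (intro subspace_diff subspace_scale) auto
    qed
    have "(refl h \<circ> w) x \<in> subX A \<and> (reflection (subX A) (subR A) ?r \<circ> w') x = (refl h \<circ> w) x"
      if "x \<in> subX A" for x using w'(2) that refl by simp
    then show ?case using weyl_group.reflection[OF r w'(1)] by blast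
  qed
  moreover obtain w where "w \<in> group_of (perp A)" "\<forall>x\<in>subX A. w x = - x"
    using minus_one_perp[OF assms] span_coroots by (auto simp: subX_def)
  ultimately show ?thesis unfolding minus_one_in_weyl_def by metis
qed

text \<open>
  The constants of the restricted systems, as functions of all points of \<open>X\<close> and \<open>X\<^sup>*\<close>.
\<close>

definition ds_value :: "('a set \<Rightarrow> ('a \<Rightarrow> real) set \<Rightarrow> 'a \<Rightarrow> ('a \<Rightarrow> real) \<Rightarrow> int) \<Rightarrow> 'a set \<Rightarrow> 'a \<Rightarrow> ('a \<Rightarrow> real) \<Rightarrow> int"
  where "ds_value c A x lam = c (subX A) (subR A) (proj A x) (restrict_functional (subX A) lam)"

lemma rt_proj:
  assumes "orth A" "h \<in> perp A" "x \<in> X"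
  shows "restrict_functional (subX A) (rt h) (proj A x) = 2 / form h h * form h x"
  using rt_restrict[OF assms(2) proj_subX[OF assms(1,3)]] ip_perp_proj[OF assms(2)] by simp

lemma regular_sub:
  assumes "orth A" "x \<in> X" "reg (perp A) x" shows "proj A x \<in> regular (subX A) (subR A)"
proof -
  have "restrict_functional (subX A) (rt h) (proj A x) \<noteq> 0" if "h \<in> perp A" for h
    using rt_proj[OF assms(1) that assms(2)] assms(3) norm_nz[OF perp_in_H[OF that]] that
    by (auto simp: reg_def ip_sym[of x])
  then show ?thesis using proj_subX[OF assms(1,2)] by (auto simp: regular_def subR_def)
qed

lemma dual_regular_sub:
  assumes "orth A" "lam \<in> dual_space X" "\<And>h. h \<in> perp A \<Longrightarrow> lam h \<noteq> 0"
  shows "restrict_functional (subX A) lam \<in> dual_regular (subX A) (subR A)"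
  using restrict_in_dual[OF assms(2) subspace_X subspace_subX subX_X] assms(3) perp_subX
  by (auto simp: dual_regular_def coroots_sub[OF assms(1)] restrict_functional_def)

lemma ds_value_empty:
  assumes c: "stable_ds_constants c" and "orth A" "perp A = {}" "x \<in> X" "lam \<in> dual_space X"
  shows "ds_value c A x lam = 1"
proof -
  have "x = 0" if "x \<in> subX A" for x using orth_complete[OF assms(2,3)] that span_coroots by (simp add: subX_def)
  then have s: "subX A = {0}" using subspace_0[OF subspace_subX] by blast
  moreover have "subR A = {}" by (simp add: subR_def assms(3))
  moreover have "proj A x = 0" using proj_subX[OF assms(2,4)] s by blast
  moreover have "restrict_functional {0} lam = 0"
    using dual_space_zero[OF assms(5) subspace_X] by (auto simp: restrict_functional_def fun_eq_iff)
  ultimately show ?thesis using c by (simp add: ds_value_def stable_ds_constants_def)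
qed

lemma ds_value_support:
  assumes c: "stable_ds_constants c" and "orth A" "x \<in> X" "lam \<in> dual_space X"
    "reg (perp A) x" "\<And>h. h \<in> perp A \<Longrightarrow> lam h \<noteq> 0" "lam (proj A x) > 0"
  shows "ds_value c A x lam = 0"
proof -
  have "\<not> restrict_functional (subX A) lam (proj A x) \<le> 0"
    using assms(7) proj_subX[OF assms(2,3)] by (simp add: restrict_functional_def)
  then show ?thesis
    using c root_system_sub[OF assms(2)] minus_one_sub[OF assms(2)] regular_sub[OF assms(2,3,5)]
      dual_regular_sub[OF assms(2,4,6)]
    unfolding ds_value_def stable_ds_constants_def by blast
qed

text \<open>
  Since the given point of the segment lies on the hyperplane of \<open>\<beta>\<close>, projecting it orthogonally to \<open>A\<close>
  also projects it orthogonally to \<open>insert \<beta> A\<close>.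
\<close>

lemma ds_value_wall:
  assumes c: "stable_ds_constants c" and A: "orth A" and X: "x \<in> X" "x' \<in> X" and lam: "lam \<in> dual_space X"
    "\<And>h. h \<in> perp A \<Longrightarrow> lam h \<noteq> 0" and adj: "adjacent (perp A) \<beta> x x'"
    and t: "0 \<le> t" "t \<le> 1" "form ((1 - t) *\<^sub>R x + t *\<^sub>R x') \<beta> = 0"
  shows "ds_value c A x lam + ds_value c A x' lam = 2 * ds_value c (insert \<beta> A) ((1 - t) *\<^sub>R x + t *\<^sub>R x') lam"
proof -
  let ?z = "(1 - t) *\<^sub>R x + t *\<^sub>R x'" and ?b = "insert \<beta> A"
  let ?r = "\<lambda>k. restrict_functional (subX A) (rt k)"
  have \<beta>: "\<beta> \<in> perp A" using adj by (simp add: adjacent_def)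
  have ob: "orth ?b" using orth_insert A \<beta> by blast
  have zX: "?z \<in> X" using X subspace_X by (simp add: subspace_add subspace_scale)
  have n: "form h h > 0" if "h \<in> perp A" for h using norm_pos[OF perp_in_H[OF that]] .
  have ker: "?r h v = 0 \<longleftrightarrow> form v h = 0" if "h \<in> perp A" "v \<in> subX A" for h v
    using rt_restrict[OF that] n[OF that(1)] ip_sym[of h v] by simp
  have Y: "subX ?b = {v\<in>subX A. ?r \<beta> v = 0}"
    using ker[OF \<beta>] by (auto simp: subX_def)
  have sign: "?r h (proj A x) * ?r h (proj A x') = (2 / form h h)\<^sup>2 * (form x h * form x' h)" if "h \<in> perp A" for h
    using rt_proj[OF A that] X by (simp add: power2_eq_square ip_sym[of h x] ip_sym[of h x'])
  have n2: "(2 / form h h)\<^sup>2 > 0" if "h \<in> perp A" for h using n[OF that] by simp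
  have sep: "separated_only_by (subX A) (subR A) (?r \<beta>) (proj A x) (proj A x')"
    unfolding separated_only_by_def
  proof (intro conjI ballI impI)
    show "?r \<beta> (proj A x) * ?r \<beta> (proj A x') < 0"
      unfolding sign[OF \<beta>] using n2[OF \<beta>] adj by (simp only: adjacent_def mult_pos_neg)
    fix \<delta> assume \<delta>: "\<delta> \<in> subR A" "{z \<in> subX A. \<delta> z = 0} \<noteq> {z \<in> subX A. ?r \<beta> z = 0}"
    then obtain k where k: "k \<in> perp A" "\<delta> = ?r k" by (auto simp: subR_def)
    have "k \<noteq> \<beta>" "k \<noteq> - \<beta>" using \<delta>(2) k ker[OF k(1)] ker[OF \<beta>] by auto
    then have "form x k * form x' k > 0" using adj k(1) by (simp add: adjacent_def)
    then show "\<delta> (proj A x) * \<delta> (proj A x') > 0"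
      unfolding k(2) sign[OF k(1)] using n2[OF k(1)] by (rule mult_pos_pos[rotated])
  qed
  have pz: "proj A ?z = (1 - t) *\<^sub>R proj A x + t *\<^sub>R proj A x'"
    by (simp add: proj_def ip_linear add_divide_distrib scaleR_add_left sum.distrib
          scaleR_diff_right scaleR_sum_right)
  have pb: "proj ?b ?z = proj A ?z"
    using t(3) perp_notin[OF \<beta>] orth_finite[OF A] by (simp add: proj_def)
  have "proj A ?z \<in> subX ?b" using proj_subX[OF ob zX] pb by simp
  moreover have "proj A ?z \<in> closed_segment (proj A x) (proj A x')"
    unfolding pz closed_segment_def using t by blast
  ultimately have mem: "proj A ?z \<in> subX ?b \<inter> closed_segment (proj A x) (proj A x')" by blast
  have coroots: "coroots (subX ?b) (subR ?b) = coroots (subX A) (subR A) \<inter> subX ?b"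
    unfolding coroots_sub[OF A] coroots_sub[OF ob]
    using perp_subX[of _ A] perp_subX[of _ ?b] by (auto simp: perp_insert subX_def)
  have regs: "proj A x \<in> regular (subX A) (subR A)" "proj A x' \<in> regular (subX A) (subR A)"
    using regular_sub[OF A] X adjacent_reg[OF adj] by blast+
  have r\<beta>: "?r \<beta> \<in> subR A" using \<beta> by (simp add: subR_def)
  have "c (subX A) (subR A) (proj A x) (restrict_functional (subX A) lam)
      + c (subX A) (subR A) (proj A x') (restrict_functional (subX A) lam)
      = 2 * c (subX ?b) (subR ?b) (proj A ?z) (restrict_functional (subX ?b) (restrict_functional (subX A) lam))"
    using c root_system_sub[OF A] minus_one_sub[OF A] regs dual_regular_sub[OF A lam] r\<beta> sep Y
      root_system_sub[OF ob] coroots mem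
    unfolding stable_ds_constants_def by blast
  moreover have "restrict_functional (subX ?b) (restrict_functional (subX A) lam) = restrict_functional (subX ?b) lam"
    by (auto simp: restrict_functional_def fun_eq_iff subX_def)
  ultimately show ?thesis unfolding ds_value_def pb by simp
qed

text \<open>
  The recursion may be carried over from another reflection system, with points \<open>x\<close> represented in \<open>X\<close>
  by \<open>\<phi>\<close> and points \<open>y\<close> represented in \<open>X\<^sup>*\<close> by \<open>\<psi>\<close>, as long as hyperplanes, signs and the
  pairing correspond. The coefficients \<open>a\<close> and \<open>b\<close> absorb the different normalizations of roots and
  coroots; their relation to the norms makes the projections correspond. This is used for \<open>R\<close> itself, and
  for the dual root system with the same source system.
\<close>

lemma ds_recursion_transfer:
  fixes ip :: "'w::real_vector \<Rightarrow> 'w \<Rightarrow> real"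
  assumes M: "minus_one_system ip H" and c: "stable_ds_constants c"
    and \<kappa>: "bij_betw \<kappa> H (coroots X R)" "\<And>h. h \<in> H \<Longrightarrow> \<kappa> (- h) = - \<kappa> h"
      "\<And>h k. h \<in> H \<Longrightarrow> k \<in> H \<Longrightarrow> form (\<kappa> h) (\<kappa> k) = 0 \<longleftrightarrow> ip h k = 0"
    and \<phi>: "linear \<phi>" "\<And>x. \<phi> x \<in> X" "\<And>h x. h \<in> H \<Longrightarrow> form (\<kappa> h) (\<phi> x) = a h * ip h x"
    and \<psi>: "\<And>y. \<psi> y \<in> dual_space X" "\<And>h y. h \<in> H \<Longrightarrow> \<psi> y (\<kappa> h) = b h * ip h y"
    and ab: "\<And>h. h \<in> H \<Longrightarrow> a h > 0 \<and> b h > 0 \<and> a h * b h / form (\<kappa> h) (\<kappa> h) = 1 / ip h h"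
    and pairing: "\<And>x y. \<psi> y (\<phi> x) = ip x y"
  shows "minus_one_system.ds_recursion ip H (\<lambda>A x y. real_of_int (ds_value c (\<kappa> ` A) (\<phi> x) (\<psi> y)))"
proof -
  interpret M: minus_one_system ip H by (rule M)
  have orth: "orth (\<kappa> ` A)" if "M.orth A" for A
  proof -
    have AH: "A \<subseteq> H" using that by (simp add: M.orth_def)
    have "form (\<kappa> a) (\<kappa> b) = 0" if "a \<in> A" "b \<in> A" "\<kappa> a \<noteq> \<kappa> b" for a b
    proof -
      have "a \<noteq> b" using that(3) by blast
      then have "ip a b = 0" using \<open>M.orth A\<close> that(1,2) by (simp add: M.orth_def)
      then show ?thesis using \<kappa>(3)[of a b] that AH by blast
    qed
    moreover have "\<kappa> ` A \<subseteq> coroots X R" using AH \<kappa>(1) by (auto simp: bij_betw_def)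
    ultimately show ?thesis by (auto simp: orth_def)
  qed
  have perp: "perp (\<kappa> ` A) = \<kappa> ` M.perp A" if "M.orth A" for A
  proof -
    have "A \<subseteq> H" using that by (simp add: M.orth_def)
    then have "\<kappa> h \<in> perp (\<kappa> ` A) \<longleftrightarrow> h \<in> M.perp A" if "h \<in> H" for h
    proof -
      have "\<kappa> h \<in> coroots X R" using \<kappa>(1) that by (auto simp: bij_betw_def)
      moreover have "form (\<kappa> h) (\<kappa> k) = 0 \<longleftrightarrow> ip h k = 0" if "k \<in> A" for k
        using \<kappa>(3)[OF \<open>h \<in> H\<close>] \<open>A \<subseteq> H\<close> that by blast
      ultimately show ?thesis using that by (simp add: perp_def M.perp_def)
    qed
    moreover have "perp (\<kappa> ` A) \<subseteq> \<kappa> ` H" using perp_subset \<kappa>(1) by (simp add: bij_betw_def)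
    moreover have "M.perp A \<subseteq> H" by (rule M.perp_subset)
    ultimately show ?thesis by blast
  qed
  have inH: "h \<in> H" if "h \<in> M.perp A" for h A using that M.perp_subset by blast
  have form_\<phi>: "form (\<phi> x) (\<kappa> h) = a h * ip x h" if "h \<in> H" for x h
    using \<phi>(3)[OF that, of x] ip_sym M.ip_sym by metis
  have reg: "reg (perp (\<kappa> ` A)) (\<phi> x)" if "M.orth A" "M.reg (M.perp A) x" for A x
    unfolding perp[OF that(1)] reg_def
  proof
    fix k assume "k \<in> \<kappa> ` M.perp A"
    then obtain h where h: "h \<in> M.perp A" "k = \<kappa> h" by blast
    then show "form (\<phi> x) k \<noteq> 0" using form_\<phi>[OF inH[OF h(1)], of x] ab[OF inH[OF h(1)]] that(2) by (auto simp: M.reg_def)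
  qed
  have dreg: "\<psi> y h \<noteq> 0" if A: "M.orth A" and y: "M.reg (M.perp A) y" and h: "h \<in> perp (\<kappa> ` A)" for A y h
  proof -
    obtain k where k: "k \<in> M.perp A" "h = \<kappa> k" using h perp[OF A] by blast
    then show ?thesis using \<psi>(2)[OF inH[OF k(1)], of y] ab[OF inH[OF k(1)]] y M.ip_sym[of k y] by (auto simp: M.reg_def)
  qed
  have proj: "\<psi> y (proj (\<kappa> ` A) (\<phi> x)) = ip x (M.proj A y)" if A: "M.orth A" for A x y
  proof -
    have AH: "A \<subseteq> H" using A by (simp add: M.orth_def)
    have inj: "inj_on \<kappa> A" using bij_betw_imp_inj_on[OF \<kappa>(1)] AH by (rule inj_on_subset)
    have \<kappa>X: "\<kappa> h \<in> X" if "h \<in> A" for h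
      using that AH \<kappa>(1) span_coroots span_base unfolding bij_betw_def by blast
    let ?g = "\<lambda>h. (form (\<phi> x) (\<kappa> h) / form (\<kappa> h) (\<kappa> h)) *\<^sub>R \<kappa> h"
    have sumX: "sum ?g B \<in> X \<and> \<psi> y (sum ?g B) = (\<Sum>h\<in>B. form (\<phi> x) (\<kappa> h) / form (\<kappa> h) (\<kappa> h) * \<psi> y (\<kappa> h))"
      if "B \<subseteq> A" for B
      using M.orth_finite[OF A, THEN finite_subset[OF that]] that
    proof (induction B)
      case empty
      then show ?case using subspace_0[OF subspace_X] dual_space_zero[OF \<psi>(1) subspace_X] by simp
    next
      case (insert h B)
      have "?g h \<in> X" using \<kappa>X insert.prems subspace_X subspace_scale by blast
      then show ?case
        using insert dual_spaceD(1)[OF \<psi>(1) subspace_X, of "?g h" "sum ?g B" y]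
          dual_spaceD(2)[OF \<psi>(1) subspace_X \<kappa>X, of h y] subspace_add[OF subspace_X]
        by simp
    qed
    have "\<psi> y (proj (\<kappa> ` A) (\<phi> x)) = \<psi> y (\<phi> x - sum ?g A)"
      by (simp add: proj_def sum.reindex[OF inj] o_def)
    also have "\<dots> = ip x y - (\<Sum>h\<in>A. form (\<phi> x) (\<kappa> h) / form (\<kappa> h) (\<kappa> h) * \<psi> y (\<kappa> h))"
      using dual_spaceD(3)[OF \<psi>(1) subspace_X \<phi>(2)] sumX[of A] pairing by simp
    also have "(\<Sum>h\<in>A. form (\<phi> x) (\<kappa> h) / form (\<kappa> h) (\<kappa> h) * \<psi> y (\<kappa> h)) = (\<Sum>h\<in>A. ip y h / ip h h * ip x h)"
    proof (rule sum.cong)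
      fix h assume "h \<in> A"
      then have h: "h \<in> H" using AH by blast
      have "form (\<phi> x) (\<kappa> h) / form (\<kappa> h) (\<kappa> h) * \<psi> y (\<kappa> h)
          = (a h * b h / form (\<kappa> h) (\<kappa> h)) * (ip x h * ip h y)"
        using form_\<phi>[OF h] \<psi>(2)[OF h] by simp
      then show "form (\<phi> x) (\<kappa> h) / form (\<kappa> h) (\<kappa> h) * \<psi> y (\<kappa> h) = ip y h / ip h h * ip x h"
        using ab[OF h] M.ip_sym[of h y] by simp
    qed simp
    also have "ip x y - (\<Sum>h\<in>A. ip y h / ip h h * ip x h) = ip x (M.proj A y)"
      by (simp add: M.proj_def M.ip_diff M.ip_sum_right M.ip_scale_right)
    finally show ?thesis .
  qed
  have adj: "adjacent (perp (\<kappa> ` A)) (\<kappa> \<beta>) (\<phi> x) (\<phi> x')" if A: "M.orth A" and adj: "M.adjacent (M.perp A) \<beta> x x'" for A \<beta> x x'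
    unfolding adjacent_def perp[OF A]
  proof (intro conjI ballI impI)
    have \<beta>: "\<beta> \<in> M.perp A" "\<beta> \<in> H" using adj M.perp_subset by (auto simp: M.adjacent_def)
    show "\<kappa> \<beta> \<in> \<kappa> ` M.perp A" using \<beta> by blast
    have *: "form (\<phi> x) (\<kappa> h) * form (\<phi> x') (\<kappa> h) = (a h)\<^sup>2 * (ip x h * ip x' h)" "(a h)\<^sup>2 > 0" if "h \<in> H" for h
      using form_\<phi>[OF that] ab[OF that] by (simp_all add: power2_eq_square)
    show "form (\<phi> x) (\<kappa> \<beta>) * form (\<phi> x') (\<kappa> \<beta>) < 0"
      unfolding *(1)[OF \<beta>(2)] using *(2)[OF \<beta>(2)] adj by (simp only: M.adjacent_def mult_pos_neg)
    fix k assume k: "k \<in> \<kappa> ` M.perp A" "k \<noteq> \<kappa> \<beta>" "k \<noteq> - \<kappa> \<beta>"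
    then obtain h where h: "h \<in> M.perp A" "k = \<kappa> h" "h \<noteq> \<beta>" "h \<noteq> - \<beta>" using \<kappa>(2)[OF \<beta>(2)] by blast
    then have "ip x h * ip x' h > 0" using adj by (simp add: M.adjacent_def)
    then show "form (\<phi> x) k * form (\<phi> x') k > 0"
      unfolding h(2) *(1)[OF inH[OF h(1)]] using *(2)[OF inH[OF h(1)]] by (rule mult_pos_pos[rotated])
  qed
  show ?thesis
    unfolding M.ds_recursion_def
  proof (intro allI impI conjI)
    fix A x y assume "M.orth A" "M.perp A = {}"
    then show "real_of_int (ds_value c (\<kappa> ` A) (\<phi> x) (\<psi> y)) = 1"
      using ds_value_empty[OF c orth] perp \<phi>(2) \<psi>(1) by simp
  next
    fix A x y assume *: "M.orth A" "M.reg (M.perp A) x" "M.reg (M.perp A) y" "ip x (M.proj A y) > 0"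
    have "ds_value c (\<kappa> ` A) (\<phi> x) (\<psi> y) = 0"
      by (rule ds_value_support[OF c orth \<phi>(2) \<psi>(1) reg dreg]) (use * proj in auto)
    then show "real_of_int (ds_value c (\<kappa> ` A) (\<phi> x) (\<psi> y)) = 0" by simp
  next
    fix A \<beta> x x' y and t :: real
    assume A: "M.orth A" and a: "M.adjacent (M.perp A) \<beta> x x'" and y: "M.reg (M.perp A) y"
      and t: "0 \<le> t" "t \<le> 1" "ip ((1 - t) *\<^sub>R x + t *\<^sub>R x') \<beta> = 0"
    have \<beta>: "\<beta> \<in> H" using a M.perp_subset by (auto simp: M.adjacent_def)
    have z: "\<phi> ((1 - t) *\<^sub>R x + t *\<^sub>R x') = (1 - t) *\<^sub>R \<phi> x + t *\<^sub>R \<phi> x'"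
      by (simp add: linear_add[OF \<phi>(1)] linear_cmul[OF \<phi>(1)])
    have "form ((1 - t) *\<^sub>R \<phi> x + t *\<^sub>R \<phi> x') (\<kappa> \<beta>) = 0"
      using form_\<phi>[OF \<beta>, of "(1 - t) *\<^sub>R x + t *\<^sub>R x'"] t(3) unfolding z by simp
    then have "ds_value c (\<kappa> ` A) (\<phi> x) (\<psi> y) + ds_value c (\<kappa> ` A) (\<phi> x') (\<psi> y)
        = 2 * ds_value c (insert (\<kappa> \<beta>) (\<kappa> ` A)) ((1 - t) *\<^sub>R \<phi> x + t *\<^sub>R \<phi> x') (\<psi> y)"
      by (intro ds_value_wall[OF c orth[OF A] \<phi>(2) \<phi>(2) \<psi>(1) dreg[OF A y] adj[OF A a] t(1,2)]) auto
    then show "real_of_int (ds_value c (\<kappa> ` A) (\<phi> x) (\<psi> y)) + real_of_int (ds_value c (\<kappa> ` A) (\<phi> x') (\<psi> y))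
        = 2 * real_of_int (ds_value c (\<kappa> ` insert \<beta> A) (\<phi> ((1 - t) *\<^sub>R x + t *\<^sub>R x')) (\<psi> y))"
      unfolding z image_insert by (metis of_int_add of_int_mult of_int_numeral)
  qed
qed

end

section \<open>The dual root system\<close>

context root_datum_minus
begin

lemma bidual_apply: "f \<in> dual_space X \<Longrightarrow> bidual X x f = f x"
  by (simp add: bidual_def restrict_functional_def)

lemma bidual_dual: assumes "x \<in> X" shows "bidual X x \<in> dual_space (dual_space X)"
  unfolding bidual_def restrict_functional_def dual_space_def[of "dual_space X"]
  using subspace_dual_space[of X] by (auto simp: subspace_add subspace_scale)

lemma dual_roots_eq: "dual_roots X R = bidual X ` coroots X R"
  by (simp add: dual_roots_def)

lemma bidual_rt: "h \<in> coroots X R \<Longrightarrow> bidual X x (rt h) = rt h x"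
  using bidual_apply rt_dual by blast

lemma bidual_in_span:
  assumes "v \<in> span (coroots X R)" shows "v \<in> X \<and> bidual X v \<in> span (dual_roots X R)"
  using assms
proof (induction rule: span_induct_alt)
  case base
  have "bidual X 0 = 0"
    using dual_space_zero[OF _ subspace_X] by (auto simp: bidual_def restrict_functional_def fun_eq_iff)
  then show ?case using span_zero subspace_0[OF subspace_X] by metis
next
  case (step c h v)
  have X: "h \<in> X" "c *\<^sub>R h \<in> X" "v \<in> X"
    using step coroot_X subspace_scale[OF subspace_X] by blast+
  have "bidual X (c *\<^sub>R h + v) = c *\<^sub>R bidual X h + bidual X v"
    using dual_spaceD(1)[OF _ subspace_X X(2,3)] dual_spaceD(2)[OF _ subspace_X X(1)]
    by (auto simp: bidual_def restrict_functional_def fun_eq_iff)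
  moreover have "c *\<^sub>R bidual X h + bidual X v \<in> span (dual_roots X R)"
    using step by (intro span_add[OF span_scale[OF span_base]]) (simp_all add: dual_roots_eq)
  ultimately show ?case using subspace_add[OF subspace_X X(2,3)] by (simp only: simp_thms)
qed

text \<open>
  A functional \<open>\<Phi>\<close> on \<open>X\<^sup>*\<close>, pulled back to \<open>X\<close> along \<open>\<iota>\<close>, is the inner product with some
  \<open>v\<close>, and then \<open>\<Phi>\<close> is evaluation at \<open>v\<close>, which is a combination of coroots.
\<close>

lemma span_dual_roots: "span (dual_roots X R) = dual_space (dual_space X)"
proof
  show "span (dual_roots X R) \<subseteq> dual_space (dual_space X)"
    using bidual_dual coroot_X by (intro span_minimal subspace_dual_space) (auto simp: dual_roots_eq)
  show "dual_space (dual_space X) \<subseteq> span (dual_roots X R)"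
  proof
    fix \<Phi> assume \<Phi>: "\<Phi> \<in> dual_space (dual_space X)"
    have "restrict_functional X (\<lambda>x. \<Phi> (\<iota> x)) \<in> dual_space X"
      using dual_spaceD(1,2)[OF \<Phi> subspace_dual_space \<iota>_dual] \<iota>_dual subspace_X
      by (auto simp: restrict_functional_def dual_space_def[of X] \<iota>_linear subspace_add subspace_scale)
    then obtain v where v: "v \<in> X" "\<iota> v = restrict_functional X (\<lambda>x. \<Phi> (\<iota> x))" using \<iota>_surj by blast
    have "\<Phi> f = bidual X v f" for f
    proof (cases "f \<in> dual_space X")
      case True
      then obtain y where y: "y \<in> X" "\<iota> y = f" using \<iota>_surj by blast
      have "\<Phi> f = \<iota> v y" using v(2) y by (simp add: restrict_functional_def)
      also have "\<dots> = f v" using y \<iota>_apply v(1) ip_sym by metis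
      finally show ?thesis using bidual_apply[OF True] by simp
    next
      case False
      then show ?thesis using dual_space_outside[OF \<Phi>] by (simp add: bidual_def restrict_functional_def)
    qed
    then have "\<Phi> = bidual X v" by (rule ext)
    then show "\<Phi> \<in> span (dual_roots X R)" using bidual_in_span v(1) span_coroots by simp
  qed
qed

lemma is_coroot_dual:
  assumes h: "h \<in> coroots X R" shows "is_coroot (dual_space X) (dual_roots X R) (bidual X h) (rt h)"
proof -
  note r = rt[OF h]
  have rr: "bidual X k - bidual X k (rt h) *\<^sub>R bidual X h = bidual X (refl h k)" if k: "k \<in> coroots X R" for k
  proof
    fix f
    have e: "refl h k = k - rt h k *\<^sub>R h" using refl_cr[OF r(1), of k] r(2) pr(3)[OF coroot_X[OF k]] by simp
    show "(bidual X k - bidual X k (rt h) *\<^sub>R bidual X h) f = bidual X (refl h k) f"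
    proof (cases "f \<in> dual_space X")
      case True
      have "f (refl h k) = f k - rt h k * f h"
        unfolding e using dual_spaceD(3)[OF True subspace_X coroot_X[OF k], of "rt h k *\<^sub>R h"]
          dual_spaceD(2)[OF True subspace_X coroot_X[OF h]] coroot_X[OF h] subspace_X
        by (simp add: subspace_scale)
      then show ?thesis using True bidual_rt[OF h] by (simp add: bidual_apply)
    next
      case False then show ?thesis by (simp add: bidual_def restrict_functional_def)
    qed
  qed
  have two: "bidual X h (rt h) = 2" using bidual_rt[OF h, of h] cr_2[OF r(1)] r(2) by simp
  have "(\<lambda>\<Psi>. \<Psi> - \<Psi> (rt h) *\<^sub>R bidual X h) ` dual_roots X R = dual_roots X R"
  proof (rule image_eq_of_involution)
    show "(\<lambda>\<Psi>. \<Psi> - \<Psi> (rt h) *\<^sub>R bidual X h) ` dual_roots X R \<subseteq> dual_roots X R"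
      using rr refl_closed[OF h] by (auto simp: dual_roots_eq)
    show "\<Psi> - \<Psi> (rt h) *\<^sub>R bidual X h - (\<Psi> - \<Psi> (rt h) *\<^sub>R bidual X h) (rt h) *\<^sub>R bidual X h = \<Psi>" for \<Psi>
      using two by (simp add: fun_eq_iff)
  qed
  then show ?thesis using rt_dual[OF h] two by (simp add: is_coroot_def)
qed

lemma bidual_scale_inj:
  assumes "h \<in> X" "k \<in> X" "t *\<^sub>R bidual X h = bidual X k" shows "k = t *\<^sub>R h"
proof -
  have "\<gamma> (k - t *\<^sub>R h) = 0" if \<gamma>: "\<gamma> \<in> R" for \<gamma>
  proof -
    have "t * \<gamma> h = \<gamma> k" using fun_cong[OF assms(3), of \<gamma>] \<gamma> R_dual bidual_apply by (simp add: subset_eq)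
    then show ?thesis
      using root_linear(3)[OF \<gamma> assms(2) subspace_scale[OF subspace_X assms(1)]] root_linear(2)[OF \<gamma> assms(1)] by simp
  qed
  moreover have "k - t *\<^sub>R h \<in> X" using assms subspace_X by (simp add: subspace_diff subspace_scale)
  ultimately have "k - t *\<^sub>R h = 0" using roots_separate by blast
  then show ?thesis by simp
qed

lemma dual_root_system: "root_system (dual_space X) (dual_roots X R)"
  unfolding root_system_def
proof (intro conjI ballI allI impI)
  show "finite_dim_subspace (dual_space X)" using finite_R span_R by (auto simp: finite_dim_subspace_def)
  show "finite (dual_roots X R)" using finite_H by (simp add: dual_roots_eq)
  show sp: "span (dual_roots X R) = dual_space (dual_space X)" by (rule span_dual_roots)
  show "dual_roots X R \<subseteq> dual_space (dual_space X)" unfolding sp[symmetric] by (rule span_superset)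
  have "bidual X h \<noteq> 0" if "h \<in> coroots X R" for h
    using is_coroot_dual[OF that] by (auto simp: is_coroot_def)
  then show "0 \<notin> dual_roots X R" by (force simp: dual_roots_eq)
  fix \<alpha> assume "\<alpha> \<in> dual_roots X R"
  then obtain h where h: "h \<in> coroots X R" "\<alpha> = bidual X h" by (auto simp: dual_roots_eq)
  show "\<exists>h. is_coroot (dual_space X) (dual_roots X R) \<alpha> h \<and> (\<forall>\<beta>\<in>dual_roots X R. \<beta> h \<in> \<int>)"
  proof (intro exI[of _ "rt h"] conjI ballI)
    show "is_coroot (dual_space X) (dual_roots X R) \<alpha> (rt h)" using is_coroot_dual h by simp
    fix \<beta> assume "\<beta> \<in> dual_roots X R"
    then obtain k where k: "k \<in> coroots X R" "\<beta> = bidual X k" by (auto simp: dual_roots_eq)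
    then show "\<beta> (rt h) \<in> \<int>"
      using cartan_integer[OF rt(1)[OF k(1)] rt(1)[OF h(1)]] rt(2)[OF k(1)] bidual_rt[OF h(1)] by simp
  qed
  fix t :: real assume "t *\<^sub>R \<alpha> \<in> dual_roots X R"
  then obtain k where k: "k \<in> coroots X R" "t *\<^sub>R bidual X h = bidual X k" using h(2) by (auto simp: dual_roots_eq)
  then have "k = t *\<^sub>R h" using bidual_scale_inj coroot_X h(1) by blast
  then show "t = 1 \<or> t = -1" using reduced[OF h(1), of t] k(1) by simp
qed

lemma dual_coroot:
  assumes "h \<in> coroots X R" shows "coroot (dual_space X) (dual_roots X R) (bidual X h) = rt h"
proof -
  interpret D: root_datum "dual_space X" "dual_roots X R" by unfold_locales (rule dual_root_system)
  show ?thesis using is_coroot_dual[OF assms] assms by (intro D.coroot_eqI) (auto simp: dual_roots_eq)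
qed

lemma dual_coroots: "coroots (dual_space X) (dual_roots X R) = R"
proof -
  have "coroots (dual_space X) (dual_roots X R) = rt ` coroots X R"
    using dual_coroot by (auto simp: coroots_def[of "dual_space X"] dual_roots_eq image_image)
  also have "\<dots> = R" using rt_cr by (auto simp: coroots_def image_image)
  finally show ?thesis .
qed

text \<open>
  The identification \<open>\<iota>\<close> intertwines the reflections of \<open>R\<close> and those of \<open>R\<^sup>\<or>\<close>.
\<close>

lemma dual_minus_one: "minus_one_in_weyl (dual_space X) (dual_roots X R)"
proof -
  have "\<exists>w'\<in>weyl_group (dual_space X) (dual_roots X R). \<forall>y\<in>X. w' (\<iota> y) = \<iota> (w y)"
    if "w \<in> group_of (coroots X R)" for w using that
  proof induction
    case group_id then show ?case using weyl_group.id by (metis id_apply)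
  next
    case (group_refl h w)
    then obtain w' where w': "w' \<in> weyl_group (dual_space X) (dual_roots X R)" "\<forall>y\<in>X. w' (\<iota> y) = \<iota> (w y)" by blast
    let ?B = "bidual X h"
    have B: "?B \<in> dual_roots X R" using group_refl by (simp add: dual_roots_eq)
    have "reflection (dual_space X) (dual_roots X R) ?B (\<iota> y) = \<iota> (refl h y)" if y: "y \<in> X" for y
    proof -
      have hX: "h \<in> X" by (rule coroot_X[OF group_refl(1)])
      have "?B (\<iota> y) = form y h" using bidual_apply[OF \<iota>_dual] \<iota>_apply[OF hX] by simp
      then have "reflection (dual_space X) (dual_roots X R) ?B (\<iota> y) = \<iota> y - form y h *\<^sub>R rt h"
        by (simp add: reflection_def dual_coroot[OF group_refl(1)])
      also have "\<iota> (refl h y) = \<iota> y + (- (2 * form y h / form h h)) *\<^sub>R \<iota> h"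
        unfolding refl_def using \<iota>_linear(1)[of y "(- (2 * form y h / form h h)) *\<^sub>R h"] \<iota>_linear(2)[of "- (2 * form y h / form h h)" h]
        by simp
      then have "\<iota> y - form y h *\<^sub>R rt h = \<iota> (refl h y)"
        unfolding \<iota>_coroot[OF group_refl(1)] using norm_nz[OF group_refl(1)] by simp
      finally show ?thesis .
    qed
    then have "(reflection (dual_space X) (dual_roots X R) ?B \<circ> w') (\<iota> y) = \<iota> ((refl h \<circ> w) y)" if "y \<in> X" for y
      using w'(2) that group_X[OF group_refl(2)] by simp
    then show ?case using weyl_group.reflection[OF B w'(1)] by blast
  qed
  moreover obtain w where w: "w \<in> group_of (coroots X R)" "\<forall>x\<in>X. w x = - x" using minus_one_group by blast
  ultimately obtain w' where w': "w' \<in> weyl_group (dual_space X) (dual_roots X R)" "\<forall>y\<in>X. w' (\<iota> y) = \<iota> (w y)" by blast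
  have "w' f = - f" if "f \<in> dual_space X" for f
  proof -
    obtain y where y: "y \<in> X" "\<iota> y = f" using \<iota>_surj[OF \<open>f \<in> dual_space X\<close>] by blast
    have "w' (\<iota> y) = \<iota> (w y)" using w'(2) y(1) by blast
    then have "w' f = \<iota> (- y)" using w(2) y by simp
    also have "\<dots> = - f" using \<iota>_linear(2)[of "-1" y] y(2) by simp
    finally show ?thesis .
  qed
  then show ?thesis using w'(1) unfolding minus_one_in_weyl_def by blast
qed

lemma linear_\<iota>: "linear \<iota>"
  by (rule linearI) (rule \<iota>_linear)+

lemma ds_recursion_direct:
  assumes "stable_ds_constants c"
  shows "ds_recursion (\<lambda>A x y. real_of_int (ds_value c A (pr x) (\<iota> y)))"
proof -
  have "ds_recursion (\<lambda>A x y. real_of_int (ds_value c (id ` A) (pr x) (\<iota> y)))"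
  proof (rule ds_recursion_transfer[OF minus_one_system_axioms assms, where a = "\<lambda>_. 1" and b = "\<lambda>_. 1"])
    show "bij_betw id (coroots X R) (coroots X R)" by simp
    show "\<iota> y (id h) = 1 * form h y" if "h \<in> coroots X R" for h y
      using \<iota>_apply[OF coroot_X[OF that]] ip_sym by simp
    show "\<iota> y (pr x) = form x y" for x y using \<iota>_apply[OF pr(2)] ip_sym by simp
  qed (use pr \<iota>_dual in simp_all)
  then show ?thesis by simp
qed

text \<open>
  Through \<open>\<iota>\<close>, the point \<open>x\<close> becomes an element of \<open>X\<^sup>*\<close>, the ambient space of \<open>R\<^sup>\<or>\<close>, and \<open>y\<close>
  becomes a functional on it. The coroots of \<open>R\<^sup>\<or>\<close> are the roots of \<open>R\<close>, which \<open>\<iota>\<close>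
  identifies with positive multiples of the coroots.
\<close>

lemma ds_recursion_dual:
  fixes c :: "('a \<Rightarrow> real) set \<Rightarrow> (('a \<Rightarrow> real) \<Rightarrow> real) set \<Rightarrow> ('a \<Rightarrow> real) \<Rightarrow> (('a \<Rightarrow> real) \<Rightarrow> real) \<Rightarrow> int"
  assumes "stable_ds_constants c"
  shows "ds_recursion (\<lambda>A x y. real_of_int
    (root_datum_minus.ds_value (dual_space X) (dual_roots X R) c (rt ` A) (\<iota> x) (bidual X (pr y))))"
proof -
  interpret D: root_datum_minus "dual_space X" "dual_roots X R"
    by unfold_locales (rule dual_root_system dual_minus_one)+
  have Dform: "D.form (rt h) f = D.form (rt h) (rt h) / 2 * f h" if h: "h \<in> coroots X R" and f: "f \<in> dual_space X" for h f
    using D.form_cr[of "bidual X h" f] dual_coroot[OF h] h bidual_apply[OF f] D.pr(3)[OF f]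
    by (simp add: dual_roots_eq)
  have Dpos: "D.form (rt h) (rt h) > 0" if "h \<in> coroots X R" for h
    using D.norm_pos rt(1)[OF that] dual_coroots by simp
  show ?thesis
  proof (rule D.ds_recursion_transfer[OF minus_one_system_axioms assms,
        where a = "\<lambda>h. D.form (rt h) (rt h) / 2" and b = "\<lambda>h. 2 / form h h"])
    show "bij_betw rt (coroots X R) (coroots (dual_space X) (dual_roots X R))"
      unfolding dual_coroots
      by (rule bij_betwI[of _ _ _ cr]) (use rt rt_cr in \<open>auto simp: coroots_def\<close>)
    show "rt (- h) = - rt h" if "h \<in> coroots X R" for h by (rule rt_neg[OF that])
    show "D.form (rt h) (rt k) = 0 \<longleftrightarrow> form h k = 0" if "h \<in> coroots X R" "k \<in> coroots X R" for h k
      using Dform[OF that(1) rt_dual[OF that(2)]] Dpos[OF that(1)] rt_form[OF that(2) coroot_X[OF that(1)]]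
        norm_pos[OF that(2)] ip_sym[of k h] by simp
    show "linear \<iota>" by (rule linear_\<iota>)
    show "\<iota> x \<in> dual_space X" for x by (rule \<iota>_dual)
    show "D.form (rt h) (\<iota> x) = D.form (rt h) (rt h) / 2 * form h x" if "h \<in> coroots X R" for h x
      using Dform[OF that \<iota>_dual] \<iota>_apply[OF coroot_X[OF that]] ip_sym[of x h] by simp
    show "bidual X (pr y) \<in> dual_space (dual_space X)" for y by (rule bidual_dual[OF pr(2)])
    show "bidual X (pr y) (rt h) = 2 / form h h * form h y" if "h \<in> coroots X R" for h y
      using bidual_rt[OF that] rt_form[OF that pr(2)] by simp
    show "D.form (rt h) (rt h) / 2 > 0 \<and> 2 / form h h > 0 \<and>
        D.form (rt h) (rt h) / 2 * (2 / form h h) / D.form (rt h) (rt h) = 1 / form h h" if "h \<in> coroots X R" for h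
      using Dpos[OF that] norm_pos[OF that] by simp
    show "bidual X (pr y) (\<iota> x) = form x y" for x y
      using bidual_apply[OF \<iota>_dual] \<iota>_apply[OF pr(2)] by simp
  qed
qed

lemma ds_value_whole:
  assumes "x \<in> X" "lam \<in> dual_space X" shows "ds_value c {} x lam = c X R x lam"
proof -
  have "subX {} = X" by (simp add: subX_def)
  moreover have "subR {} = R"
  proof -
    have "restrict_functional X (rt h) = rt h" if "h \<in> coroots X R" for h
      using restrict_self rt_dual that by blast
    then have "subR {} = rt ` coroots X R" by (simp add: subR_def \<open>subX {} = X\<close> image_image cong: image_cong_simp)
    also have "\<dots> = R" using rt_cr by (auto simp: coroots_def image_image)
    finally show ?thesis .
  qed
  moreover have "proj {} x = x" by (simp add: proj_def)
  ultimately show ?thesis using restrict_self[OF assms(2)] by (simp add: ds_value_def)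
qed

lemma weyl_props:
  assumes "w \<in> weyl_group X R"
  shows "bij w \<and> (\<forall>x. x \<notin> X \<longrightarrow> w x = x) \<and> (\<forall>x\<in>X. w x \<in> X) \<and> inv w \<in> weyl_group X R"
  using assms
proof induction
  case id
  then show ?case using weyl_group.id bij_id inv_id by (metis id_apply)
next
  case (reflection \<alpha> w)
  let ?s = "reflection X R \<alpha>"
  note \<alpha> = reflection.hyps(1)
  have out: "?s x = x" if "x \<notin> X" for x
    using that \<alpha> R_dual dual_space_outside[of \<alpha> X x] by (auto simp: reflection_def)
  have sX: "?s x \<in> X" if "x \<in> X" for x using reflection_eq refl_X \<alpha> that by simp
  have ss: "?s (?s x) = x" for x
  proof (cases "x \<in> X")
    case True
    then show ?thesis using reflection_eq[OF \<alpha>] sX refl_refl[of "cr \<alpha>"] form_cr_pos[OF \<alpha>] by simp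
  qed (simp add: out)
  have bij_s: "bij ?s" by (rule bijI[OF inj_on_inverseI[of _ ?s] surjI[of _ ?s]]) (rule ss)+
  have inv_s: "inv ?s = ?s" by (rule inv_equality) (rule ss)+
  have right: "v \<circ> ?s \<in> weyl_group X R" if "v \<in> weyl_group X R" for v using that
  proof induction
    case id then show ?case using weyl_group.reflection[OF \<alpha> weyl_group.id] by simp
  next
    case (reflection \<beta> v)
    then show ?case unfolding comp_assoc by (intro weyl_group.reflection)
  qed
  have "bij (?s \<circ> w)" using reflection bij_s bij_comp by blast
  moreover have "inv (?s \<circ> w) = inv w \<circ> ?s" using reflection bij_s inv_s by (simp add: o_inv_distrib)
  moreover have "(?s \<circ> w) x = x" if "x \<notin> X" for x using reflection that out by simp
  moreover have "(?s \<circ> w) x \<in> X" if "x \<in> X" for x using reflection that sX by simp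
  ultimately show ?case using right reflection by metis
qed

lemma reflections_Cons:
  "foldr (\<circ>) (map (reflection X R) (\<alpha> # \<alpha>s)) id = reflection X R \<alpha> \<circ> foldr (\<circ>) (map (reflection X R) \<alpha>s) id"
  by (simp only: list.map foldr_Cons o_apply)

lemma reflections_to_word:
  assumes "set \<alpha>s \<subseteq> R" "x \<in> X"
  shows "foldr (\<circ>) (map (reflection X R) \<alpha>s) id x = word (map cr \<alpha>s) x
    \<and> foldr (\<circ>) (map (reflection X R) \<alpha>s) id x \<in> X"
  using assms(1)
proof (induction \<alpha>s)
  case Nil
  then show ?case using assms(2) by simp
next
  case (Cons \<alpha> \<alpha>s)
  let ?w = "foldr (\<circ>) (map (reflection X R) \<alpha>s) id"
  have "\<alpha> \<in> R" "?w x = word (map cr \<alpha>s) x" "?w x \<in> X"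
    using Cons.IH Cons.prems unfolding list.set insert_subset by blast+
  then have "(reflection X R \<alpha> \<circ> ?w) x = refl (cr \<alpha>) (word (map cr \<alpha>s) x)"
    "refl (cr \<alpha>) (word (map cr \<alpha>s) x) \<in> X"
    using reflection_eq refl_X by simp_all
  moreover have "word (map cr (\<alpha> # \<alpha>s)) x = refl (cr \<alpha>) (word (map cr \<alpha>s) x)" by simp
  ultimately show ?case unfolding reflections_Cons by (simp only: simp_thms)
qed

lemma weyl_sign_eq:
  assumes "w \<in> weyl_group X R" "x \<in> X" "reg (coroots X R) x"
  shows "real_of_int (weyl_sign X R w) = rel_sign (coroots X R) x (w x)"
proof -
  let ?P = "\<lambda>n. \<exists>\<alpha>s. length \<alpha>s = n \<and> set \<alpha>s \<subseteq> R \<and> w = foldr (\<circ>) (map (reflection X R) \<alpha>s) id"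
  have "\<exists>n. ?P n" using assms(1)
  proof induction
    case id then show ?case by (intro exI[of _ 0] exI[of _ "[]"]) simp
  next
    case (reflection \<alpha> w)
    then obtain \<alpha>s where "set \<alpha>s \<subseteq> R" "w = foldr (\<circ>) (map (reflection X R) \<alpha>s) id" by blast
    then have "set (\<alpha> # \<alpha>s) \<subseteq> R" "reflection X R \<alpha> \<circ> w = foldr (\<circ>) (map (reflection X R) (\<alpha> # \<alpha>s)) id"
      using reflection(1) reflections_Cons by simp_all
    then show ?case by blast
  qed
  then have "?P (LEAST n. ?P n)" by (rule LeastI_ex)
  then obtain \<alpha>s where \<alpha>s: "length \<alpha>s = (LEAST n. ?P n)" "set \<alpha>s \<subseteq> R"
    "w = foldr (\<circ>) (map (reflection X R) \<alpha>s) id" by blast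
  have "w x = word (map cr \<alpha>s) x" using reflections_to_word[OF \<alpha>s(2) assms(2)] \<alpha>s(3) by simp
  moreover have "rel_sign (coroots X R) x (word (map cr \<alpha>s) x) = (-1) ^ length (map cr \<alpha>s)"
    using \<alpha>s(2) by (intro rel_sign_word[OF _ assms(3)]) (auto simp: coroots_def)
  ultimately show ?thesis using \<alpha>s(1) by (simp add: weyl_sign_def)
qed

lemma ds_recursion_group_invariant:
  assumes F: "ds_recursion F" and "w \<in> group_of (coroots X R)" "reg (coroots X R) x" "reg (coroots X R) y"
  shows "F {} (w x) (w y) = F {} x y"
  using assms(2)
proof induction
  case (group_refl h w)
  then show ?case
    using ds_recursion_invariant[OF F group_refl(1), of "w x" "w y"] reg_group assms(3,4) by simp
qed simp

end

section \<open>The symmetry of the constants\<close>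

context root_datum_minus
begin

lemma weyl_group_rep:
  assumes "w \<in> weyl_group X R"
  obtains w' where "w' \<in> group_of (coroots X R)" "\<And>x. x \<in> X \<Longrightarrow> w x = w' x" "\<And>x. x \<in> X \<Longrightarrow> inv w x = inv w' x"
proof -
  obtain w' where w': "w' \<in> group_of (coroots X R)" "\<forall>x\<in>X. w x = w' x" using weyl_to_group[OF assms] by blast
  have "inv w x = inv w' x" if x: "x \<in> X" for x
  proof -
    have "inv w' x \<in> X" using group_X[OF group_inv[OF w'(1)] x] .
    then have "w (inv w' x) = x" using w' group_inv_apply[OF w'(1)] by simp
    then show ?thesis using weyl_props[OF assms] bij_is_inj inv_f_f by metis
  qed
  then show thesis using that w' by blast
qed

lemma dual_action_\<iota>:
  assumes "w \<in> weyl_group X R" "y \<in> X" shows "dual_action w (\<iota> y) = \<iota> (w y)"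
proof
  fix v
  obtain w' where w': "w' \<in> group_of (coroots X R)" "\<And>x. x \<in> X \<Longrightarrow> w x = w' x" "\<And>x. x \<in> X \<Longrightarrow> inv w x = inv w' x"
    using weyl_group_rep[OF assms(1)] by blast
  show "dual_action w (\<iota> y) v = \<iota> (w y) v"
  proof (cases "v \<in> X")
    case True
    then have "\<iota> y (inv w' v) = form y (inv w' v)" using \<iota>_apply group_X[OF group_inv[OF w'(1)]] by blast
    also have "\<dots> = form (w' y) v" using group_adjoint[OF w'(1)] by simp
    finally show ?thesis using True w' assms(2) by (simp add: dual_action_def \<iota>_apply)
  next
    case False
    then have "inv w v = v" using weyl_props[OF assms(1)] bij_is_inj inv_f_f by metis
    then show ?thesis using False by (simp add: dual_action_def \<iota>_def restrict_functional_def)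
  qed
qed

lemma d_fun_eq:
  assumes "w \<in> weyl_group X R" "x \<in> X" "y \<in> X"
  shows "d_fun c X R x (\<iota> y) w = ds_value c {} (pr x) (\<iota> (w y))"
  using assms by (simp add: d_fun_def dual_action_\<iota> ds_value_whole \<iota>_dual pr(3))

lemma d_dual_eq:
  assumes "w \<in> weyl_group X R" "x \<in> X" "y \<in> X"
  shows "d_dual c X R x (\<iota> y) w
    = root_datum_minus.ds_value (dual_space X) (dual_roots X R) c (rt ` {}) (\<iota> y) (bidual X (pr (w x)))"
proof -
  interpret D: root_datum_minus "dual_space X" "dual_roots X R"
    by unfold_locales (rule dual_root_system dual_minus_one)+
  have "w x \<in> X" using weyl_props assms by blast
  then show ?thesis by (simp add: d_dual_def D.ds_value_whole \<iota>_dual bidual_dual pr(3))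
qed

text \<open>
  In terms of the inner product, both the chamber and the dual chamber are described by the signs of a single
  regular point.
\<close>

lemma chamber_representative:
  assumes "C \<in> weyl_chambers X R"
  obtains z where "z \<in> X" "reg (coroots X R) z"
    "\<And>x. x \<in> C \<Longrightarrow> x \<in> X \<and> same_chamber (coroots X R) z x"
    "positive_roots R C = rt ` {h\<in>coroots X R. form h z > 0}"
proof -
  obtain z where z: "z \<in> regular X R" and C: "C = {y\<in>X. \<forall>\<alpha>\<in>R. \<alpha> z * \<alpha> y > 0}"
    using assms by (auto simp: weyl_chambers_def)
  have zX: "z \<in> X" using z by (simp add: regular_def)
  have nz: "\<alpha> z \<noteq> 0" if "\<alpha> \<in> R" for \<alpha> using z that by (simp add: regular_def)
  have rts: "rt h v = 2 / form h h * form v h" if "h \<in> coroots X R" "v \<in> X" for h v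
    using rt_form[OF that] ip_sym[of h v] by simp
  have rz: "reg (coroots X R) z"
    unfolding reg_def using nz[OF rt(1)] rts[OF _ zX] by fastforce
  have same: "x \<in> X \<and> same_chamber (coroots X R) z x" if x: "x \<in> C" for x
  proof -
    have xX: "x \<in> X" using x C by simp
    have "form z h * form x h > 0" if h: "h \<in> coroots X R" for h
    proof -
      have "0 < rt h z * rt h x" using x C rt(1)[OF h] by blast
      also have "rt h z * rt h x = (2 / form h h)\<^sup>2 * (form z h * form x h)"
        using rts[OF h zX] rts[OF h xX] by (simp add: power2_eq_square)
      finally show ?thesis by (simp add: zero_less_mult_iff not_less[symmetric])
    qed
    then show ?thesis using xX by (simp add: same_chamber_def)
  qed
  have zC: "z \<in> C" using nz not_real_square_gt_zero zX C by blast
  have pos_iff: "rt h z > 0 \<longleftrightarrow> form h z > 0" if "h \<in> coroots X R" for h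
    using rts[OF that zX] norm_pos[OF that] ip_sym[of h z] by (simp add: zero_less_divide_iff)
  have "positive_roots R C = {\<alpha>\<in>R. \<alpha> z > 0}"
  proof (intro equalityI subsetI)
    fix \<alpha> assume "\<alpha> \<in> positive_roots R C"
    then show "\<alpha> \<in> {\<alpha>\<in>R. \<alpha> z > 0}" using zC by (simp add: positive_roots_def)
  next
    fix \<alpha> assume \<alpha>: "\<alpha> \<in> {\<alpha>\<in>R. \<alpha> z > 0}"
    have "\<alpha> x > 0" if "x \<in> C" for x
    proof -
      have "\<alpha> z * \<alpha> x > 0" using that C \<alpha> by blast
      then show ?thesis using \<alpha> by (simp add: zero_less_mult_iff)
    qed
    then show "\<alpha> \<in> positive_roots R C" using \<alpha> by (simp add: positive_roots_def)
  qed
  also have "\<dots> = rt ` {h\<in>coroots X R. form h z > 0}"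
  proof (intro equalityI subsetI)
    fix \<alpha> assume \<alpha>: "\<alpha> \<in> {\<alpha>\<in>R. \<alpha> z > 0}"
    then have "cr \<alpha> \<in> coroots X R" "\<alpha> = rt (cr \<alpha>)" using rt_cr by (auto simp: coroots_def)
    then show "\<alpha> \<in> rt ` {h\<in>coroots X R. form h z > 0}" using pos_iff[of "cr \<alpha>"] \<alpha> by auto
  next
    fix \<alpha> assume "\<alpha> \<in> rt ` {h\<in>coroots X R. form h z > 0}"
    then show "\<alpha> \<in> {\<alpha>\<in>R. \<alpha> z > 0}" using rt(1) pos_iff by auto
  qed
  finally show thesis using that zX rz same by blast
qed

lemma q_of_eq:
  assumes "reg (coroots X R) z" "positive_roots R C = rt ` {h\<in>coroots X R. form h z > 0}"
  shows "q_of X R C = q_exponent {}"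
proof -
  have "inj_on rt (coroots X R)" using rt(2) by (metis inj_onI)
  then have "card (positive_roots R C) = card {h\<in>coroots X R. form h z > 0}"
    unfolding assms(2) by (intro card_image) (rule inj_on_subset, auto)
  moreover have "card (coroots X R) = 2 * card {h\<in>coroots X R. form h z > 0}"
  proof -
    have "form h z \<noteq> 0" if "h \<in> coroots X R" for h using assms(1) that ip_sym[of h z] by (simp add: reg_def)
    then have none: "{h\<in>coroots X R. form h z = 0} = {}" by blast
    show ?thesis using card_split[of z] unfolding none by simp
  qed
  moreover have "dim X = dim (coroots X R)" using span_coroots dim_span by metis
  ultimately have "q_of X R C = (c + d) div 2" "q_exponent {} = (2 * c + 2 * d) div 4"
    if "c = card (positive_roots R C)" "d = dim X" for c d
    using that by (simp_all add: q_of_def q_exponent_def)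
  then show ?thesis by simp
qed

text \<open>
  With \<open>z\<close> in the chamber, all constants that are compared are values of one solution \<open>F\<close> of the recursion:
  \<open>d(w) = F {} z (w z)\<close>, also \<open>d\<^sup>\<or>(w) = F {} z (w z)\<close> by uniqueness, and
  \<open>d(w\<^sup>-\<^sup>1) = F {} z (w\<^sup>-\<^sup>1 z) = F {} (w z) z\<close> by invariance, to which the symmetry of \<open>F\<close> applies.
\<close>

theorem stable_constants_symmetry:
  assumes c: "stable_ds_constants c" and c': "stable_ds_constants c'"
    and C: "C \<in> weyl_chambers X R" and w: "w \<in> weyl_group X R"
  shows "\<exists>v. (\<forall>x\<in>C. \<forall>lam\<in>dual_chamber X R C. d_fun c X R x lam w = v w \<and> d_dual c' X R x lam w = v w
      \<and> d_fun c X R x lam (inv w) = (-1) ^ q_of X R C * weyl_sign X R w * v w)"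
proof -
  let ?H = "coroots X R"
  obtain z where z: "z \<in> X" "reg ?H z" and Cz: "\<And>x. x \<in> C \<Longrightarrow> x \<in> X \<and> same_chamber ?H z x"
    and pos: "positive_roots R C = rt ` {h\<in>?H. form h z > 0}"
    using chamber_representative[OF C] by blast
  have C'z: "\<exists>y\<in>X. \<iota> y = lam \<and> same_chamber ?H z y" if lam: "lam \<in> dual_chamber X R C" for lam
  proof -
    obtain y where y: "y \<in> X" "\<iota> y = lam" using \<iota>_surj lam by (auto simp: dual_chamber_def)
    have p: "form y h > 0" if h: "h \<in> ?H" "form h z > 0" for h
    proof -
      have "rt h \<in> positive_roots R C" using pos h by blast
      then have "lam (cr (rt h)) > 0" using lam by (simp add: dual_chamber_def)
      then show ?thesis using y(2) \<iota>_apply[OF coroot_X[OF h(1)], of y] rt(2)[OF h(1)] by simp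
    qed
    have "form z h * form y h > 0" if h: "h \<in> ?H" for h
    proof (cases "form h z > 0")
      case True
      then show ?thesis using p[OF h True] ip_sym[of z h] by simp
    next
      case False
      then have "form (- h) z > 0" using z(2) h ip_sym[of h z] by (simp add: reg_def less_le)
      then have "form z h < 0" "form y h < 0" using p[OF neg_closed[OF h]] ip_sym[of h z] by simp_all
      then show ?thesis by (rule mult_neg_neg)
    qed
    then show ?thesis using y by (auto simp: same_chamber_def)
  qed
  let ?F = "\<lambda>A x y. real_of_int (ds_value c A (pr x) (\<iota> y))"
  let ?G = "\<lambda>A x y. real_of_int
    (root_datum_minus.ds_value (dual_space X) (dual_roots X R) c' (rt ` A) (\<iota> x) (bidual X (pr y)))"
  have F: "ds_recursion ?F" by (rule ds_recursion_direct[OF c])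
  have G: "ds_recursion ?G" by (rule ds_recursion_dual[OF c'])
  have F_const: "?F {} x (u y) = ?F {} z (u z)"
    if u: "u \<in> group_of ?H" and xy: "same_chamber ?H z x" "same_chamber ?H z y" for u x y
  proof -
    have uy: "same_chamber ?H (u y) (u z)" using same_chamber_group[OF u] same_chamber_sym[OF xy(2)] .
    have "?F {} x (u y) = ?F {} x (u z)"
      using ds_recursion_same_y[OF F orth_empty] uy same_chamber_reg(2)[OF xy(1)] by simp
    also have "\<dots> = ?F {} z (u z)"
      using ds_recursion_same_x[OF F orth_empty] same_chamber_sym[OF xy(1)] reg_group[OF u z(2)] by simp
    finally show ?thesis .
  qed
  obtain w' where w': "w' \<in> group_of ?H" "\<And>x. x \<in> X \<Longrightarrow> w x = w' x" "\<And>x. x \<in> X \<Longrightarrow> inv w x = inv w' x"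
    using weyl_group_rep[OF w] by blast
  let ?v = "ds_value c {} (pr z) (\<iota> (w z))"
  have "d_fun c X R x lam w = ?v \<and> d_dual c' X R x lam w = ?v
      \<and> d_fun c X R x lam (inv w) = (-1) ^ q_of X R C * weyl_sign X R w * ?v"
    if x: "x \<in> C" and lam: "lam \<in> dual_chamber X R C" for x lam
  proof -
    have xX: "x \<in> X" and xz: "same_chamber ?H z x" using Cz[OF x] by blast+
    obtain y where y: "y \<in> X" "\<iota> y = lam" "same_chamber ?H z y" using C'z[OF lam] by blast
    have wX: "w x \<in> X" using weyl_props[OF w] xX by blast
    have d: "d_fun c X R x lam w = ?v"
      using d_fun_eq[OF w xX y(1), of c] F_const[OF w'(1) xz y(3)] w'(2) y z(1) by simp
    have "real_of_int (d_dual c' X R x lam w) = ?G {} y (w x)"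
      using d_dual_eq[OF w xX y(1), of c'] y(2) by simp
    also have "\<dots> = ?F {} y (w x)"
      using ds_recursion_unique[OF G F orth_empty] same_chamber_reg(2)[OF y(3)]
        reg_group[OF w'(1) same_chamber_reg(2)[OF xz]] w'(2)[OF xX] by simp
    also have "\<dots> = real_of_int ?v" using F_const[OF w'(1) y(3) xz] w'(2) xX z(1) by simp
    finally have d': "d_dual c' X R x lam w = ?v" by simp
    have iw: "inv w \<in> weyl_group X R" using weyl_props[OF w] by blast
    have iw': "inv w' \<in> group_of ?H" by (rule group_inv[OF w'(1)])
    have "real_of_int (d_fun c X R x lam (inv w)) = ?F {} x (inv w' y)"
      using d_fun_eq[OF iw xX y(1), of c] w'(3) y by simp
    also have "\<dots> = ?F {} z (inv w' z)" by (rule F_const[OF iw' xz y(3)])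
    also have "\<dots> = ?F {} (w' z) (w' (inv w' z))"
      using ds_recursion_group_invariant[OF F w'(1) z(2) reg_group[OF iw' z(2)]] by simp
    also have "w' (inv w' z) = z" by (rule group_inv_apply(2)[OF w'(1)])
    also have "?F {} (w' z) z = (-1) ^ q_exponent {} * rel_sign (perp {}) (w' z) z * ?F {} z (w' z)"
      using reg_group[OF w'(1) z(2)] z(2) by (intro ds_recursion_swap[OF F orth_empty]) simp_all
    also have "rel_sign (perp {}) (w' z) z = real_of_int (weyl_sign X R w)"
      using weyl_sign_eq[OF w z] w'(2)[OF z(1)] rel_sign_commute by simp
    also have "q_exponent {} = q_of X R C" using q_of_eq[OF z(2) pos] by simp
    finally have "real_of_int (d_fun c X R x lam (inv w)) = real_of_int ((-1) ^ q_of X R C * weyl_sign X R w * ?v)"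
      using w'(2)[OF z(1)] by simp
    then show ?thesis using d d' of_int_eq_iff by blast
  qed
  then show ?thesis by (intro exI[of _ "\<lambda>_. ?v"]) blast
qed

end

theorem theorem3p2:
  fixes X :: "'a::real_vector set"
    and R :: "('a \<Rightarrow> real) set"
    and C0 :: "'a set"
    and x0 :: 'a
    and lam0 :: "'a \<Rightarrow> real"
    and c :: "'a set \<Rightarrow> ('a \<Rightarrow> real) set \<Rightarrow> 'a \<Rightarrow> ('a \<Rightarrow> real) \<Rightarrow> int"
    and c' :: "('a \<Rightarrow> real) set \<Rightarrow> (('a \<Rightarrow> real) \<Rightarrow> real) set \<Rightarrow>
                ('a \<Rightarrow> real) \<Rightarrow> (('a \<Rightarrow> real) \<Rightarrow> real) \<Rightarrow> int"
  assumes "stable_ds_constants c"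
    and "stable_ds_constants c'"
    and "root_system X R"
    and "minus_one_in_weyl X R"
    and "C0 \<in> weyl_chambers X R"
    and "x0 \<in> C0"
    and "lam0 \<in> dual_chamber X R C0"
  shows "\<forall>w\<in>weyl_group X R.
           (\<forall>x1\<in>C0. \<forall>lam1\<in>dual_chamber X R C0.
              d_fun c X R x1 lam1 w = d_fun c X R x0 lam0 w \<and>
              d_dual c' X R x1 lam1 w = d_dual c' X R x0 lam0 w) \<and>
           d_dual c' X R x0 lam0 w = d_fun c X R x0 lam0 w \<and>
           d_fun c X R x0 lam0 (inv w) =
             (-1) ^ q_of X R C0 * weyl_sign X R w * d_fun c X R x0 lam0 w"
proof
  fix w assume w: "w \<in> weyl_group X R"
  interpret root_datum_minus X R by unfold_locales (fact assms)+
  obtain v where v: "\<And>x lam. x \<in> C0 \<Longrightarrow> lam \<in> dual_chamber X R C0 \<Longrightarrow>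
      d_fun c X R x lam w = v w \<and> d_dual c' X R x lam w = v w
      \<and> d_fun c X R x lam (inv w) = (-1) ^ q_of X R C0 * weyl_sign X R w * v w"
    using stable_constants_symmetry[OF assms(1,2,5) w] by blast
  note v0 = v[OF assms(6,7)]
  show "(\<forall>x1\<in>C0. \<forall>lam1\<in>dual_chamber X R C0.
              d_fun c X R x1 lam1 w = d_fun c X R x0 lam0 w \<and>
              d_dual c' X R x1 lam1 w = d_dual c' X R x0 lam0 w) \<and>
           d_dual c' X R x0 lam0 w = d_fun c X R x0 lam0 w \<and>
           d_fun c X R x0 lam0 (inv w) =
             (-1) ^ q_of X R C0 * weyl_sign X R w * d_fun c X R x0 lam0 w"
    using v v0 by simp
qed

end
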